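(* If $\alpha$ is a (non-zero) rational number and $d$ is a positive integer, then $M_\infty(\alpha^{1/d})$ equals the largest prime dividing the numerator or denominator of $\alpha$.
   Context: For a number field $K$ and a place $v$ of $K$ dividing the place $p$ of $\mathbb{Q}$ (including $p=\infty$), let $\|\cdot\|_v$ be the unique absolute value on the completion $K_v$ extending the $p$-adic (usual, if $p=\infty$) absolute value on $\mathbb{Q}_p$, and put $|\alpha|_v = \|\alpha\|_v^{[K_v:\mathbb{Q}_p]/[K:\mathbb{Q}]}$ for $\alpha\in K$. The (absolute, multiplicative) Weil height of $\alpha \in K$ is $H(\alpha) = \prod_v \max\{1,|\alpha|_v\}$, the product being over all places $v$ of $K$; it does not depend on the choice of $K$ containing $\alpha$, so $H$ is a function on $\overline{\mathbb{Q}}$. The Mahler measure of $\alpha\in\overline{\mathbb{Q}}$ is $M(\alpha) = H(\alpha)^{\deg\alpha}$, where $\deg\alpha = [\mathbb{Q}(\alpha):\mathbb{Q}]$. Let $\mathcal{X}(\overline{\mathbb{Q}}^{\times})$ be the group of sequences $(\alpha_1,\alpha_2,\ldots)$ with $\alpha_n\in\overline{\mathbb{Q}}^{\times}$ and $\alpha_n = 1$ for all but finitely many $n$, and let $\tau:\mathcal{X}(\overline{\mathbb{Q}}^{\times})\to\overline{\mathbb{Q}}^{\times}$ be $\tau(\alpha_1,\alpha_2,\ldots) = \alpha_1\alpha_2\cdots$. For $\alpha\in\overline{\mathbb{Q}}^{\times}$ define the non-Archimedean (strong) metric Mahler measure $$M_\infty(\alpha) = \inf\left\{\max_{n\geq 1}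 M(\alpha_n) : (\alpha_1,\alpha_2,\ldots)\in\tau^{-1}(\alpha)\right\}.$$ Here $\alpha^{1/d}$ denotes any $d$-th root of $\alpha$ in $\overline{\mathbb{Q}}$; the choice does not matter, since any two differ by a root of unity and $M_\infty$ is invariant under multiplication by roots of unity. The numerator and denominator of $\alpha$ are those of $\alpha$ written in lowest terms. *)

theory Defs
  imports
    Complex_Main
    "HOL-Algebra.Embedded_Algebras"
    "HOL-Algebra.Generated_Fields"
    "HOL-Algebra.QuotRing"
    "HOL-Algebra.Algebraic_Closure_Type"
begin

text \<open>
  The algebraic closure of the rationals is taken inside the complex numbers, as the set of
  all complex numbers satisfying \<^const>\<open>algebraic\<close>; number fields are subfields \<open>K\<close> of the
  complex numbers that are finite over \<open>\<rat>\<close>, represented by their underlying sets.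
\<close>

abbreviation complex_field :: "complex ring" where
  "complex_field \<equiv> ring_of_type_algebra"

definition field_degree :: "complex set \<Rightarrow> nat" where
  "field_degree K = ring.dim complex_field \<rat> K"

definition Q_adjoin :: "complex \<Rightarrow> complex set" where
  "Q_adjoin \<alpha> = generate_field complex_field {\<alpha>}"

definition alg_degree :: "complex \<Rightarrow> nat" where
  "alg_degree \<alpha> = field_degree (Q_adjoin \<alpha>)"


section \<open>Places\<close>

definition padic_abs :: "nat \<Rightarrow> rat \<Rightarrow> real" where
  "padic_abs p q =
    (if q = 0 then 0
     else real p powi (int (multiplicity (int p) (snd (quotient_of q)))
                       - int (multiplicity (int p) (fst (quotient_of q)))))"

definition absolute_value_on :: "complex set \<Rightarrow> (complex \<Rightarrow> real) \<Rightarrow> bool" where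
  "absolute_value_on K v \<longleftrightarrow>
     (\<forall>x\<in>K. 0 \<le> v x \<and> (v x = 0 \<longleftrightarrow> x = 0)) \<and>
     (\<forall>x\<in>K. \<forall>y\<in>K. v (x * y) = v x * v y) \<and>
     (\<forall>x\<in>K. \<forall>y\<in>K. v (x + y) \<le> v x + v y)"

text \<open>
  Every place of \<open>K\<close> (equivalence class of nontrivial absolute values) contains exactly one
  absolute value restricting on \<open>\<rat>\<close> to the usual one or to the \<open>p\<close>-adic one for some prime
  \<open>p\<close>. This is the restriction to \<open>K\<close> of the absolute value on the completion that extends the
  one on \<open>\<rat>\<^sub>p\<close> (with \<open>\<rat>\<^sub>\<infinity> = \<real>\<close>), and it represents the place. Membership in
  \<^term>\<open>extensional K\<close> fixes the irrelevant values outside \<open>K\<close>, so that each place is counted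
  once.
\<close>

definition places :: "complex set \<Rightarrow> (complex \<Rightarrow> real) set" where
  "places K = {v \<in> extensional K. absolute_value_on K v \<and>
     ((\<forall>q::rat. v (of_rat q) = \<bar>of_rat q\<bar>) \<or>
      (\<exists>p::nat. Factorial_Ring.prime p \<and> (\<forall>q::rat. v (of_rat q) = padic_abs p q)))}"


section \<open>Completions and local degrees\<close>

text \<open>The completion \<open>K\<^sub>v\<close> is the ring of \<open>v\<close>-Cauchy sequences in \<open>K\<close> modulo the null sequences.\<close>

definition cauchy_seqs :: "complex set \<Rightarrow> (complex \<Rightarrow> real) \<Rightarrow> (nat \<Rightarrow> complex) set" where
  "cauchy_seqs K v = {s. range s \<subseteq> K \<and>
     (\<forall>e>0. \<exists>N. \<forall>m\<ge>N. \<forall>n\<ge>N. v (s m - s n) < e)}"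

definition cauchy_ring :: "complex set \<Rightarrow> (complex \<Rightarrow> real) \<Rightarrow> (nat \<Rightarrow> complex) ring" where
  "cauchy_ring K v =
    \<lparr> carrier = cauchy_seqs K v,
      monoid.mult = (\<lambda>s t n. s n * t n),
      one = (\<lambda>_. 1),
      ring.zero = (\<lambda>_. 0),
      add = (\<lambda>s t n. s n + t n) \<rparr>"

definition null_seqs :: "complex set \<Rightarrow> (complex \<Rightarrow> real) \<Rightarrow> (nat \<Rightarrow> complex) set" where
  "null_seqs K v = {s \<in> cauchy_seqs K v. (\<lambda>n. v (s n)) \<longlonglongrightarrow> 0}"

definition completion ::
    "complex set \<Rightarrow> (complex \<Rightarrow> real) \<Rightarrow> (nat \<Rightarrow> complex) set ring" where
  "completion K v = cauchy_ring K v Quot null_seqs K v"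

text \<open>
  The copy of \<open>\<rat>\<^sub>p\<close> (of \<open>\<real>\<close> for archimedean \<open>v\<close>) inside \<open>K\<^sub>v\<close>: the classes of Cauchy
  sequences of rational numbers, i.e. the closure of \<open>\<rat>\<close>.
\<close>

definition rational_completion ::
    "complex set \<Rightarrow> (complex \<Rightarrow> real) \<Rightarrow> (nat \<Rightarrow> complex) set set" where
  "rational_completion K v =
     (\<lambda>s. null_seqs K v +>\<^bsub>cauchy_ring K v\<^esub> s) ` {s \<in> cauchy_seqs K v. range s \<subseteq> \<rat>}"

definition local_degree :: "complex set \<Rightarrow> (complex \<Rightarrow> real) \<Rightarrow> nat" where
  "local_degree K v =
     ring.dim (completion K v) (rational_completion K v) (carrier (completion K v))"


section \<open>Weil height and Mahler measures\<close>

definition normalized_abs :: "complex set \<Rightarrow> (complex \<Rightarrow> real) \<Rightarrow> complex \<Rightarrow> real" where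
  "normalized_abs K v \<alpha> = v \<alpha> powr (real (local_degree K v) / real (field_degree K))"

text \<open>
  All but finitely many factors of the product over the places of \<open>K\<close> are \<open>1\<close>. As
  \<^const>\<open>prod\<close> over an infinite set is \<open>1\<close> by convention, the trivial factors are left out.
\<close>

definition weil_height_in :: "complex set \<Rightarrow> complex \<Rightarrow> real" where
  "weil_height_in K \<alpha> =
     (\<Prod>v \<in> {v \<in> places K. max 1 (normalized_abs K v \<alpha>) \<noteq> 1}. max 1 (normalized_abs K v \<alpha>))"

text \<open>
  The height of \<open>\<alpha>\<close> does not depend on the number field containing \<open>\<alpha>\<close> in which it is
  computed; we use the smallest one.
\<close>

definition weil_height :: "complex \<Rightarrow> real" where
  "weil_height \<alpha> = weil_height_in (Q_adjoin \<alpha>) \<alpha>"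

definition mahler_measure :: "complex \<Rightarrow> real" where
  "mahler_measure \<alpha> = weil_height \<alpha> ^ alg_degree \<alpha>"

definition alg_seqs :: "(nat \<Rightarrow> complex) set" where
  "alg_seqs = {a. (\<forall>n. algebraic (a n) \<and> a n \<noteq> 0) \<and> finite {n. a n \<noteq> 1}}"

definition seq_prod :: "(nat \<Rightarrow> complex) \<Rightarrow> complex" where
  "seq_prod a = (\<Prod>n \<in> {n. a n \<noteq> 1}. a n)"

text \<open>
  The set under \<^const>\<open>Max\<close> is finite because \<open>a n = 1\<close> for all but finitely many \<open>n\<close>.
\<close>

definition strong_metric_mahler :: "complex \<Rightarrow> real" where
  "strong_metric_mahler \<alpha> =
     Inf {Max (range (\<lambda>n. mahler_measure (a n))) | a. a \<in> alg_seqs \<and> seq_prod a = \<alpha>}"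


section \<open>Largest prime of a rational number\<close>

definition rat_primes :: "rat \<Rightarrow> nat set" where
  "rat_primes q = {p. Factorial_Ring.prime p \<and>
     (int p dvd fst (quotient_of q) \<or> int p dvd snd (quotient_of q))}"

text \<open>For \<open>q = 1\<close> and \<open>q = -1\<close> there is no such prime, and the value is \<open>1\<close> by convention.\<close>

definition largest_prime :: "rat \<Rightarrow> nat" where
  "largest_prime q = (if rat_primes q = {} then 1 else Max (rat_primes q))"

end

theory Submission
  imports Defs
begin

text \<open>
  Upper bound: up to a root of unity, \<open>\<beta>\<close> is a product of numbers \<open>q\<^bsup>1/d\<^esup>\<close> and \<open>q\<^bsup>-1/d\<^esup>\<close> with
  \<open>q\<close> a prime of \<open>\<alpha>\<close>. Such a number \<open>\<gamma>\<close> has absolute value \<open>q\<^bsup>1/d\<^esup> > 1\<close> at the places over a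
  single place of \<open>\<rat>\<close> only, and the local degrees there sum up to at most \<open>deg \<gamma> \<le> d\<close> by weak
  approximation, so \<open>M(\<gamma>) \<le> q\<close>.

  Lower bound: let \<open>p\<close> be the largest prime of \<open>\<alpha>\<close> and extend the \<open>p\<close>-adic absolute value to the
  algebraic numbers. As \<open>\<beta>\<close> is not a unit for it, neither is some factor \<open>\<gamma>\<close> of \<open>\<beta>\<close>, so \<open>p\<close>
  divides the first or the last coefficient of the primitive integral minimal polynomial of \<open>\<gamma>\<close>.
  Both are at most \<open>M(\<gamma>)\<close>: every conjugate of \<open>\<gamma>\<close> induces a place of \<open>\<rat>(\<gamma>)\<close>, at most \<open>[K\<^sub>v : \<rat>\<^sub>p]\<close>
  conjugates induce the same place \<open>v\<close>, and thus \<open>M(\<gamma>)\<close> is bounded from below by a product over the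
  conjugates, which Gauss's lemma evaluates at the finite places.
\<close>

section \<open>Absolute values on subfields of the complex numbers\<close>

text \<open>The local degree is a dimension over a completion, but it is computed by elements of
  \<open>K\<close>: a family whose rational combinations are \<open>v\<close>-dense in
  \<open>K\<close> and whose coefficients are bounded by a constant multiple of the combination.
  Both properties survive the passage to limits, so the length of such a family is the local degree,
  and later arguments never return to Cauchy sequences.

  The \<open>p\<close>-adic absolute value is extended by means of a subring of the algebraic
  numbers that is maximal among those without \<open>1 / p\<close>. It is a valuation ring. Since
  all numbers involved are algebraic over the rationals, every nonzero one has a power that is a
  unit times a power of \<open>p\<close>, so real values can be assigned.

  The strong metric Mahler measure takes the maximum over the factors. Repeating a factor is
  therefore free, and only the primes of \<alpha> matter, not their exponents.\<close>

locale complex_subring =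
  fixes K :: "complex set"
  assumes one_mem [simp]: "1 \<in> K"
    and diff_mem [simp]: "x \<in> K \<Longrightarrow> y \<in> K \<Longrightarrow> x - y \<in> K"
    and mult_mem [simp]: "x \<in> K \<Longrightarrow> y \<in> K \<Longrightarrow> x * y \<in> K"
begin

lemma zero_mem [simp]: "0 \<in> K"
  using diff_mem[OF one_mem one_mem] by simp

lemma uminus_mem [simp]: "x \<in> K \<Longrightarrow> - x \<in> K"
  using diff_mem[OF zero_mem] by fastforce

lemma add_mem [simp]: "x \<in> K \<Longrightarrow> y \<in> K \<Longrightarrow> x + y \<in> K"
  using diff_mem[of x "- y"] by simp

lemma power_mem [simp]: "x \<in> K \<Longrightarrow> x ^ n \<in> K"
  by (induction n) auto

lemma sum_mem [simp]: "(\<And>i. i \<in> A \<Longrightarrow> f i \<in> K) \<Longrightarrow> sum f A \<in> K"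
  by (induction A rule: infinite_finite_induct) auto

lemma prod_mem [simp]: "(\<And>i. i \<in> A \<Longrightarrow> f i \<in> K) \<Longrightarrow> prod f A \<in> K"
  by (induction A rule: infinite_finite_induct) auto

lemma of_nat_mem [simp]: "of_nat n \<in> K"
  by (induction n) auto

lemma of_int_mem [simp]: "of_int n \<in> K"
  by (cases n rule: int_cases2) auto

end

locale complex_subfield = complex_subring +
  assumes inverse_mem [simp]: "x \<in> K \<Longrightarrow> inverse x \<in> K"
begin

lemma divide_mem [simp]: "x \<in> K \<Longrightarrow> y \<in> K \<Longrightarrow> x / y \<in> K"
  by (simp add: divide_inverse)

lemma of_rat_mem [simp]: "of_rat q \<in> K"
  by (cases q) (auto simp: of_rat_rat)

lemma Rats_subset: "\<rat> \<subseteq> K"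
  by (auto elim: Rats_cases)

lemma Rats_mem [simp]: "x \<in> \<rat> \<Longrightarrow> x \<in> K"
  using Rats_subset by auto

text \<open>Gaussian elimination, by induction on the set \<open>G\<close> of equations in the
  unknowns \<open>F\<close>: an equation with a nonzero coefficient is solved for one unknown, which
  is then substituted into the others. It serves over the rationals and over the algebraic
  numbers.\<close>

lemma homogeneous_system:
  assumes "finite F" "finite G" "card G < card F"
    and "\<And>i l. i \<in> G \<Longrightarrow> l \<in> F \<Longrightarrow> A i l \<in> K"
  shows "\<exists>c. (\<forall>l. c l \<in> K) \<and> (\<exists>l\<in>F. c l \<noteq> 0) \<and> (\<forall>i\<in>G. (\<Sum>l\<in>F. c l * A i l) = 0)"
  using assms(2,1,3,4)
proof (induction G arbitrary: F A rule: finite_induct)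
  case empty
  then have "F \<noteq> {}" by auto
  then show ?case by (intro exI[of _ "\<lambda>_. 1"]) auto
next
  case (insert g G)
  show ?case
  proof (cases "\<forall>l\<in>F. A g l = 0")
    case True
    have "\<exists>c. (\<forall>l. c l \<in> K) \<and> (\<exists>l\<in>F. c l \<noteq> 0) \<and> (\<forall>i\<in>G. (\<Sum>l\<in>F. c l * A i l) = 0)"
      using insert.prems insert.hyps by (intro insert.IH) auto
    then show ?thesis using True by auto
  next
    case False
    then obtain l0 where l0: "l0 \<in> F" "A g l0 \<noteq> 0" by auto
    \<comment> \<open>The coefficients left after eliminating the unknown \<open>l0\<close> by means
      of equation \<open>g\<close>.\<close>
    define A' where "A' i l = A i l - A i l0 * A g l / A g l0" for i l
    have card: "card G < card (F - {l0})"
      using insert.prems insert.hyps l0 by simp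
    have "\<exists>c. (\<forall>l. c l \<in> K) \<and> (\<exists>l\<in>F - {l0}. c l \<noteq> 0) \<and>
              (\<forall>i\<in>G. (\<Sum>l\<in>F - {l0}. c l * A' i l) = 0)"
      using insert.prems(1,3) l0 card by (intro insert.IH) (auto simp: A'_def)
    then obtain c where c: "\<And>l. c l \<in> K" "\<exists>l\<in>F - {l0}. c l \<noteq> 0"
      "\<And>i. i \<in> G \<Longrightarrow> (\<Sum>l\<in>F - {l0}. c l * A' i l) = 0" by blast
    \<comment> \<open>Equation \<open>g\<close> forces the value \<open>- s\<close> for the
      eliminated unknown.\<close>
    define s where "s = (\<Sum>l\<in>F - {l0}. c l * A g l) / A g l0"
    define c' where "c' = c(l0 := - s)"
    have sK: "s \<in> K"
      using insert.prems(3) l0 c(1) unfolding s_def by (auto intro!: divide_mem sum_mem)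
    have sum_c': "(\<Sum>l\<in>F. c' l * A i l) = (\<Sum>l\<in>F - {l0}. c l * A i l) - s * A i l0" for i
    proof -
      have "(\<Sum>l\<in>F. c' l * A i l) = c' l0 * A i l0 + (\<Sum>l\<in>F - {l0}. c' l * A i l)"
        using insert.prems(1) l0 by (simp add: sum.remove)
      also have "(\<Sum>l\<in>F - {l0}. c' l * A i l) = (\<Sum>l\<in>F - {l0}. c l * A i l)"
        by (rule sum.cong) (auto simp: c'_def)
      finally show ?thesis by (simp add: c'_def)
    qed
    have "(\<Sum>l\<in>F. c' l * A i l) = 0" if "i \<in> insert g G" for i
    proof (cases "i = g")
      case True
      then show ?thesis using l0 by (simp add: sum_c' s_def)
    next
      case False
      then have "i \<in> G" using that by auto
      have "(\<Sum>l\<in>F - {l0}. c l * A' i l) =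
          (\<Sum>l\<in>F - {l0}. c l * A i l) - (\<Sum>l\<in>F - {l0}. c l * A g l) * (A i l0 / A g l0)"
        unfolding A'_def sum_distrib_right sum_subtractf[symmetric]
        by (rule sum.cong) (auto simp: algebra_simps)
      then show ?thesis using c(3)[OF \<open>i \<in> G\<close>] by (simp add: sum_c' s_def)
    qed
    moreover have "\<forall>l. c' l \<in> K" using c(1) sK by (auto simp: c'_def)
    moreover have "\<exists>l\<in>F. c' l \<noteq> 0" using c(2) by (auto simp: c'_def)
    ultimately show ?thesis by blast
  qed
qed

end

lemma complex_subfield_Rats: "complex_subfield \<rat>"
  by unfold_locales auto

locale abs_val_field = complex_subfield K for K +
  fixes v :: "complex \<Rightarrow> real"
  assumes abs_val: "absolute_value_on K v"
begin

lemma v_nonneg [simp]: "x \<in> K \<Longrightarrow> 0 \<le> v x"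
  and v_eq_0 [simp]: "x \<in> K \<Longrightarrow> v x = 0 \<longleftrightarrow> x = 0"
  and v_mult [simp]: "x \<in> K \<Longrightarrow> y \<in> K \<Longrightarrow> v (x * y) = v x * v y"
  and v_triangle: "x \<in> K \<Longrightarrow> y \<in> K \<Longrightarrow> v (x + y) \<le> v x + v y"
  using abs_val unfolding absolute_value_on_def by auto

lemma v_0 [simp]: "v 0 = 0" using v_eq_0[OF zero_mem] by simp

lemma v_pos [simp]: "x \<in> K \<Longrightarrow> 0 < v x \<longleftrightarrow> x \<noteq> 0"
  using v_nonneg v_eq_0 by (metis less_eq_real_def less_numeral_extra(3))

lemma v_1 [simp]: "v 1 = 1"
proof -
  have "v 1 * v 1 = v 1" using v_mult[OF one_mem one_mem] by simp
  moreover have "v 1 \<noteq> 0" using v_eq_0[OF one_mem] by simp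
  ultimately show ?thesis by simp
qed

lemma v_minus_1 [simp]: "v (- 1) = 1"
proof -
  have "v (- 1) * v (- 1) = 1" using v_mult[of "-1" "-1"] by simp
  moreover have "0 \<le> v (- 1)" by simp
  ultimately show ?thesis
    by (metis abs_of_nonneg abs_mult_self_eq abs_square_eq_1 power2_eq_square)
qed

lemma v_minus [simp]: "x \<in> K \<Longrightarrow> v (- x) = v x"
  using v_mult[of "- 1" x] by simp

lemma v_diff: "x \<in> K \<Longrightarrow> y \<in> K \<Longrightarrow> v (x - y) \<le> v x + v y"
  using v_triangle[of x "- y"] by simp

lemma v_commute: "x \<in> K \<Longrightarrow> y \<in> K \<Longrightarrow> v (x - y) = v (y - x)"
  using v_minus[of "x - y"] by simp

lemma v_diff_ge: "x \<in> K \<Longrightarrow> y \<in> K \<Longrightarrow> v x - v y \<le> v (x - y)"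
  using v_triangle[of "x - y" y] by simp

lemma v_diff_abs: "x \<in> K \<Longrightarrow> y \<in> K \<Longrightarrow> \<bar>v x - v y\<bar> \<le> v (x - y)"
  using v_diff_ge[of x y] v_diff_ge[of y x] v_commute[of x y] by linarith

lemma v_power [simp]: "x \<in> K \<Longrightarrow> v (x ^ n) = v x ^ n"
  by (induction n) auto

lemma v_inverse [simp]: "x \<in> K \<Longrightarrow> v (inverse x) = inverse (v x)"
proof (cases "x = 0")
  case False
  assume "x \<in> K"
  then have "v x * v (inverse x) = 1" using False v_mult[of x "inverse x"] by simp
  then show ?thesis by (metis inverse_unique)
qed auto

lemma v_divide [simp]: "x \<in> K \<Longrightarrow> y \<in> K \<Longrightarrow> v (x / y) = v x / v y"
  by (simp add: divide_inverse)

lemma v_sum: "(\<And>i. i \<in> A \<Longrightarrow> f i \<in> K) \<Longrightarrow> v (sum f A) \<le> (\<Sum>i\<in>A. v (f i))"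
proof (induction A rule: infinite_finite_induct)
  case (insert x F)
  then show ?case using v_triangle[of "f x" "sum f F"] by force
qed auto

lemma v_prod: "(\<And>i. i \<in> A \<Longrightarrow> f i \<in> K) \<Longrightarrow> v (prod f A) = (\<Prod>i\<in>A. v (f i))"
  by (induction A rule: infinite_finite_induct) auto

end

text \<open>Translates the list-based \<open>independent\<close> and \<open>Span\<close> into
  coefficient families indexed by \<open>i < m\<close>. Both \<open>field_degree\<close> and
  \<open>local_degree\<close> are evaluated through it.\<close>

lemma (in ring) dim_eqI:
  assumes F: "subfield F R" and U: "\<And>i. i < m \<Longrightarrow> U i \<in> carrier R"
    and indep: "\<And>c. (\<And>i. i < m \<Longrightarrow> c i \<in> F) \<Longrightarrow>
      combine (map c [0..<m]) (map U [0..<m]) = \<zero> \<Longrightarrow> \<forall>i<m. c i = \<zero>"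
    and span: "\<And>x. x \<in> E \<longleftrightarrow> (\<exists>c. (\<forall>i<m. c i \<in> F) \<and> x = combine (map c [0..<m]) (map U [0..<m]))"
  shows "dim F E = m"
proof -
  define Us where "Us = map U [0..<m]"
  have Us: "set Us \<subseteq> carrier R" "length Us = m" using U by (auto simp: Us_def)
  have list: "(\<forall>i<m. Ks ! i \<in> F) \<and> Ks = map ((!) Ks) [0..<m]" if "length Ks = m" "set Ks \<subseteq> F" for Ks
    using that nth_mem[of _ Ks] by (auto simp: list_eq_iff_nth_eq)
  have "independent F Us"
  proof (rule ccontr)
    assume dep: "\<not> independent F Us"
    \<comment> \<open>For the empty list, \<open>set Ks \<noteq> {\<zero>}\<close> would hold
      without any nonzero coefficient.\<close>
    then have "m \<noteq> 0" unfolding Us_def by (cases m) auto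
    obtain Ks where Ks: "length Ks = m" "combine Ks Us = \<zero>" "set Ks \<subseteq> F" "set Ks \<noteq> {\<zero>}"
      using dependent_imp_non_trivial_combine[OF F Us(1) dep] Us(2) by metis
    then have "\<forall>i<m. Ks ! i = \<zero>" using indep[of "(!) Ks"] list[of Ks] by (simp add: Us_def)
    then have "set Ks \<subseteq> {\<zero>}" using Ks(1) by (auto simp: in_set_conv_nth)
    then show False using Ks(1,4) \<open>m \<noteq> 0\<close> by (auto simp: subset_singleton_iff)
  qed
  moreover have "Span F Us = E"
  proof (intro equalityI subsetI)
    fix x assume "x \<in> Span F Us"
    then obtain Ks where "set Ks \<subseteq> F" "length Ks = m" "x = combine Ks Us"
      using Span_mem_iff_length_version[OF F Us(1)] Us(2) by auto
    then show "x \<in> E" unfolding span Us_def using list[of Ks] by (intro exI[of _ "(!) Ks"]) simp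
  next
    fix x assume "x \<in> E"
    then obtain c where "\<forall>i<m. c i \<in> F" "x = combine (map c [0..<m]) Us" unfolding span Us_def by blast
    then show "x \<in> Span F Us"
      unfolding Span_mem_iff_length_version[OF F Us(1)] Us(2)
      by (intro exI[of _ "map c [0..<m]"]) auto
  qed
  ultimately have "dimension (length Us) F E" by (rule dimensionI[OF F])
  then show ?thesis using dimI[OF F] Us(2) by (simp add: over_def)
qed

section \<open>Completions and local degrees\<close>

context abs_val_field
begin

section \<open>Cauchy sequences with respect to an absolute value\<close>

lemma cauchy_mem: "s \<in> cauchy_seqs K v \<Longrightarrow> s n \<in> K"
  by (auto simp: cauchy_seqs_def)

lemma cauchyD:
  assumes "s \<in> cauchy_seqs K v" "e > 0"
  shows "\<exists>N. \<forall>m\<ge>N. \<forall>n\<ge>N. v (s m - s n) < e"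
  using assms unfolding cauchy_seqs_def by auto

lemma cauchy_bounded:
  assumes "s \<in> cauchy_seqs K v"
  shows "\<exists>B>0. \<forall>n. v (s n) \<le> B"
proof -
  obtain N where N: "\<forall>m\<ge>N. \<forall>n\<ge>N. v (s m - s n) < 1"
    using cauchyD[OF assms zero_less_one] by blast
  define B where "B = 1 + v (s N) + (\<Sum>i<N. v (s i))"
  have sum_nn: "0 \<le> (\<Sum>i<N. v (s i))" using cauchy_mem[OF assms] by (auto intro: sum_nonneg)
  have "v (s n) \<le> B" for n
  proof (cases "n < N")
    case True
    then have "v (s n) \<le> (\<Sum>i<N. v (s i))"
      using cauchy_mem[OF assms] by (intro member_le_sum) auto
    then show ?thesis unfolding B_def using cauchy_mem[OF assms] by (smt (verit) v_nonneg)
  next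
    case False
    then have "v (s n - s N) < 1" using N by auto
    then show ?thesis
      using v_diff_ge[of "s n" "s N"] cauchy_mem[OF assms] sum_nn unfolding B_def by force
  qed
  moreover have "B > 0" using sum_nn cauchy_mem[OF assms] unfolding B_def by (smt (verit) v_nonneg)
  ultimately show ?thesis by blast
qed

lemma cauchy_const [simp]: "x \<in> K \<Longrightarrow> (\<lambda>_. x) \<in> cauchy_seqs K v"
  by (auto simp: cauchy_seqs_def)

lemma cauchy_add [simp]:
  assumes "s \<in> cauchy_seqs K v" "t \<in> cauchy_seqs K v"
  shows "(\<lambda>n. s n + t n) \<in> cauchy_seqs K v"
  unfolding cauchy_seqs_def
proof (safe)
  fix e :: real assume "e > 0"
  then have pos: "e / 2 > 0" by simp
  obtain M where M: "\<forall>m\<ge>M. \<forall>n\<ge>M. v (s m - s n) < e / 2"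
    using cauchyD[OF assms(1) pos] by blast
  obtain N where N: "\<forall>m\<ge>N. \<forall>n\<ge>N. v (t m - t n) < e / 2"
    using cauchyD[OF assms(2) pos] by blast
  have "v (s m + t m - (s n + t n)) < e" if "m \<ge> max M N" "n \<ge> max M N" for m n
  proof -
    have "v (s m + t m - (s n + t n)) \<le> v (s m - s n) + v (t m - t n)"
      using v_triangle[of "s m - s n" "t m - t n"] cauchy_mem assms by (simp add: algebra_simps)
    also have "\<dots> < e / 2 + e / 2"
      using that M N by (intro add_strict_mono) auto
    finally show ?thesis by simp
  qed
  then show "\<exists>N. \<forall>m\<ge>N. \<forall>n\<ge>N. v (s m + t m - (s n + t n)) < e" by blast
qed (auto simp: cauchy_mem assms)

lemma cauchy_mult [simp]:
  assumes "s \<in> cauchy_seqs K v" "t \<in> cauchy_seqs K v"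
  shows "(\<lambda>n. s n * t n) \<in> cauchy_seqs K v"
  unfolding cauchy_seqs_def
proof (safe)
  fix e :: real assume "e > 0"
  obtain B C where B: "B > 0" "\<And>n. v (s n) \<le> B" and C: "C > 0" "\<And>n. v (t n) \<le> C"
    using cauchy_bounded[OF assms(1)] cauchy_bounded[OF assms(2)] by auto
  have pos: "e / (2 * C) > 0" "e / (2 * B) > 0" using \<open>e > 0\<close> B C by auto
  obtain M where M: "\<forall>m\<ge>M. \<forall>n\<ge>M. v (s m - s n) < e / (2 * C)"
    using cauchyD[OF assms(1) pos(1)] by blast
  obtain N where N: "\<forall>m\<ge>N. \<forall>n\<ge>N. v (t m - t n) < e / (2 * B)"
    using cauchyD[OF assms(2) pos(2)] by blast
  have "v (s m * t m - s n * t n) < e" if "m \<ge> max M N" "n \<ge> max M N" for m n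
  proof -
    have K: "s m \<in> K" "s n \<in> K" "t m \<in> K" "t n \<in> K" using cauchy_mem assms by auto
    have "v (s m * t m - s n * t n) \<le> v (s m) * v (t m - t n) + v (s m - s n) * v (t n)"
    proof -
      have "s m * t m - s n * t n = s m * (t m - t n) + (s m - s n) * t n"
        by (simp add: algebra_simps)
      then show ?thesis using v_triangle[of "s m * (t m - t n)" "(s m - s n) * t n"] K by simp
    qed
    also have "\<dots> < B * (e / (2 * B)) + e / (2 * C) * C"
    proof (rule add_le_less_mono)
      show "v (s m) * v (t m - t n) \<le> B * (e / (2 * B))"
        using that N B K by (intro mult_mono less_imp_le[of "v (t m - t n)"]) auto
      have "v (s m - s n) * v (t n) \<le> v (s m - s n) * C"
        using C K by (intro mult_left_mono) auto
      also have "\<dots> < e / (2 * C) * C" using that M C by (intro mult_strict_right_mono) auto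
      finally show "v (s m - s n) * v (t n) < e / (2 * C) * C" .
    qed
    also have "\<dots> = e" using B C by simp
    finally show ?thesis .
  qed
  then show "\<exists>N. \<forall>m\<ge>N. \<forall>n\<ge>N. v (s m * t m - s n * t n) < e" by blast
qed (auto simp: cauchy_mem assms)

lemma cauchy_uminus [simp]: "s \<in> cauchy_seqs K v \<Longrightarrow> (\<lambda>n. - s n) \<in> cauchy_seqs K v"
  using cauchy_mult[of "\<lambda>_. - 1" s] by simp

lemma cauchy_diff [simp]:
  "s \<in> cauchy_seqs K v \<Longrightarrow> t \<in> cauchy_seqs K v \<Longrightarrow> (\<lambda>n. s n - t n) \<in> cauchy_seqs K v"
  using cauchy_add[of s "\<lambda>n. - t n"] by simp

section \<open>The completion as a quotient of the ring of Cauchy sequences\<close>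

lemma cauchy_ring_cring: "cring (cauchy_ring K v)"
proof (rule cringI)
  have *: "\<exists>y\<in>cauchy_seqs K v. (\<lambda>n. x n + y n) = (\<lambda>_. 0)" if "x \<in> cauchy_seqs K v" for x
    using that by (intro bexI[of _ "\<lambda>n. - x n"]) auto
  show "abelian_group (cauchy_ring K v)"
    by (rule abelian_groupI) (auto simp: cauchy_ring_def algebra_simps *)
  show "comm_monoid (cauchy_ring K v)"
    by (rule comm_monoidI) (auto simp: cauchy_ring_def algebra_simps)
qed (auto simp: cauchy_ring_def algebra_simps)

sublocale cauchy: cring "cauchy_ring K v"
  by (rule cauchy_ring_cring)

lemma null_mem: "s \<in> null_seqs K v \<Longrightarrow> s \<in> cauchy_seqs K v"
  by (auto simp: null_seqs_def)

lemma cauchy_ring_minus: "s \<in> cauchy_seqs K v \<Longrightarrow> \<ominus>\<^bsub>cauchy_ring K v\<^esub> s = (\<lambda>n. - s n)"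
  by (rule cauchy.minus_equality) (auto simp: cauchy_ring_def)

lemma null_ideal: "ideal (null_seqs K v) (cauchy_ring K v)"
proof (rule idealI)
  show "ring (cauchy_ring K v)" by (rule cauchy.ring_axioms)
  show "subgroup (null_seqs K v) (add_monoid (cauchy_ring K v))"
  proof (rule cauchy.add.subgroupI)
    show "null_seqs K v \<subseteq> carrier (cauchy_ring K v)"
      by (auto simp: cauchy_ring_def null_mem)
    have "(\<lambda>_. 0) \<in> null_seqs K v" by (auto simp: null_seqs_def)
    then show "null_seqs K v \<noteq> {}" by auto
    show "\<ominus>\<^bsub>cauchy_ring K v\<^esub> s \<in> null_seqs K v" if "s \<in> null_seqs K v" for s
      using that by (auto simp: null_mem cauchy_ring_minus) (auto simp: null_seqs_def cauchy_mem)
    show "s \<oplus>\<^bsub>cauchy_ring K v\<^esub> t \<in> null_seqs K v"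
      if "s \<in> null_seqs K v" "t \<in> null_seqs K v" for s t
    proof -
      have "(\<lambda>n. v (s n + t n)) \<longlonglongrightarrow> 0"
      proof (rule tendsto_sandwich[of "\<lambda>_. 0" _ _ "\<lambda>n. v (s n) + v (t n)"])
        have "(\<lambda>n. v (s n) + v (t n)) \<longlonglongrightarrow> 0 + 0"
          using that by (intro tendsto_add) (auto simp: null_seqs_def)
        then show "(\<lambda>n. v (s n) + v (t n)) \<longlonglongrightarrow> 0" by simp
      qed (use that null_mem cauchy_mem v_triangle in \<open>auto intro!: always_eventually\<close>)
      then show ?thesis using that by (auto simp: cauchy_ring_def null_seqs_def)
    qed
  qed
  have *: "(\<lambda>n. s n * t n) \<in> null_seqs K v" if st: "s \<in> null_seqs K v" "t \<in> cauchy_seqs K v" for s t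
  proof -
    obtain B where B: "B > 0" "\<And>n. v (t n) \<le> B" using cauchy_bounded[OF st(2)] by auto
    have "(\<lambda>n. v (s n * t n)) \<longlonglongrightarrow> 0"
    proof (rule tendsto_sandwich[of "\<lambda>_. 0" _ _ "\<lambda>n. v (s n) * B"])
      have "(\<lambda>n. v (s n) * B) \<longlonglongrightarrow> 0 * B"
        using st by (intro tendsto_mult) (auto simp: null_seqs_def)
      then show "(\<lambda>n. v (s n) * B) \<longlonglongrightarrow> 0" by simp
      show "\<forall>\<^sub>F n in sequentially. v (s n * t n) \<le> v (s n) * B"
        using st null_mem cauchy_mem B by (auto intro!: mult_left_mono always_eventually)
    qed (use st null_mem cauchy_mem in \<open>auto intro!: always_eventually\<close>)
    then show ?thesis using st by (auto simp: null_seqs_def)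
  qed
  show "x \<otimes>\<^bsub>cauchy_ring K v\<^esub> a \<in> null_seqs K v"
    if "a \<in> null_seqs K v" "x \<in> carrier (cauchy_ring K v)" for a x
    using *[of a x] that by (auto simp: cauchy_ring_def mult.commute)
  show "a \<otimes>\<^bsub>cauchy_ring K v\<^esub> x \<in> null_seqs K v"
    if "a \<in> null_seqs K v" "x \<in> carrier (cauchy_ring K v)" for a x
    using *[of a x] that by (auto simp: cauchy_ring_def)
qed

sublocale null: ideal "null_seqs K v" "cauchy_ring K v"
  by (rule null_ideal)

abbreviation cls :: "(nat \<Rightarrow> complex) \<Rightarrow> (nat \<Rightarrow> complex) set" where
  "cls s \<equiv> null_seqs K v +>\<^bsub>cauchy_ring K v\<^esub> s"

lemma completion_hom: "ring_hom_cring (cauchy_ring K v) (completion K v) cls"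
  unfolding completion_def by (rule null.rcos_ring_hom_cring[OF cauchy_ring_cring])

lemma carrier_cauchy_ring [simp]: "carrier (cauchy_ring K v) = cauchy_seqs K v"
  by (simp add: cauchy_ring_def)

lemma cauchy_ring_simps:
  "s \<otimes>\<^bsub>cauchy_ring K v\<^esub> t = (\<lambda>n. s n * t n)" "s \<oplus>\<^bsub>cauchy_ring K v\<^esub> t = (\<lambda>n. s n + t n)"
  "\<one>\<^bsub>cauchy_ring K v\<^esub> = (\<lambda>_. 1)" "\<zero>\<^bsub>cauchy_ring K v\<^esub> = (\<lambda>_. 0)"
  by (simp_all add: cauchy_ring_def)

lemma carrier_completion: "carrier (completion K v) = cls ` cauchy_seqs K v"
  unfolding completion_def FactRing_def A_RCOSETS_def' by auto

lemma cls_eq_zero_iff: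
  assumes "s \<in> cauchy_seqs K v"
  shows "cls s = \<zero>\<^bsub>completion K v\<^esub> \<longleftrightarrow> s \<in> null_seqs K v"
proof -
  have "s \<in> carrier (cauchy_ring K v)" using assms by (simp add: cauchy_ring_def)
  then show ?thesis
    using null.a_rcos_const[of s] null.a_rcos_self[of s] unfolding completion_def FactRing_def
    by fastforce
qed

lemma cls_eq_iff:
  assumes "s \<in> cauchy_seqs K v" "t \<in> cauchy_seqs K v"
  shows "cls s = cls t \<longleftrightarrow> (\<lambda>n. v (s n - t n)) \<longlonglongrightarrow> 0"
proof -
  interpret quot: ring_hom_cring "cauchy_ring K v" "completion K v" cls
    by (rule completion_hom)
  have c: "s \<in> carrier (cauchy_ring K v)" "t \<in> carrier (cauchy_ring K v)"
    using assms by (auto simp: cauchy_ring_def)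
  have "cls s = cls t \<longleftrightarrow> cls s \<ominus>\<^bsub>completion K v\<^esub> cls t = \<zero>\<^bsub>completion K v\<^esub>"
    using c by auto
  also have "cls s \<ominus>\<^bsub>completion K v\<^esub> cls t = cls (s \<ominus>\<^bsub>cauchy_ring K v\<^esub> t)"
    using c by (simp add: a_minus_def del: carrier_cauchy_ring)
  also have "s \<ominus>\<^bsub>cauchy_ring K v\<^esub> t = (\<lambda>n. s n - t n)"
    using assms by (simp add: a_minus_def cauchy_ring_minus) (simp add: cauchy_ring_def)
  finally show ?thesis using assms
    by (simp only: cls_eq_zero_iff cauchy_diff) (simp add: null_seqs_def)
qed

text \<open>If infinitely many terms have absolute value at least \<open>e\<close>, the Cauchy
  property keeps all later terms above \<open>e / 2\<close>. The finitely many earlier terms may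
  vanish; there \<open>inverse\<close> yields 0, which does not affect the Cauchy property.\<close>

lemma cauchy_inverse:
  assumes s: "s \<in> cauchy_seqs K v" and nn: "s \<notin> null_seqs K v"
  shows "(\<lambda>n. inverse (s n)) \<in> cauchy_seqs K v" and "eventually (\<lambda>n. s n \<noteq> 0) sequentially"
proof -
  have sK: "s n \<in> K" for n using cauchy_mem s by auto
  have "\<not> (\<lambda>n. v (s n)) \<longlonglongrightarrow> 0" using s nn by (auto simp: null_seqs_def)
  then obtain e where e: "e > 0" "\<And>N. \<exists>n\<ge>N. v (s n) \<ge> e"
    using sK by (auto simp: LIMSEQ_iff not_less)
  have "e / 2 > 0" using e by simp
  then obtain N where N: "\<forall>m\<ge>N. \<forall>n\<ge>N. v (s m - s n) < e / 2" using cauchyD[OF s] by blast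
  obtain n0 where n0: "n0 \<ge> N" "v (s n0) \<ge> e" using e by blast
  have ge: "v (s n) > e / 2" if "n \<ge> N" for n
  proof -
    have "v (s n0 - s n) < e / 2" using N n0 that by auto
    then show ?thesis using v_diff_ge[OF sK sK, of n0 n] n0 by linarith
  qed
  then have nz: "s n \<noteq> 0" if "n \<ge> N" for n using that e by force
  then show "eventually (\<lambda>n. s n \<noteq> 0) sequentially" by (auto simp: eventually_sequentially)
  show "(\<lambda>n. inverse (s n)) \<in> cauchy_seqs K v"
    unfolding cauchy_seqs_def
  proof safe
    fix d :: real assume "d > 0"
    then have "d * (e / 2) * (e / 2) > 0" using e by simp
    then obtain M where M: "\<forall>m\<ge>M. \<forall>n\<ge>M. v (s m - s n) < d * (e / 2) * (e / 2)"
      using cauchyD[OF s] by blast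
    have "v (inverse (s m) - inverse (s n)) < d" if "m \<ge> max M N" "n \<ge> max M N" for m n
    proof -
      have nz': "s m \<noteq> 0" "s n \<noteq> 0" using nz that by auto
      have g: "v (s m) > e / 2" "v (s n) > e / 2" using ge that by auto
      have "inverse (s m) - inverse (s n) = (s n - s m) / (s m * s n)"
        using nz' by (simp add: field_simps)
      then have "v (inverse (s m) - inverse (s n)) = v (s n - s m) / (v (s m) * v (s n))"
        using sK by simp
      also have "\<dots> < d"
      proof -
        have "v (s n - s m) < d * (e / 2) * (e / 2)" using M that by simp
        also have "\<dots> \<le> d * (v (s m) * v (s n))"
          using g e \<open>d > 0\<close> by (simp only: mult.assoc, intro mult_left_mono mult_mono) auto
        finally show ?thesis using g e by (simp add: divide_less_eq)
      qed
      finally show ?thesis .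
    qed
    then show "\<exists>N. \<forall>m\<ge>N. \<forall>n\<ge>N. v (inverse (s m) - inverse (s n)) < d" by blast
  qed (use sK in auto)
qed

definition rat_cauchy :: "(nat \<Rightarrow> complex) set" where
  "rat_cauchy = {s \<in> cauchy_seqs K v. range s \<subseteq> \<rat>}"

lemma rational_completion_eq: "rational_completion K v = cls ` rat_cauchy"
  by (simp add: rational_completion_def rat_cauchy_def)

lemma rat_cauchy_cauchy [simp]: "s \<in> rat_cauchy \<Longrightarrow> s \<in> cauchy_seqs K v"
  by (simp add: rat_cauchy_def)

lemma rat_cauchy_1: "(\<lambda>_. 1) \<in> rat_cauchy"
  unfolding rat_cauchy_def image_subset_iff by simp

lemma rat_cauchy_uminus: "s \<in> rat_cauchy \<Longrightarrow> (\<lambda>n. - s n) \<in> rat_cauchy"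
  and rat_cauchy_add: "s \<in> rat_cauchy \<Longrightarrow> t \<in> rat_cauchy \<Longrightarrow> (\<lambda>n. s n + t n) \<in> rat_cauchy"
  and rat_cauchy_mult: "s \<in> rat_cauchy \<Longrightarrow> t \<in> rat_cauchy \<Longrightarrow> (\<lambda>n. s n * t n) \<in> rat_cauchy"
  unfolding rat_cauchy_def image_subset_iff by simp_all

lemma rat_cauchy_inverse:
  "s \<in> rat_cauchy \<Longrightarrow> s \<notin> null_seqs K v \<Longrightarrow> (\<lambda>n. inverse (s n)) \<in> rat_cauchy"
  using cauchy_inverse(1)[of s] unfolding rat_cauchy_def image_subset_iff by simp

lemma rat_cauchy_Rats: "s \<in> rat_cauchy \<Longrightarrow> s n \<in> \<rat>"
  unfolding rat_cauchy_def image_subset_iff by simp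

lemma one_neq_zero_completion: "\<one>\<^bsub>completion K v\<^esub> \<noteq> \<zero>\<^bsub>completion K v\<^esub>"
proof -
  interpret quot: ring_hom_cring "cauchy_ring K v" "completion K v" cls
    by (rule completion_hom)
  have "cls (\<lambda>_. 1) = \<one>\<^bsub>completion K v\<^esub>"
    using quot.hom_one unfolding cauchy_ring_simps .
  moreover have "cls (\<lambda>_. 1) \<noteq> \<zero>\<^bsub>completion K v\<^esub>"
    by (subst cls_eq_zero_iff) (auto simp: null_seqs_def LIMSEQ_const_iff)
  ultimately show ?thesis by simp
qed

lemma subfield_rational_completion: "subfield (rational_completion K v) (completion K v)"
proof -
  interpret quot: ring_hom_cring "cauchy_ring K v" "completion K v" cls
    by (rule completion_hom)
  let ?C = "completion K v" and ?Q = "rational_completion K v"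
  have mult: "cls s \<otimes>\<^bsub>?C\<^esub> cls t = cls (\<lambda>n. s n * t n)"
    if "s \<in> cauchy_seqs K v" "t \<in> cauchy_seqs K v" for s t
    using quot.hom_mult[of s t] that unfolding cauchy_ring_simps by auto
  have one_eq: "\<one>\<^bsub>?C\<^esub> = cls (\<lambda>_. 1)"
    using quot.hom_one unfolding cauchy_ring_simps by (rule sym)
  have "subring rat_cauchy (cauchy_ring K v)"
    by (rule cauchy.subringI) (auto simp: cauchy_ring_simps cauchy_ring_minus rat_cauchy_uminus
        rat_cauchy_add rat_cauchy_mult rat_cauchy_1)
  then have "subring ?Q ?C"
    unfolding rational_completion_eq by (rule quot.ring.img_is_subring)
  then have sub: "subcring ?Q ?C" by (rule quot.S.subcringI')
  have Q_carrier: "x \<in> carrier ?C" if "x \<in> ?Q" for x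
    using that by (auto simp: rational_completion_eq carrier_completion)
  show ?thesis
  proof (rule quot.S.subfieldI[OF sub])
    show "Units (?C\<lparr>carrier := ?Q\<rparr>) = ?Q - {\<zero>\<^bsub>?C\<^esub>}"
    proof (intro equalityI subsetI)
      fix x assume x: "x \<in> Units (?C\<lparr>carrier := ?Q\<rparr>)"
      then obtain y where y: "x \<in> ?Q" "y \<in> ?Q" "x \<otimes>\<^bsub>?C\<^esub> y = \<one>\<^bsub>?C\<^esub>"
        by (auto simp: Units_def)
      have "x \<noteq> \<zero>\<^bsub>?C\<^esub>"
      proof
        assume "x = \<zero>\<^bsub>?C\<^esub>"
        then show False using y Q_carrier[of y] one_neq_zero_completion by simp
      qed
      then show "x \<in> ?Q - {\<zero>\<^bsub>?C\<^esub>}" using y by simp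
    next
      fix x assume x: "x \<in> ?Q - {\<zero>\<^bsub>?C\<^esub>}"
      then obtain s where s: "s \<in> rat_cauchy" "x = cls s"
        unfolding rational_completion_eq by blast
      then have "s \<notin> null_seqs K v" using x cls_eq_zero_iff[of s] by auto
      note inv = cauchy_inverse[OF rat_cauchy_cauchy[OF s(1)] \<open>s \<notin> null_seqs K v\<close>]
      have inv_Q: "cls (\<lambda>n. inverse (s n)) \<in> ?Q"
        unfolding rational_completion_eq 
        using rat_cauchy_inverse[OF s(1) \<open>s \<notin> null_seqs K v\<close>] by (rule imageI)
      have "x \<otimes>\<^bsub>?C\<^esub> cls (\<lambda>n. inverse (s n)) = cls (\<lambda>n. s n * inverse (s n))"
        using s inv by (simp add: mult)
      also have "\<dots> = cls (\<lambda>_. 1)"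
      proof (subst cls_eq_iff)
        show "(\<lambda>n. v (s n * inverse (s n) - 1)) \<longlonglongrightarrow> 0"
          by (rule tendsto_eventually) (use inv(2) in eventually_elim, auto)
      qed (use s inv in auto)
      finally have "x \<otimes>\<^bsub>?C\<^esub> cls (\<lambda>n. inverse (s n)) = \<one>\<^bsub>?C\<^esub>" by (simp only: one_eq)
      moreover from this have "cls (\<lambda>n. inverse (s n)) \<otimes>\<^bsub>?C\<^esub> x = \<one>\<^bsub>?C\<^esub>"
        using quot.S.m_comm[of x "cls (\<lambda>n. inverse (s n))"] Q_carrier inv_Q x by auto
      ultimately show "x \<in> Units (?C\<lparr>carrier := ?Q\<rparr>)"
        using x inv_Q by (auto simp: Units_def)
    qed
  qed
qed

lemma combine_cauchy_ring:
  "cauchy.combine (map f xs) (map g xs) = (\<lambda>n. \<Sum>x\<leftarrow>xs. f x n * g x n)"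
  by (induction xs) (simp_all add: cauchy_ring_simps)

text \<open>The bound on the coefficients passes to limits, so the constant sequences
  \<open>us i\<close> are independent over the closure of the rationals. By density every class has
  a representative built from rational combinations, and the same bound makes its coefficient
  sequences Cauchy.\<close>

lemma local_degree_eq:
  assumes us: "\<And>i. i < m \<Longrightarrow> us i \<in> K"
    and indep: "\<And>c i. (\<And>i. c i \<in> \<rat>) \<Longrightarrow> i < m \<Longrightarrow> v (c i) \<le> C * v (\<Sum>i<m. c i * us i)"
    and dense: "\<And>x e. x \<in> K \<Longrightarrow> e > 0 \<Longrightarrow>
      \<exists>c. (\<forall>i. c i \<in> \<rat>) \<and> v (x - (\<Sum>i<m. c i * us i)) < e"
  shows "local_degree K v = m"
proof -
  interpret quot: ring_hom_cring "cauchy_ring K v" "completion K v" cls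
    by (rule completion_hom)
  let ?C = "completion K v" and ?Q = "rational_completion K v"
  note sub = subfield_rational_completion
  define U where "U i = cls (\<lambda>_. us i)" for i
  have combine: "quot.S.combine (map (\<lambda>i. cls (f i)) [0..<m]) (map U [0..<m]) = cls (\<lambda>n. \<Sum>i<m. f i n * us i)"
    if "\<And>i. i < m \<Longrightarrow> f i \<in> cauchy_seqs K v" for f
  proof -
    have "quot.S.combine (map cls (map f [0..<m])) (map cls (map (\<lambda>i _. us i) [0..<m])) =
        cls (cauchy.combine (map f [0..<m]) (map (\<lambda>i _. us i) [0..<m]))"
      using that us by (intro quot.ring.combine_hom) auto
    also have "cauchy.combine (map f [0..<m]) (map (\<lambda>i _. us i) [0..<m]) = (\<lambda>n. \<Sum>i<m. f i n * us i)"
      by (simp add: combine_cauchy_ring sum_list_distinct_conv_sum_set atLeast0LessThan)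
    finally show ?thesis by (simp add: U_def[abs_def] o_def)
  qed
  have sum_cauchy: "(\<lambda>n. \<Sum>i<k. f i n * us i) \<in> cauchy_seqs K v"
    if "\<And>i. i < k \<Longrightarrow> f i \<in> cauchy_seqs K v" "k \<le> m" for f k
    using that by (induction k) (auto simp: us)
  have represent: "\<exists>f. \<forall>i<m. f i \<in> rat_cauchy \<and> c i = cls (f i)" if "\<forall>i<m. c i \<in> ?Q" for c
  proof -
    have "\<forall>i. \<exists>s. i < m \<longrightarrow> s \<in> rat_cauchy \<and> c i = cls s"
      using that unfolding rational_completion_eq by blast
    then show ?thesis by metis
  qed
  show ?thesis
    unfolding local_degree_def
  proof (rule quot.S.dim_eqI[OF sub])
    show "U i \<in> carrier ?C" if "i < m" for i
      using us[OF that] by (auto simp: U_def carrier_completion)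
    show "\<forall>i<m. c i = \<zero>\<^bsub>?C\<^esub>"
      if c: "\<And>i. i < m \<Longrightarrow> c i \<in> ?Q" "quot.S.combine (map c [0..<m]) (map U [0..<m]) = \<zero>\<^bsub>?C\<^esub>" for c
    proof (intro allI impI)
      fix i assume "i < m"
      obtain f where f: "\<And>i. i < m \<Longrightarrow> f i \<in> rat_cauchy \<and> c i = cls (f i)"
        using represent[of c] c(1) by blast
      have map_c: "map c [0..<m] = map (\<lambda>i. cls (f i)) [0..<m]" using f by simp
      have sum_c: "quot.S.combine (map c [0..<m]) (map U [0..<m]) = cls (\<lambda>n. \<Sum>i<m. f i n * us i)"
        unfolding map_c by (rule combine) (simp add: f)
      then have "cls (\<lambda>n. \<Sum>i<m. f i n * us i) = \<zero>\<^bsub>?C\<^esub>"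
        using c(2) by (rule trans[OF sym])
      then have null: "(\<lambda>n. v (\<Sum>i<m. f i n * us i)) \<longlonglongrightarrow> 0"
        using cls_eq_zero_iff[OF sum_cauchy[of m f]] f by (auto simp: null_seqs_def)
      \<comment> \<open>\<open>indep\<close> asks for rational coefficients at every index, while
        \<open>f i\<close> is known to be rational only for \<open>i < m\<close>.\<close>
      define g where "g i = (if i < m then f i else (\<lambda>_. 0))" for i
      have gQ: "g i n \<in> \<rat>" for i n using f by (simp add: g_def rat_cauchy_Rats)
      have le: "v (f i n) \<le> C * v (\<Sum>i<m. f i n * us i)" for n
        using indep[of "\<lambda>i. g i n" i] gQ \<open>i < m\<close> by (simp add: g_def)
      have "(\<lambda>n. v (f i n)) \<longlonglongrightarrow> 0"
      proof (rule tendsto_sandwich[of "\<lambda>_. 0" _ _ "\<lambda>n. C * v (\<Sum>i<m. f i n * us i)"])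
        show "(\<lambda>n. C * v (\<Sum>i<m. f i n * us i)) \<longlonglongrightarrow> 0"
          using tendsto_mult_right_zero[OF null, of C] by simp
        show "\<forall>\<^sub>F n in sequentially. 0 \<le> v (f i n)"
          using f[OF \<open>i < m\<close>] by (intro always_eventually) (auto simp: cauchy_mem)
      qed (use le in \<open>auto intro!: always_eventually\<close>)
      then show "c i = \<zero>\<^bsub>?C\<^esub>"
        using f[OF \<open>i < m\<close>] cls_eq_zero_iff[of "f i"] by (auto simp: null_seqs_def)
    qed
    show "x \<in> carrier ?C \<longleftrightarrow> (\<exists>c. (\<forall>i<m. c i \<in> ?Q) \<and>
        x = quot.S.combine (map c [0..<m]) (map U [0..<m]))" for x
    proof
      assume "x \<in> carrier ?C"
      then obtain s where s: "s \<in> cauchy_seqs K v" "x = cls s" by (auto simp: carrier_completion)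
      have "\<forall>n. \<exists>c. (\<forall>i. c i \<in> \<rat>) \<and> v (s n - (\<Sum>i<m. c i * us i)) < 1 / real (Suc n)"
        using dense[OF cauchy_mem[OF s(1)]] by simp
      then obtain c where c: "\<And>n i. c n i \<in> \<rat>"
        "\<And>n. v (s n - (\<Sum>i<m. c n i * us i)) < 1 / real (Suc n)" by metis
      define t where "t n = (\<Sum>i<m. c n i * us i)" for n
      have tK: "t n \<in> K" for n unfolding t_def by (intro sum_mem mult_mem Rats_mem c(1) us) simp
      have sK: "s n \<in> K" for n using s cauchy_mem by auto
      have lim: "(\<lambda>n. v (s n - t n)) \<longlonglongrightarrow> 0"
      proof (rule tendsto_sandwich[of "\<lambda>_. 0" _ _ "\<lambda>n. 1 / real (Suc n)"])
        show "(\<lambda>n. 1 / real (Suc n)) \<longlonglongrightarrow> 0"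
          using LIMSEQ_inverse_real_of_nat by (simp add: inverse_eq_divide)
        show "\<forall>\<^sub>F n in sequentially. v (s n - t n) \<le> 1 / real (Suc n)"
          using c(2) by (auto simp: t_def intro!: always_eventually less_imp_le)
      qed (use sK tK in \<open>auto intro!: always_eventually\<close>)
      have "(\<lambda>n. s n - t n) \<in> cauchy_seqs K v"
        unfolding cauchy_seqs_def
      proof safe
        fix e :: real assume "e > 0"
        then have "\<forall>\<^sub>F n in sequentially. v (s n - t n) < e / 2"
          using order_tendstoD(2)[OF lim, of "e / 2"] by simp
        then obtain N where N: "\<And>n. n \<ge> N \<Longrightarrow> v (s n - t n) < e / 2"
          by (auto simp: eventually_sequentially)
        have "v (s i - t i - (s j - t j)) < e" if "i \<ge> N" "j \<ge> N" for i j
          using v_diff[of "s i - t i" "s j - t j"] N[OF that(1)] N[OF that(2)] sK tK by force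
        then show "\<exists>N. \<forall>i\<ge>N. \<forall>j\<ge>N. v (s i - t i - (s j - t j)) < e" by blast
      qed (use sK tK in auto)
      then have t: "t \<in> cauchy_seqs K v"
        using cauchy_diff[OF s(1), of "\<lambda>n. s n - t n"] by simp
      \<comment> \<open>The approximating sequence \<open>t\<close> is Cauchy, and
        \<open>indep\<close> applied to differences of its terms carries this over to each
        coefficient.\<close>
      have f: "(\<lambda>n. c n i) \<in> rat_cauchy" if "i < m" for i
      proof -
        have "\<exists>N. \<forall>k\<ge>N. \<forall>n\<ge>N. v (c k i - c n i) < e" if "e > 0" for e
        proof -
          \<comment> \<open>Positive whatever the sign of \<open>C\<close>, so that
            \<open>e / C'\<close> is an admissible tolerance.\<close>
          define C' where "C' = max C 1"
          have "e / C' > 0" using that by (auto simp: C'_def)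
          then obtain N where N: "\<forall>k\<ge>N. \<forall>n\<ge>N. v (t k - t n) < e / C'"
            using cauchyD[OF t] by blast
          have "v (c k i - c n i) < e" if "k \<ge> N" "n \<ge> N" for k n
          proof -
            have "v (c k i - c n i) \<le> C * v (\<Sum>i<m. (c k i - c n i) * us i)"
              using indep[of "\<lambda>i. c k i - c n i" i] c(1) \<open>i < m\<close> by simp
            also have "(\<Sum>i<m. (c k i - c n i) * us i) = t k - t n"
              by (simp add: t_def sum_subtractf left_diff_distrib)
            also have "C * v (t k - t n) \<le> C' * v (t k - t n)"
              using tK by (intro mult_right_mono) (auto simp: C'_def)
            also have "\<dots> < C' * (e / C')"
              using N that by (intro mult_strict_left_mono) (auto simp: C'_def)
            finally show ?thesis by (simp add: C'_def)
          qed
          then show ?thesis by blast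
        qed
        then show ?thesis
          using c(1) unfolding rat_cauchy_def cauchy_seqs_def image_subset_iff by simp
      qed
      have "x = cls t" using s t lim by (simp add: cls_eq_iff)
      also have "\<dots> = quot.S.combine (map (\<lambda>i. cls (\<lambda>n. c n i)) [0..<m]) (map U [0..<m])"
        using combine[of "\<lambda>i n. c n i"] f by (simp add: t_def[abs_def])
      finally show "\<exists>c. (\<forall>i<m. c i \<in> ?Q) \<and> x = quot.S.combine (map c [0..<m]) (map U [0..<m])"
        using f by (intro exI[of _ "\<lambda>i. cls (\<lambda>n. c n i)"]) (auto simp: rational_completion_eq)
    next
      assume "\<exists>c. (\<forall>i<m. c i \<in> ?Q) \<and> x = quot.S.combine (map c [0..<m]) (map U [0..<m])"
      then obtain c where c: "\<And>i. i < m \<Longrightarrow> c i \<in> ?Q" "x = quot.S.combine (map c [0..<m]) (map U [0..<m])"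
        by blast
      obtain f where f: "\<And>i. i < m \<Longrightarrow> f i \<in> rat_cauchy \<and> c i = cls (f i)"
        using represent[of c] c(1) by blast
      have map_c: "map c [0..<m] = map (\<lambda>i. cls (f i)) [0..<m]" using f by simp
      have sum_c: "quot.S.combine (map c [0..<m]) (map U [0..<m]) = cls (\<lambda>n. \<Sum>i<m. f i n * us i)"
        unfolding map_c by (rule combine) (simp add: f)
      have "x = cls (\<lambda>n. \<Sum>i<m. f i n * us i)" unfolding c(2) by (rule sum_c)
      then show "x \<in> carrier ?C" using sum_cauchy[of m f] f by (simp add: carrier_completion)
    qed
  qed
qed

end

section \<open>Number fields and local bases\<close>

lemma (in complex_subfield) power_int_mem [simp]: "x \<in> K \<Longrightarrow> x powi k \<in> K"
  by (simp add: power_int_def)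

lemma (in abs_val_field) v_power_int [simp]: "x \<in> K \<Longrightarrow> v (x powi k) = v x powi k"
  by (simp add: power_int_def)

text \<open>By \<open>homogeneous_system\<close>, more than \<open>n\<close> elements of
  \<open>K\<close> satisfy a nontrivial rational relation. This is how the length of the spanning
  family will bound sums of local degrees.\<close>

locale number_field = complex_subfield K for K +
  fixes n :: nat and w :: "nat \<Rightarrow> complex"
  assumes basis_mem: "w i \<in> K"
    and spanning: "x \<in> K \<Longrightarrow> \<exists>c. (\<forall>i. c i \<in> \<rat>) \<and> x = (\<Sum>i<n. c i * w i)"

locale number_field_abs = number_field K n w + abs_val_field K v for K n w v
begin

text \<open>Membership in the \<open>v\<close>-closure of a rational span, expressed inside
  \<open>K\<close>.\<close>

definition approximable :: "nat \<Rightarrow> (nat \<Rightarrow> complex) \<Rightarrow> complex \<Rightarrow> bool" where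
  "approximable m us x \<longleftrightarrow>
     (\<forall>e>0. \<exists>c. (\<forall>i. c i \<in> \<rat>) \<and> v (x - (\<Sum>i<m. c i * us i)) < e)"

lemma rat_combination_mem:
  "(\<And>i. c i \<in> \<rat>) \<Longrightarrow> (\<And>i. us i \<in> K) \<Longrightarrow> (\<Sum>i\<in>I. c i * us i) \<in> K"
  by (intro sum_mem mult_mem) simp_all

lemma approximable_sum:
  assumes us: "\<And>i. us i \<in> K" and x: "\<And>i. i \<in> I \<Longrightarrow> x i \<in> K \<and> approximable m us (x i)"
    and q: "\<And>i. q i \<in> \<rat>"
  shows "approximable m us (\<Sum>i\<in>I. q i * x i)"
  unfolding approximable_def
proof (intro allI impI)
  fix e :: real assume "e > 0"
  have qK: "q i \<in> K" for i using q by simp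
  \<comment> \<open>The summand 1 makes \<open>L\<close> positive and the final estimate
    strict.\<close>
  define L where "L = 1 + (\<Sum>i\<in>I. v (q i))"
  have L: "L > 0" unfolding L_def using qK by (intro add_pos_nonneg sum_nonneg) auto
  then have "e / L > 0" using \<open>e > 0\<close> by simp
  then have "\<forall>i\<in>I. \<exists>c. (\<forall>j. c j \<in> \<rat>) \<and> v (x i - (\<Sum>j<m. c j * us j)) < e / L"
    using x unfolding approximable_def by blast
  then obtain c where c: "\<And>i j. i \<in> I \<Longrightarrow> c i j \<in> \<rat>"
    "\<And>i. i \<in> I \<Longrightarrow> v (x i - (\<Sum>j<m. c i j * us j)) < e / L"
    by metis
  define y where "y i = x i - (\<Sum>j<m. c i j * us j)" for i
  have yK: "y i \<in> K" if "i \<in> I" for i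
    unfolding y_def using x[OF that] c(1)[OF that] us by (intro diff_mem rat_combination_mem) auto
  define d where "d j = (\<Sum>i\<in>I. q i * c i j)" for j
  have d: "d j \<in> \<rat>" for j unfolding d_def using q c(1) by (intro Rats_sum Rats_mult) auto
  have "(\<Sum>j<m. d j * us j) = (\<Sum>i\<in>I. q i * (\<Sum>j<m. c i j * us j))"
    unfolding d_def sum_distrib_left sum_distrib_right by (subst sum.swap) (simp add: mult.assoc)
  then have "(\<Sum>i\<in>I. q i * x i) - (\<Sum>j<m. d j * us j) = (\<Sum>i\<in>I. q i * y i)"
    by (simp add: y_def right_diff_distrib sum_subtractf)
  also have "v \<dots> \<le> (\<Sum>i\<in>I. v (q i * y i))" using qK yK by (intro v_sum) simp
  also have "\<dots> \<le> (\<Sum>i\<in>I. v (q i) * (e / L))"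
  proof (rule sum_mono)
    fix i assume i: "i \<in> I"
    then have "v (q i * y i) = v (q i) * v (y i)" using qK yK by simp
    also have "\<dots> \<le> v (q i) * (e / L)"
      using qK c(2)[OF i] by (intro mult_left_mono) (simp_all add: y_def)
    finally show "v (q i * y i) \<le> v (q i) * (e / L)" .
  qed
  also have "\<dots> = (\<Sum>i\<in>I. v (q i)) * (e / L)" by (simp only: sum_distrib_right)
  also have "\<dots> < L * (e / L)" using \<open>e / L > 0\<close> by (intro mult_strict_right_mono) (simp_all add: L_def)
  finally show "\<exists>d. (\<forall>j. d j \<in> \<rat>) \<and> v ((\<Sum>i\<in>I. q i * x i) - (\<Sum>j<m. d j * us j)) < e"
    using L d by auto
qed

text \<open>Linear independence over the completion of the rationals in quantitative form:
  \<open>C\<close> bounds the coordinate maps on rational combinations.\<close>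

definition rat_independent :: "real \<Rightarrow> nat \<Rightarrow> (nat \<Rightarrow> complex) \<Rightarrow> bool" where
  "rat_independent C m us \<longleftrightarrow>
     (\<forall>c. (\<forall>i. c i \<in> \<rat>) \<longrightarrow> (\<forall>i<m. v (c i) \<le> C * v (\<Sum>i<m. c i * us i)))"

text \<open>
  If \<open>x\<close> keeps a distance \<open>e\<close> from all rational combinations of \<open>us\<close>, its coefficient in a
  combination of small absolute value is small; hence so are the other coefficients.
\<close>

lemma rat_independent_extend:
  assumes us: "\<And>i. us i \<in> K" and x: "x \<in> K" and C: "C > 0" "rat_independent C m us"
    and not: "\<not> approximable m us x"
  shows "\<exists>D>0. rat_independent D (Suc m) (us(m := x))"
proof -
  obtain e where e: "e > 0" "\<And>c. (\<And>i. c i \<in> \<rat>) \<Longrightarrow> v (x - (\<Sum>i<m. c i * us i)) \<ge> e"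
    using not unfolding approximable_def by (meson not_less)
  \<comment> \<open>The term \<open>1 / e\<close> takes care of the coefficient of \<open>x\<close>,
    the other term of the coefficients of the old family.\<close>
  define D where "D = C * (1 + v x / e) + 1 / e"
  have D: "D > 0" "1 / e \<le> D" "C * (1 + v x / e) \<le> D"
    using e C x unfolding D_def by (auto intro!: add_nonneg_pos mult_nonneg_nonneg add_nonneg_nonneg)
  have "v (c i) \<le> D * v (\<Sum>i<Suc m. c i * (us(m := x)) i)"
    if c: "\<And>i. c i \<in> \<rat>" and i: "i < Suc m" for c i
  proof -
    have cK: "c i \<in> K" for i using c by simp
    have comb: "(\<Sum>i<m. c i * us i) \<in> K" by (intro rat_combination_mem c us)
    define s where "s = c m * x + (\<Sum>i<m. c i * us i)"
    have s: "(\<Sum>i<Suc m. c i * (us(m := x)) i) = s" by (simp add: s_def)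
    have sK: "s \<in> K" using comb cK x by (simp add: s_def)
    have cm: "v (c m) \<le> v s / e"
    proof (cases "c m = 0")
      case False
      have "s = c m * (x - (\<Sum>i<m. (- c i / c m) * us i))"
        using False by (simp add: s_def sum_distrib_left sum_negf algebra_simps)
      moreover have "(\<Sum>i<m. (- c i / c m) * us i) \<in> K"
        using c by (intro rat_combination_mem us) auto
      ultimately have "v s = v (c m) * v (x - (\<Sum>i<m. (- c i / c m) * us i))"
        using cK x by simp
      also have "\<dots> \<ge> v (c m) * e" using c cK by (intro mult_left_mono e(2)) auto
      finally show ?thesis using e by (simp add: field_simps)
    qed (use sK e in auto)
    show ?thesis
    proof (cases "i = m")
      case True
      have "v (c m) \<le> 1 / e * v s" using cm by simp
      also have "\<dots> \<le> D * v s" using D sK by (intro mult_right_mono) auto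
      finally show ?thesis unfolding s True .
    next
      case False
      then have "i < m" using i by simp
      then have "v (c i) \<le> C * v (\<Sum>i<m. c i * us i)"
        using C c unfolding rat_independent_def by auto
      also have "(\<Sum>i<m. c i * us i) = s - c m * x" by (simp add: s_def)
      also have "v \<dots> \<le> v s + v (c m) * v x" using v_diff[of s "c m * x"] sK cK x by simp
      also have "\<dots> \<le> v s + v s / e * v x" using cm x by (intro add_left_mono mult_right_mono) auto
      also have "\<dots> = (1 + v x / e) * v s" by (simp add: algebra_simps)
      finally have "v (c i) \<le> C * ((1 + v x / e) * v s)" using C by (simp add: mult_left_mono)
      also have "\<dots> \<le> D * v s"
        unfolding mult.assoc[symmetric] using D sK by (intro mult_right_mono) auto
      finally show ?thesis unfolding s .
    qed
  qed
  then show ?thesis using D(1) unfolding rat_independent_def by blast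
qed

text \<open>Greedy selection: the spanning family is traversed, and \<open>w k\<close> is appended
  only if the elements chosen so far do not approximate it. This is the situation in which
  independence extends, and at most \<open>n\<close> elements get chosen.\<close>

lemma local_basis:
  obtains us C where "\<And>i. us i \<in> K" "C > 0" "rat_independent C (local_degree K v) us"
    "\<And>x. x \<in> K \<Longrightarrow> approximable (local_degree K v) us x" "local_degree K v \<le> n"
proof -
  have "\<exists>m\<le>k. \<exists>us C. (\<forall>i. us i \<in> K) \<and> C > 0 \<and> rat_independent C m us \<and> (\<forall>i<k. approximable m us (w i))"
    for k
  proof (induction k)
    case 0
    then show ?case
      by (intro exI[of _ 0] conjI exI[of _ "\<lambda>_. 0"] exI[of _ 1]) (auto simp: rat_independent_def)
  next
    case (Suc k)
    then obtain m us C where IH: "m \<le> k" "\<And>i. us i \<in> K" "C > 0" "rat_independent C m us"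
      "\<And>i. i < k \<Longrightarrow> approximable m us (w i)" by blast
    show ?case
    proof (cases "approximable m us (w k)")
      case True
      then have "\<forall>i<Suc k. approximable m us (w i)" using IH(5) less_Suc_eq by auto
      then show ?thesis using IH by (metis le_SucI)
    next
      case False
      define us' where "us' = us(m := w k)"
      obtain D where D: "D > 0" "rat_independent D (Suc m) us'"
        using rat_independent_extend[OF IH(2) basis_mem IH(3,4) False] unfolding us'_def by auto
      have us': "us' i \<in> K" for i using IH basis_mem by (simp add: us'_def)
      have "approximable (Suc m) us' (w i)" if "i < Suc k" for i
      proof (cases "i = k")
        case True
        have "(\<Sum>j<Suc m. (if j = m then 1 else 0) * us' j) = w k"
          by (simp add: us'_def)
        then show ?thesis unfolding approximable_def True
          by (intro allI impI exI[of _ "\<lambda>j. if j = m then 1 else 0"]) simp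
      next
        case False
        then have "approximable m us (w i)" using IH that by auto
        show ?thesis unfolding approximable_def
        proof (intro allI impI)
          fix e :: real assume "e > 0"
          then obtain c where c: "\<And>i. c i \<in> \<rat>" "v (w i - (\<Sum>j<m. c j * us j)) < e"
            using \<open>approximable m us (w i)\<close> unfolding approximable_def by metis
          have "(\<Sum>j<Suc m. (c(m := 0)) j * us' j) = (\<Sum>j<m. c j * us j)"
            by (auto simp: us'_def intro!: sum.cong)
          then show "\<exists>c. (\<forall>i. c i \<in> \<rat>) \<and> v (w i - (\<Sum>j<Suc m. c j * us' j)) < e"
            using c by (intro exI[of _ "c(m := 0)"]) simp
        qed
      qed
      then show ?thesis using IH(1) us' D by blast
    qed
  qed
  from this[of n] obtain m us C where B: "m \<le> n" "\<And>i. us i \<in> K" "C > 0" "rat_independent C m us"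
    "\<And>i. i < n \<Longrightarrow> approximable m us (w i)" by blast
  have dense: "approximable m us x" if x: "x \<in> K" for x
  proof -
    obtain c where c: "\<And>i. c i \<in> \<rat>" "x = (\<Sum>i<n. c i * w i)" using spanning[OF x] by blast
    have "approximable m us (\<Sum>i<n. c i * w i)"
      by (intro approximable_sum conjI basis_mem B c) auto
    then show ?thesis unfolding c(2) .
  qed
  have "local_degree K v = m"
  proof (rule local_degree_eq)
    show "v (c i) \<le> C * v (\<Sum>i<m. c i * us i)" if "\<And>i. c i \<in> \<rat>" "i < m" for c i
      using B(4) that unfolding rat_independent_def by blast
    show "\<exists>c. (\<forall>i. c i \<in> \<rat>) \<and> v (x - (\<Sum>i<m. c i * us i)) < e" if "x \<in> K" "e > 0" for x e
      using dense that unfolding approximable_def by blast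
  qed (rule B)
  then show ?thesis using B dense that by blast
qed

lemma local_degree_pos: "local_degree K v > 0"
proof (rule ccontr)
  assume "\<not> local_degree K v > 0"
  then have 0: "local_degree K v = 0" by simp
  obtain us where "approximable 0 us 1" using local_basis one_mem unfolding 0 by metis
  then have "\<exists>c. (\<forall>i. c i \<in> \<rat>) \<and> v (1 - (\<Sum>i<0. c i * us i)) < 1"
    unfolding approximable_def using zero_less_one by blast
  then show False by simp
qed

end

section \<open>Weak approximation\<close>

text \<open>Agreement on the rationals, together with a rational \<open>r\<close> of absolute value
  greater than 1, prevents one absolute value from being a nontrivial power of the other. The
  element \<open>r\<close> also serves as a common scale.\<close>

locale two_abs_vals = v: abs_val_field K v + v': abs_val_field K v' for K v v' +
  fixes r :: complex
  assumes agree: "x \<in> \<rat> \<Longrightarrow> v x = v' x" and r: "r \<in> \<rat>" "v r > 1"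
begin

text \<open>A high power of \<open>x\<close> widens the gap between the two values beyond a factor
  \<open>R\<close>. Some power of \<open>R\<close> then lies strictly in between, and dividing by
  the same power of \<open>r\<close> moves it to 1.\<close>

lemma separate_aux:
  assumes x: "x \<in> K" "v x < v' x"
  shows "\<exists>z\<in>K. v z < 1 \<and> v' z > 1"
proof -
  have rK: "r \<in> K" using r by simp
  define R where "R = v r"
  have R: "R > 1" "v' r = R" using r agree by (auto simp: R_def)
  have "x \<noteq> 0" using x by auto
  then have pos: "v x > 0" "v' x > 0" using x by auto
  then have "v' x / v x > 1" using x by simp
  then obtain k where k: "R < (v' x / v x) ^ k" using real_arch_pow by blast
  \<comment> \<open>The least exponent for which \<open>R powi j\<close> exceeds
    \<open>v x ^ k\<close>.\<close>
  define j where "j = \<lfloor>log R (v x ^ k)\<rfloor> + 1"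
  have vk: "v x ^ k > 0" using pos by simp
  have log: "log R (v x ^ k) < of_int j" "of_int j \<le> log R (v x ^ k) + 1"
    unfolding j_def by linarith+
  have "v x ^ k = R powr log R (v x ^ k)" using R vk by simp
  also have "\<dots> < R powr of_int j" using R log by (intro powr_less_mono) auto
  also have "\<dots> = R powi j" using R by (simp add: powr_real_of_int')
  finally have 1: "v x ^ k < R powi j" .
  have "R powi j = R powr of_int j" using R by (simp add: powr_real_of_int')
  also have "\<dots> \<le> R powr (log R (v x ^ k) + 1)" using R log by (intro powr_mono) auto
  also have "\<dots> = v x ^ k * R" using R vk by (simp add: powr_add)
  also have "\<dots> < v x ^ k * (v' x / v x) ^ k" using k vk by simp
  also have "\<dots> = v' x ^ k" using pos by (simp add: power_divide)
  finally have 2: "R powi j < v' x ^ k" .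
  have Rj: "R powi j > 0" using R by simp
  define z where "z = x ^ k / r powi j"
  have "z \<in> K" "v z = v x ^ k / R powi j" "v' z = v' x ^ k / R powi j"
    using x rK R by (simp_all add: z_def R_def)
  then show ?thesis using 1 2 Rj by (intro bexI[of _ z]) (auto simp: divide_less_eq less_divide_eq)
qed

end

lemma two_abs_vals_sym: "two_abs_vals K v v' r \<Longrightarrow> two_abs_vals K v' v r"
  unfolding two_abs_vals_def two_abs_vals_axioms_def by auto

text \<open>If \<open>x\<close> is larger at \<open>v\<close>, the roles are exchanged and the
  element found is inverted.\<close>

lemma (in two_abs_vals) separate:
  assumes "x \<in> K" "v x \<noteq> v' x"
  shows "\<exists>z\<in>K. v z < 1 \<and> v' z > 1"
proof (cases "v x < v' x")
  case True
  then show ?thesis using separate_aux assms by blast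
next
  case False
  interpret s: two_abs_vals K v' v r by (rule two_abs_vals_sym) unfold_locales
  obtain z where z: "z \<in> K" "v' z < 1" "v z > 1" using s.separate_aux[of x] assms False by auto
  have "z \<noteq> 0" using z by auto
  then show ?thesis using z
    by (intro bexI[of _ "inverse z"]) (auto simp: inverse_less_1_iff one_less_inverse_iff)
qed

context abs_val_field
begin

lemma one_plus_power_neq_0: "x \<in> K \<Longrightarrow> v x > 1 \<or> v x < 1 \<Longrightarrow> k > 0 \<Longrightarrow> 1 + x ^ k \<noteq> 0"
proof
  assume x: "x \<in> K" "v x > 1 \<or> v x < 1" "k > 0" and "1 + x ^ k = 0"
  then have "x ^ k = - 1" by (simp add: eq_neg_iff_add_eq_0 add.commute)
  then have "v x ^ k = 1" using v_power[OF x(1), of k] by simp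
  then have "v x = 1" using x power_eq_1_iff[of "v x" k] by simp
  then show False using x by simp
qed

text \<open>The fractions \<open>x ^ k / (1 + x ^ k)\<close> turn a separating element into
  approximate indicators: they tend to 0 where \<open>v x < 1\<close> and to 1 where
  \<open>v x > 1\<close>.\<close>

lemma tendsto_power_fraction_small:
  assumes "x \<in> K" "v x < 1"
  shows "(\<lambda>k. v (x ^ k / (1 + x ^ k))) \<longlonglongrightarrow> 0"
proof (rule tendsto_sandwich[of "\<lambda>_. 0" _ _ "\<lambda>k. v x ^ k / (1 - v x ^ k)"])
  have "(\<lambda>k. v x ^ k) \<longlonglongrightarrow> 0" using assms by (intro LIMSEQ_realpow_zero) auto
  then have "(\<lambda>k. v x ^ k / (1 - v x ^ k)) \<longlonglongrightarrow> 0 / (1 - 0)"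
    by (intro tendsto_divide tendsto_diff tendsto_const) simp_all
  then show "(\<lambda>k. v x ^ k / (1 - v x ^ k)) \<longlonglongrightarrow> 0" by simp
  show "\<forall>\<^sub>F k in sequentially. v (x ^ k / (1 + x ^ k)) \<le> v x ^ k / (1 - v x ^ k)"
    using eventually_gt_at_top[of 0]
  proof eventually_elim
    case (elim k)
    have nz: "1 + x ^ k \<noteq> 0" using one_plus_power_neq_0 assms elim by auto
    have "v (x ^ k / (1 + x ^ k)) = v x ^ k / v (1 + x ^ k)" using assms by simp
    also have "\<dots> \<le> v x ^ k / (1 - v x ^ k)"
    proof (rule divide_left_mono)
      show "1 - v x ^ k \<le> v (1 + x ^ k)"
        using v_diff_ge[of 1 "- (x ^ k)"] assms by simp
      have "v x ^ k < 1" using assms elim power_strict_mono[of "v x" 1 k] by simp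
      moreover have "v (1 + x ^ k) > 0" using assms nz by simp
      ultimately show "0 < v (1 + x ^ k) * (1 - v x ^ k)" by simp
    qed (use assms in auto)
    finally show ?case .
  qed
qed (use assms in \<open>auto intro!: always_eventually\<close>)

text \<open>The distance of the fraction from 1 is, up to sign, the fraction formed with
  \<open>inverse x\<close>.\<close>

lemma tendsto_power_fraction_large:
  assumes "x \<in> K" "v x > 1"
  shows "(\<lambda>k. v (x ^ k / (1 + x ^ k) - 1)) \<longlonglongrightarrow> 0"
proof (rule Lim_transform_eventually)
  have "v (inverse x) < 1" using assms by (simp add: inverse_less_1_iff)
  then show "(\<lambda>k. v (inverse x ^ k / (1 + inverse x ^ k))) \<longlonglongrightarrow> 0"
    using assms by (intro tendsto_power_fraction_small) auto
  show "\<forall>\<^sub>F k in sequentially.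
      v (inverse x ^ k / (1 + inverse x ^ k)) = v (x ^ k / (1 + x ^ k) - 1)"
    using eventually_gt_at_top[of 0]
  proof eventually_elim
    case (elim k)
    have nz: "1 + x ^ k \<noteq> 0" "x \<noteq> 0" using one_plus_power_neq_0 assms elim by auto
    then have "x ^ k / (1 + x ^ k) - 1 = - (inverse x ^ k / (1 + inverse x ^ k))"
      by (simp add: field_simps)
    then show ?case using assms by (simp del: v_divide)
  qed
qed

end

text \<open>The pairwise hypotheses of weak approximation. Distinctness is demanded at a point of
  \<open>K\<close>, because the functions are total and could differ only outside
  \<open>K\<close>.\<close>

definition separated_abs_vals :: "complex set \<Rightarrow> (complex \<Rightarrow> real) set \<Rightarrow> complex \<Rightarrow> bool" where
  "separated_abs_vals K S r \<longleftrightarrow>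
     (\<forall>v\<in>S. abs_val_field K v \<and> v r > 1) \<and>
     (\<forall>v\<in>S. \<forall>v'\<in>S. (\<forall>x\<in>\<rat>. v x = v' x) \<and> (v \<noteq> v' \<longrightarrow> (\<exists>x\<in>K. v x \<noteq> v' x)))"

context complex_subfield
begin

lemma abs_val_fieldI: "absolute_value_on K v \<Longrightarrow> abs_val_field K v"
  by unfold_locales

text \<open>Let \<open>x\<close> work for \<open>T\<close> and let \<open>y\<close> separate
  \<open>v0\<close> from the new \<open>v'\<close>. If \<open>v' x \<le> 1\<close>, then
  \<open>x ^ k * y\<close> works for large \<open>k\<close>. Otherwise powers of \<open>x\<close>
  explode at \<open>v'\<close>; the fractions \<open>e k\<close> replace them, as they are close to
  1 at \<open>v0\<close> and \<open>v'\<close> and close to 0 on \<open>T\<close>.\<close>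

lemma finite_separation:
  assumes "finite T" "v0 \<notin> T" "separated_abs_vals K (insert v0 T) r" "r \<in> \<rat>"
  shows "\<exists>x\<in>K. v0 x > 1 \<and> (\<forall>v\<in>T. v x < 1)"
  using assms
proof (induction T rule: finite_induct)
  case empty
  then show ?case by (intro bexI[of _ r]) (auto simp: separated_abs_vals_def)
next
  case (insert v' T)
  have ab: "abs_val_field K v" if "v \<in> insert v0 (insert v' T)" for v
    using insert.prems that unfolding separated_abs_vals_def by blast
  interpret v0: abs_val_field K v0 by (rule ab) simp
  interpret v': abs_val_field K v' by (rule ab) simp
  have sep: "separated_abs_vals K (insert v0 T) r"
    using insert.prems unfolding separated_abs_vals_def by blast
  obtain x where x: "x \<in> K" "v0 x > 1" "\<And>v. v \<in> T \<Longrightarrow> v x < 1"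
    using insert.IH[OF _ sep] insert.prems by auto
  interpret t: two_abs_vals K v' v0 r
  proof
    show "v' x = v0 x" if "x \<in> \<rat>" for x
      using insert.prems(2) that unfolding separated_abs_vals_def by blast
    show "1 < v' r" using insert.prems(2) unfolding separated_abs_vals_def by blast
  qed (rule insert.prems)
  have "\<exists>z\<in>K. v' z < 1 \<and> v0 z > 1"
  proof -
    have "v' \<noteq> v0" using insert.prems by auto
    then have "\<exists>x\<in>K. v' x \<noteq> v0 x" using insert.prems unfolding separated_abs_vals_def by blast
    then show ?thesis using t.separate by blast
  qed
  then obtain y where y: "y \<in> K" "v' y < 1" "v0 y > 1" by blast
  show ?case
  proof (cases "v' x \<le> 1")
    case True
    have lim: "\<forall>\<^sub>F k in sequentially. v (x ^ k * y) < 1" if "v \<in> T" for v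
    proof -
      interpret v: abs_val_field K v using that by (intro ab) simp
      have "(\<lambda>k. v x ^ k * v y) \<longlonglongrightarrow> 0 * v y"
        using x(1) x(3)[OF that] by (intro tendsto_mult tendsto_const LIMSEQ_realpow_zero) auto
      then have "\<forall>\<^sub>F k in sequentially. v x ^ k * v y < 1"
        by (intro order_tendstoD(2)) auto
      then show ?thesis using x(1) y(1) by simp
    qed
    have "\<forall>\<^sub>F k in sequentially. \<forall>v\<in>T. v (x ^ k * y) < 1"
      using lim insert.hyps(1) by (simp add: eventually_ball_finite)
    then obtain k where k: "\<forall>v\<in>T. v (x ^ k * y) < 1"
      using eventually_happens'[OF sequentially_bot] by blast
    have "v' (x ^ k * y) \<le> 1 * v' y"
      using x(1) y(1) True by (simp add: mult_right_mono power_le_one mult_left_le_one_le)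
    moreover have "v0 (x ^ k * y) > 1"
    proof -
      have "1 * 1 < v0 x ^ k * v0 y"
        using x(1,2) y(1,3) by (intro mult_le_less_imp_less one_le_power) auto
      then show ?thesis using x(1) y(1) by simp
    qed
    ultimately show ?thesis using k x(1) y(1,2) by (intro bexI[of _ "x ^ k * y"]) auto
  next
    case False
    define e where "e k = x ^ k / (1 + x ^ k)" for k
    have eK: "e k \<in> K" for k using x(1) by (simp add: e_def)
    have large: "(\<lambda>k. v (e k * y)) \<longlonglongrightarrow> v y" if "abs_val_field K v" "v x > 1" for v
    proof -
      interpret v: abs_val_field K v by (rule that(1))
      have "(\<lambda>k. \<bar>v (e k) - 1\<bar>) \<longlonglongrightarrow> 0"
      proof (rule tendsto_sandwich[of "\<lambda>_. 0" _ _ "\<lambda>k. v (e k - 1)"])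
        show "(\<lambda>k. v (e k - 1)) \<longlonglongrightarrow> 0"
          unfolding e_def by (rule v.tendsto_power_fraction_large[OF x(1) that(2)])
        show "\<forall>\<^sub>F k in sequentially. \<bar>v (e k) - 1\<bar> \<le> v (e k - 1)"
          using v.v_diff_abs[OF eK one_mem] by (auto intro!: always_eventually)
      qed auto
      then have "(\<lambda>k. v (e k)) \<longlonglongrightarrow> 1" by (simp add: LIM_zero_iff tendsto_rabs_zero_iff)
      then have "(\<lambda>k. v (e k) * v y) \<longlonglongrightarrow> 1 * v y" by (intro tendsto_mult tendsto_const)
      then show ?thesis using eK y(1) by simp
    qed
    have small: "(\<lambda>k. v (e k * y)) \<longlonglongrightarrow> 0" if "abs_val_field K v" "v x < 1" for v
    proof -
      interpret v: abs_val_field K v by (rule that(1))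
      have "(\<lambda>k. v (e k) * v y) \<longlonglongrightarrow> 0 * v y"
        unfolding e_def
        by (intro tendsto_mult tendsto_const v.tendsto_power_fraction_small[OF x(1) that(2)])
      then show ?thesis using eK y(1) by simp
    qed
    have "\<forall>\<^sub>F k in sequentially. \<forall>v\<in>T. v (e k * y) < 1"
    proof -
      have "\<forall>\<^sub>F k in sequentially. v (e k * y) < 1" if "v \<in> T" for v
        using small[OF ab[of v] x(3)[OF that]] that by (intro order_tendstoD(2)) auto
      then show ?thesis using insert.hyps(1) by (simp add: eventually_ball_finite)
    qed
    moreover have "\<forall>\<^sub>F k in sequentially. v' (e k * y) < 1"
      using order_tendstoD(2)[OF large[OF ab[of v']], of 1] False y(2) by simp
    moreover have "\<forall>\<^sub>F k in sequentially. v0 (e k * y) > 1"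
      using order_tendstoD(1)[OF large[OF ab[of v0]], of 1] x(2) y(3) by simp
    ultimately have "\<forall>\<^sub>F k in sequentially. (\<forall>v\<in>T. v (e k * y) < 1) \<and> v' (e k * y) < 1 \<and> v0 (e k * y) > 1"
      by eventually_elim auto
    then obtain k where "(\<forall>v\<in>T. v (e k * y) < 1) \<and> v' (e k * y) < 1 \<and> v0 (e k * y) > 1"
      using eventually_happens'[OF sequentially_bot] by blast
    then show ?thesis using eK y(1) by (intro bexI[of _ "e k * y"]) auto
  qed
qed

text \<open>The fractions formed from an element that is large at \<open>v0\<close> only are close
  to 1 at \<open>v0\<close> and close to 0 elsewhere.\<close>

lemma weak_approximation:
  assumes "finite S" "v0 \<in> S" "separated_abs_vals K S r" "r \<in> \<rat>" "\<delta> > 0"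
  shows "\<exists>x\<in>K. v0 (x - 1) < \<delta> \<and> (\<forall>v\<in>S - {v0}. v x < \<delta>)"
proof -
  have "insert v0 (S - {v0}) = S" using assms by auto
  then obtain x where x: "x \<in> K" "v0 x > 1" "\<And>v. v \<in> S - {v0} \<Longrightarrow> v x < 1"
    using finite_separation[of "S - {v0}" v0 r] assms by auto
  have ab: "abs_val_field K v" if "v \<in> S" for v
    using assms that unfolding separated_abs_vals_def by blast
  have "\<forall>\<^sub>F k in sequentially. v0 (x ^ k / (1 + x ^ k) - 1) < \<delta>"
    using abs_val_field.tendsto_power_fraction_large[OF ab[OF assms(2)] x(1,2)] assms
    by (intro order_tendstoD(2)) auto
  moreover have "\<forall>\<^sub>F k in sequentially. \<forall>v\<in>S - {v0}. v (x ^ k / (1 + x ^ k)) < \<delta>"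
  proof -
    have "\<forall>\<^sub>F k in sequentially. v (x ^ k / (1 + x ^ k)) < \<delta>" if "v \<in> S - {v0}" for v
      using abs_val_field.tendsto_power_fraction_small[OF ab[of v] x(1) x(3)[OF that]]
        assms that by (intro order_tendstoD(2)) auto
    then show ?thesis using assms(1) by (simp add: eventually_ball_finite)
  qed
  ultimately have "\<forall>\<^sub>F k in sequentially. v0 (x ^ k / (1 + x ^ k) - 1) < \<delta> \<and>
      (\<forall>v\<in>S - {v0}. v (x ^ k / (1 + x ^ k)) < \<delta>)"
    by eventually_elim auto
  then obtain k where "v0 (x ^ k / (1 + x ^ k) - 1) < \<delta> \<and>
      (\<forall>v\<in>S - {v0}. v (x ^ k / (1 + x ^ k)) < \<delta>)"
    using eventually_happens'[OF sequentially_bot] by blast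
  then show ?thesis using x(1) by (intro bexI[of _ "x ^ k / (1 + x ^ k)"]) auto
qed

end

text \<open>
  Approximating local bases simultaneously by elements of \<open>K\<close> gives elements that are linearly
  independent over \<open>\<rat>\<close>: in a relation with largest coefficient belonging to the place \<open>v\<close>, all
  terms but the combination of the local basis at \<open>v\<close> are negligible at \<open>v\<close>.
\<close>

lemma (in number_field) sum_local_degree_le:
  assumes S: "finite S" "separated_abs_vals K S r" and r: "r \<in> \<rat>"
  shows "(\<Sum>v\<in>S. local_degree K v) \<le> n"
proof (rule ccontr)
  assume contra: "\<not> (\<Sum>v\<in>S. local_degree K v) \<le> n"
  let ?m = "local_degree K"
  have ab: "abs_val_field K v" if "v \<in> S" for v
    using S that unfolding separated_abs_vals_def by blast
  have nfa: "number_field_abs K n w v" if "v \<in> S" for v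
    using ab[OF that] number_field_axioms by (rule number_field_abs.intro[rotated])
  have "\<forall>v\<in>S. \<exists>us C. (\<forall>i. us i \<in> K) \<and> C > 0 \<and> number_field_abs.rat_independent v C (?m v) us"
    using number_field_abs.local_basis[OF nfa] by metis
  then obtain us C where us: "\<And>v i. v \<in> S \<Longrightarrow> us v i \<in> K" and C: "\<And>v. v \<in> S \<Longrightarrow> C v > 0"
    "\<And>v. v \<in> S \<Longrightarrow> number_field_abs.rat_independent v (C v) (?m v) (us v)" by metis
  \<comment> \<open>One index for each place and each member of its local basis; the hypothesis to
    be refuted says that there are more than \<open>n\<close> of them.\<close>
  define F where "F = Sigma S (\<lambda>v. {..<?m v})"
  have F: "finite F" using S by (auto simp: F_def)
  have cardF: "card F = (\<Sum>v\<in>S. ?m v)" using S by (simp add: F_def)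
  have bounded: "\<exists>M\<ge>1. \<forall>x\<in>A. x \<le> M" if "finite A" for A :: "real set"
    using that by (intro exI[of _ "Max (insert 1 A)"]) simp
  have "\<exists>M\<ge>1. \<forall>x\<in>(\<lambda>(v, l). v (us (fst l) (snd l))) ` (S \<times> F). x \<le> M"
    using S F by (intro bounded) simp
  then obtain M where M1: "M \<ge> 1" and M: "\<And>v l. v \<in> S \<Longrightarrow> l \<in> F \<Longrightarrow> v (us (fst l) (snd l)) \<le> M"
    by fastforce
  obtain B where B: "B \<ge> 1" "\<And>v. v \<in> S \<Longrightarrow> C v \<le> B" using bounded[of "C ` S"] S by auto
  obtain v1 where v1: "v1 \<in> S" using contra by (cases "S = {}") auto
  \<comment> \<open>Small enough for \<open>B * (card F * M) * \<delta> < 1\<close>, which is the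
    final contradiction.\<close>
  define \<delta> where "\<delta> = 1 / (B * (card F * M) + 1)"
  have pos: "B * (card F * M) + 1 > 0" using B(1) M1 by (intro add_nonneg_pos) auto
  then have \<delta>: "\<delta> > 0" by (simp add: \<delta>_def)
  have "\<forall>v\<in>S. \<exists>e\<in>K. v (e - 1) < \<delta> \<and> (\<forall>v'\<in>S - {v}. v' e < \<delta>)"
    using weak_approximation[OF S(1) _ S(2) r \<delta>] by blast
  then obtain e where e: "\<And>v. v \<in> S \<Longrightarrow> e v \<in> K" "\<And>v. v \<in> S \<Longrightarrow> v (e v - 1) < \<delta>"
    "\<And>v v'. v \<in> S \<Longrightarrow> v' \<in> S \<Longrightarrow> v' \<noteq> v \<Longrightarrow> v' (e v) < \<delta>"
    by (metis Diff_iff singletonD)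
  define x where "x l = e (fst l) * us (fst l) (snd l)" for l
  have xK: "x l \<in> K" if "l \<in> F" for l using that e us by (auto simp: x_def F_def)
  have "\<forall>l\<in>F. \<exists>A. (\<forall>i. A i \<in> \<rat>) \<and> x l = (\<Sum>i<n. A i * w i)"
    using spanning xK by blast
  then obtain A where A: "\<And>l i. l \<in> F \<Longrightarrow> A l i \<in> \<rat>" "\<And>l. l \<in> F \<Longrightarrow> x l = (\<Sum>i<n. A l i * w i)"
    by metis
  have "\<exists>c. (\<forall>l. c l \<in> \<rat>) \<and> (\<exists>l\<in>F. c l \<noteq> 0) \<and> (\<forall>i\<in>{..<n}. (\<Sum>l\<in>F. c l * A l i) = 0)"
    using F contra cardF A(1)
    by (intro complex_subfield.homogeneous_system[OF complex_subfield_Rats]) auto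
  then obtain c where c: "\<And>l. c l \<in> \<rat>" "\<exists>l\<in>F. c l \<noteq> 0"
    "\<And>i. i < n \<Longrightarrow> (\<Sum>l\<in>F. c l * A l i) = 0" by auto
  have cK: "c l \<in> K" for l using c by simp
  have sum0: "(\<Sum>l\<in>F. c l * x l) = 0"
  proof -
    have "(\<Sum>l\<in>F. c l * x l) = (\<Sum>l\<in>F. \<Sum>i<n. c l * A l i * w i)"
      using A(2) by (intro sum.cong) (auto simp: sum_distrib_left mult.assoc)
    also have "\<dots> = (\<Sum>i<n. (\<Sum>l\<in>F. c l * A l i) * w i)"
      unfolding sum_distrib_right by (rule sum.swap)
    also have "\<dots> = 0" using c(3) by simp
    finally show ?thesis .
  qed
  \<comment> \<open>All places of \<open>S\<close> agree on rational coefficients, so the notion of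
    a largest coefficient does not depend on the place and may be measured by
    \<open>v1\<close>.\<close>
  have agree: "v y = v1 y" if "v \<in> S" "y \<in> \<rat>" for v y
    using S that v1 unfolding separated_abs_vals_def by blast
  have "F \<noteq> {}" using c by auto
  then have "Max ((\<lambda>l. v1 (c l)) ` F) \<in> (\<lambda>l. v1 (c l)) ` F" using F by (intro Max_in) auto
  then obtain l0 where "l0 \<in> F" "Max ((\<lambda>l. v1 (c l)) ` F) = v1 (c l0)" by auto
  then have l0: "l0 \<in> F" "\<And>l. l \<in> F \<Longrightarrow> v1 (c l) \<le> v1 (c l0)"
    using F Max_ge[of "(\<lambda>l. v1 (c l)) ` F"] by auto
  define \<beta> where "\<beta> = v1 (c l0)"
  interpret v1: abs_val_field K v1 by (rule ab[OF v1])
  have \<beta>: "\<beta> > 0"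
  proof -
    obtain l where "l \<in> F" "c l \<noteq> 0" using c by blast
    then have "0 < v1 (c l)" using cK by simp
    then show ?thesis using l0(2)[OF \<open>l \<in> F\<close>] by (simp add: \<beta>_def)
  qed
  define v0 i0 where "v0 = fst l0" and "i0 = snd l0"
  have v0: "v0 \<in> S" "i0 < ?m v0" "l0 = (v0, i0)" using l0(1) by (auto simp: F_def v0_def i0_def)
  interpret v0: number_field_abs K n w v0 by (rule nfa[OF v0(1)])
  have bound: "v0 (c l) \<le> \<beta>" if "l \<in> F" for l
    using l0(2)[OF that] agree[OF v0(1) c(1)] by (simp add: \<beta>_def)
  \<comment> \<open>The error in term \<open>l\<close> when the factor \<open>e (fst l)\<close> is
    replaced by its limit at \<open>v0\<close>, which is 1 for the place \<open>v0\<close> and 0 for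
    the others. As the relation sums to 0, the errors sum to the combination of the local basis at
    \<open>v0\<close>.\<close>
  define T where "T l = (if fst l = v0 then c l * us v0 (snd l) else 0) - c l * x l" for l
  have TK: "T l \<in> K" if "l \<in> F" for l
    using that cK us v0 xK by (auto simp: T_def)
  have T: "v0 (T l) \<le> \<beta> * (\<delta> * M)" if l: "l \<in> F" for l
  proof -
    have lS: "fst l \<in> S" using l by (auto simp: F_def)
    have usK: "us (fst l) (snd l) \<in> K" using us lS by auto
    define y where "y = (if fst l = v0 then 1 - e (fst l) else - e (fst l))"
    have yK: "y \<in> K" using e lS by (auto simp: y_def)
    have "T l = c l * (y * us (fst l) (snd l))"
      by (auto simp: T_def y_def x_def algebra_simps)
    then have "v0 (T l) = v0 (c l) * (v0 y * v0 (us (fst l) (snd l)))"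
      using cK yK usK by simp
    also have "v0 y \<le> \<delta>"
      using e(2)[OF lS] e(3)[OF lS v0(1)] v0.v_commute[OF one_mem e(1)[OF lS]] e(1)[OF lS]
      by (auto simp: y_def)
    then have "v0 (c l) * (v0 y * v0 (us (fst l) (snd l))) \<le> \<beta> * (\<delta> * M)"
      using M[OF v0(1) l] \<delta> bound[OF l] \<beta> yK usK cK by (intro mult_mono mult_nonneg_nonneg) auto
    finally show ?thesis .
  qed
  have "(\<Sum>l\<in>F. T l) = (\<Sum>l\<in>F. if fst l = v0 then c l * us v0 (snd l) else 0)"
    unfolding T_def sum_subtractf sum0 by simp
  also have "\<dots> = (\<Sum>v\<in>S. \<Sum>i<?m v. if v = v0 then c (v, i) * us v0 i else 0)"
    unfolding F_def using S by (subst sum.Sigma) (auto simp: case_prod_unfold intro!: sum.cong)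
  also have "\<dots> = (\<Sum>v\<in>S. if v = v0 then (\<Sum>i<?m v0. c (v0, i) * us v0 i) else 0)"
    by (intro sum.cong) auto
  also have "\<dots> = (\<Sum>i<?m v0. c (v0, i) * us v0 i)" using S v0 by simp
  finally have eq: "(\<Sum>i<?m v0. c (v0, i) * us v0 i) = (\<Sum>l\<in>F. T l)" by simp
  have "\<beta> = v0 (c (v0, i0))" using agree[OF v0(1) c(1)] v0 by (simp add: \<beta>_def)
  also have "\<dots> \<le> C v0 * v0 (\<Sum>i<?m v0. c (v0, i) * us v0 i)"
    using C(2)[OF v0(1), unfolded v0.rat_independent_def, rule_format, of "\<lambda>i. c (v0, i)" i0]
      v0(2) c(1) by simp
  also have "\<dots> \<le> B * (card F * (\<beta> * (\<delta> * M)))"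
  proof (rule mult_mono)
    have "v0 (\<Sum>l\<in>F. T l) \<le> (\<Sum>l\<in>F. v0 (T l))" by (rule v0.v_sum) (rule TK)
    also have "\<dots> \<le> of_nat (card F) * (\<beta> * (\<delta> * M))" by (rule sum_bounded_above) (rule T)
    finally show "v0 (\<Sum>i<?m v0. c (v0, i) * us v0 i) \<le> card F * (\<beta> * (\<delta> * M))" unfolding eq .
    show "0 \<le> v0 (\<Sum>i<?m v0. c (v0, i) * us v0 i)" unfolding eq using TK by simp
  qed (use B v0(1) in auto)
  also have "\<dots> = \<beta> * ((B * (card F * M)) * \<delta>)" by (simp add: algebra_simps)
  also have "\<dots> < \<beta> * 1"
  proof (rule mult_strict_left_mono)
    show "B * (card F * M) * \<delta> < 1" unfolding \<delta>_def using pos by (simp add: divide_less_eq)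
  qed (rule \<beta>)
  finally show False by simp
qed

section \<open>The field of algebraic numbers\<close>

definition rat_span :: "'i set \<Rightarrow> ('i \<Rightarrow> complex) \<Rightarrow> complex set" where
  "rat_span I g = {\<Sum>j\<in>I. c j * g j | c. \<forall>j. c j \<in> \<rat>}"

lemma rat_spanI: "(\<And>j. c j \<in> \<rat>) \<Longrightarrow> (\<Sum>j\<in>I. c j * g j) \<in> rat_span I g"
  unfolding rat_span_def by blast

lemma rat_spanE:
  assumes "x \<in> rat_span I g"
  obtains c where "\<forall>j. c j \<in> \<rat>" "x = (\<Sum>j\<in>I. c j * g j)"
  using assms unfolding rat_span_def by blast

lemma rat_span_0: "0 \<in> rat_span I g"
  using rat_spanI[of "\<lambda>_. 0" g I] by simp

lemma rat_span_base: "finite I \<Longrightarrow> i \<in> I \<Longrightarrow> g i \<in> rat_span I g"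
  using rat_spanI[of "\<lambda>j. if j = i then 1 else 0" g I] by (simp add: if_distrib[of "\<lambda>c. c * _"] cong: if_cong)

lemma rat_span_add: "x \<in> rat_span I g \<Longrightarrow> y \<in> rat_span I g \<Longrightarrow> x + y \<in> rat_span I g"
proof (elim rat_spanE)
  fix c d assume c: "\<forall>j. c j \<in> \<rat>" "x = (\<Sum>j\<in>I. c j * g j)" and d: "\<forall>j. d j \<in> \<rat>" "y = (\<Sum>j\<in>I. d j * g j)"
  show "x + y \<in> rat_span I g"
    using rat_spanI[of "\<lambda>j. c j + d j" g I] c d by (simp add: sum.distrib distrib_right)
qed

lemma rat_span_scale: "x \<in> rat_span I g \<Longrightarrow> q \<in> \<rat> \<Longrightarrow> q * x \<in> rat_span I g"
proof (elim rat_spanE)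
  fix c assume c: "\<forall>j. c j \<in> \<rat>" "x = (\<Sum>j\<in>I. c j * g j)" and "q \<in> \<rat>"
  then show "q * x \<in> rat_span I g"
    using rat_spanI[of "\<lambda>j. q * c j" g I] by (simp add: sum_distrib_left mult.assoc)
qed

lemma rat_span_sum: "(\<And>i. i \<in> J \<Longrightarrow> f i \<in> rat_span I g) \<Longrightarrow> sum f J \<in> rat_span I g"
  by (induction J rule: infinite_finite_induct) (auto intro: rat_span_0 rat_span_add)

lemma rat_span_mult:
  assumes "\<And>i. i \<in> I \<Longrightarrow> z * g i \<in> rat_span I g" and "x \<in> rat_span I g"
  shows "z * x \<in> rat_span I g"
proof -
  obtain c where c: "\<forall>j. c j \<in> \<rat>" "x = (\<Sum>j\<in>I. c j * g j)" using assms(2) by (rule rat_spanE)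
  have "z * x = (\<Sum>j\<in>I. c j * (z * g j))" unfolding c(2) sum_distrib_left by (simp add: mult_ac)
  also have "\<dots> \<in> rat_span I g" using c(1) by (intro rat_span_sum rat_span_scale[OF assms(1)]) auto
  finally show ?thesis .
qed

text \<open>The \<open>card I + 1\<close> elements \<open>z ^ k * g i0\<close> with
  \<open>k \<le> card I\<close> lie in the span of \<open>card I\<close> elements. A relation among
  them is a polynomial equation for \<open>z\<close>, since \<open>g i0\<close> can be
  cancelled.\<close>

lemma algebraic_if_stable:
  assumes I: "finite I" "i0 \<in> I" "g i0 \<noteq> 0" and stable: "\<And>i. i \<in> I \<Longrightarrow> z * g i \<in> rat_span I g"
  shows "algebraic z"
proof -
  have "z ^ k * g i0 \<in> rat_span I g" for k
    by (induction k) (auto simp: mult.assoc I intro!: rat_span_base rat_span_mult stable)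
  then have "\<forall>k. \<exists>A. (\<forall>i. A i \<in> \<rat>) \<and> z ^ k * g i0 = (\<Sum>j\<in>I. A j * g j)"
    unfolding rat_span_def by blast
  then obtain A where A: "\<And>k i. A k i \<in> \<rat>" "\<And>k. z ^ k * g i0 = (\<Sum>j\<in>I. A k j * g j)" by metis
  have "\<exists>c. (\<forall>l. c l \<in> \<rat>) \<and> (\<exists>l\<in>{..card I}. c l \<noteq> 0) \<and> (\<forall>i\<in>I. (\<Sum>l\<le>card I. c l * A l i) = 0)"
    using I A by (intro complex_subfield.homogeneous_system[OF complex_subfield_Rats]) auto
  then obtain c where c: "\<And>l. c l \<in> \<rat>" "\<exists>l\<in>{..card I}. c l \<noteq> 0"
    "\<And>i. i \<in> I \<Longrightarrow> (\<Sum>l\<le>card I. c l * A l i) = 0" by auto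
  define p where "p = (\<Sum>l\<le>card I. monom (c l) l)"
  have coeff: "coeff p l = (if l \<le> card I then c l else 0)" for l
    by (simp add: p_def coeff_sum)
  have "poly p z * g i0 = (\<Sum>l\<le>card I. c l * (z ^ l * g i0))"
    by (simp add: p_def poly_sum poly_monom sum_distrib_right mult.assoc)
  also have "\<dots> = (\<Sum>l\<le>card I. \<Sum>j\<in>I. c l * A l j * g j)"
    unfolding A(2) sum_distrib_left by (simp add: mult.assoc)
  also have "\<dots> = (\<Sum>j\<in>I. (\<Sum>l\<le>card I. c l * A l j) * g j)"
    unfolding sum_distrib_right by (rule sum.swap)
  also have "\<dots> = 0" using c(3) by simp
  finally have "poly p z = 0" using I by simp
  moreover have "p \<noteq> 0"
  proof
    assume "p = 0"
    then show False using c(2) coeff by (metis atMost_iff coeff_0)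
  qed
  ultimately show ?thesis using c(1) coeff by (intro algebraicI'[of p]) auto
qed

lemma algebraic_power_relation:
  assumes "algebraic (x :: complex)"
  obtains n c where "n > 0" "\<And>i. c i \<in> \<rat>" "x ^ n = (\<Sum>i<n. c i * x ^ i)"
proof -
  obtain p where p: "\<And>i. coeff p i \<in> \<rat>" "p \<noteq> 0" "poly p x = 0"
    using assms unfolding algebraic_altdef by blast
  define n where "n = degree p"
  have "n > 0"
  proof (rule ccontr)
    assume "\<not> n > 0"
    then have "degree p = 0" by (simp add: n_def)
    then obtain a where "p = [:a:]" by (rule degree_eq_zeroE)
    then show False using p by auto
  qed
  moreover have "x ^ n = (\<Sum>i<n. (- coeff p i / lead_coeff p) * x ^ i)"
  proof -
    have "0 = (\<Sum>i<n. coeff p i * x ^ i) + lead_coeff p * x ^ n"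
      using p(3) by (simp add: poly_altdef n_def lessThan_Suc_atMost[symmetric])
    then have "x ^ n = - (\<Sum>i<n. coeff p i * x ^ i) / lead_coeff p"
      using p(2) by (simp add: field_simps eq_neg_iff_add_eq_0)
    also have "\<dots> = (\<Sum>i<n. (- coeff p i / lead_coeff p) * x ^ i)"
      by (simp add: sum_divide_distrib sum_negf)
    finally show ?thesis .
  qed
  ultimately show ?thesis using p(1) by (intro that[of n "\<lambda>i. - coeff p i / lead_coeff p"]) simp_all
qed

lemma rat_span_product:
  assumes x: "x \<in> rat_span I g" and y: "y \<in> rat_span J h"
  shows "x * y \<in> rat_span (I \<times> J) (\<lambda>l. g (fst l) * h (snd l))"
proof -
  obtain c where c: "\<forall>i. c i \<in> \<rat>" "x = (\<Sum>i\<in>I. c i * g i)" using x by (rule rat_spanE)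
  obtain d where d: "\<forall>j. d j \<in> \<rat>" "y = (\<Sum>j\<in>J. d j * h j)" using y by (rule rat_spanE)
  have "x * y = (\<Sum>l\<in>I \<times> J. (c (fst l) * d (snd l)) * (g (fst l) * h (snd l)))"
    unfolding c(2) d(2) sum_product sum.cartesian_product by (simp add: case_prod_unfold mult_ac)
  also have "\<dots> \<in> rat_span (I \<times> J) (\<lambda>l. g (fst l) * h (snd l))"
    using c(1) d(1) by (intro rat_spanI) simp
  finally show ?thesis .
qed

lemma algebraic_power_span:
  assumes "algebraic (x :: complex)"
  obtains n where "n > 0" "\<And>i. i \<le> n \<Longrightarrow> x ^ i \<in> rat_span {..<n} (\<lambda>i. x ^ i)"
proof -
  obtain n c where n: "n > 0" "\<And>i. c i \<in> \<rat>" "x ^ n = (\<Sum>i<n. c i * x ^ i)"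
    using algebraic_power_relation[OF assms] by metis
  show ?thesis
  proof (rule that[OF n(1)])
    fix i assume "i \<le> n"
    then consider "i < n" | "i = n" by linarith
    then show "x ^ i \<in> rat_span {..<n} (\<lambda>i. x ^ i)"
    proof cases
      case 1
      then show ?thesis using rat_span_base[of "{..<n}" i "\<lambda>i. x ^ i"] by simp
    next
      case 2
      then show ?thesis using n(3) rat_spanI[OF n(2)] by simp
    qed
  qed
qed

text \<open>The span of the products \<open>x ^ i * y ^ j\<close> with \<open>i < n\<close> and
  \<open>j < m\<close> is stable under multiplication by \<open>x\<close> and by \<open>y\<close>,
  hence by their sum and product.\<close>

lemma algebraic_add_mult:
  assumes "algebraic (x :: complex)" "algebraic y"
  shows "algebraic (x + y)" "algebraic (x * y)"
proof -
  obtain n where n: "n > 0" "\<And>i. i \<le> n \<Longrightarrow> x ^ i \<in> rat_span {..<n} (\<lambda>i. x ^ i)"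
    using algebraic_power_span[OF assms(1)] by metis
  obtain m where m: "m > 0" "\<And>i. i \<le> m \<Longrightarrow> y ^ i \<in> rat_span {..<m} (\<lambda>i. y ^ i)"
    using algebraic_power_span[OF assms(2)] by metis
  define I where "I = {..<n} \<times> {..<m}"
  define g where "g l = x ^ fst l * y ^ snd l" for l
  have span: "x ^ i * y ^ j \<in> rat_span I g" if "i \<le> n" "j \<le> m" for i j
    unfolding I_def g_def[abs_def] by (rule rat_span_product) (use n m that in auto)
  have x: "x * g l \<in> rat_span I g" and y: "y * g l \<in> rat_span I g" if "l \<in> I" for l
    using that span[of "Suc (fst l)" "snd l"] span[of "fst l" "Suc (snd l)"]
    by (auto simp: I_def g_def mult_ac)
  have fin: "finite I" and I0: "(0, 0) \<in> I" "g (0, 0) \<noteq> 0" using n m by (auto simp: I_def g_def)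
  show "algebraic (x + y)"
    using x y by (intro algebraic_if_stable[where g = g, OF fin I0]) (auto simp: distrib_right intro: rat_span_add)
  show "algebraic (x * y)"
    using x y by (intro algebraic_if_stable[where g = g, OF fin I0]) (auto simp: mult.assoc intro: rat_span_mult)
qed

lemma complex_subfield_algebraic: "complex_subfield (Collect algebraic)"
proof
  fix x y :: complex assume "x \<in> Collect algebraic" "y \<in> Collect algebraic"
  then show "x - y \<in> Collect algebraic"
    using algebraic_add_mult(1)[of x "- y"] by simp
qed (auto simp: algebraic_add_mult)

section \<open>Extending the p-adic absolute value to the algebraic numbers\<close>

lemma poly_eq_sum_le:
  fixes p :: "'a :: comm_semiring_1 poly"
  assumes "degree p \<le> n"
  shows "poly p x = (\<Sum>i\<le>n. coeff p i * x ^ i)"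
  by (subst (1) poly_as_sum_of_monoms'[OF assms, symmetric]) (simp add: poly_sum poly_monom)

text \<open>Chevalley's construction of a valuation: maximality with \<open>1 / q\<close> excluded
  will force a valuation ring of the algebraic numbers in which \<open>q\<close> is not a
  unit.\<close>

locale maximal_subring = complex_subring R for R +
  fixes q :: nat
  assumes prime_q: "Factorial_Ring.prime q"
    and R_alg: "x \<in> R \<Longrightarrow> algebraic x"
    and R_q: "inverse (of_nat q) \<notin> R"
    and R_max: "\<lbrakk>R \<subseteq> T; complex_subring T; T \<subseteq> Collect algebraic; inverse (of_nat q) \<notin> T\<rbrakk> \<Longrightarrow> T = R"

text \<open>Zorn's lemma, starting from the integers. A union of a nonempty chain is again a subring
  because any two of its elements lie in a common member.\<close>

lemma exists_maximal_subring:
  assumes "Factorial_Ring.prime (q :: nat)"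
  shows "\<exists>R. maximal_subring R q"
proof -
  define \<A> where
    "\<A> = {T. complex_subring T \<and> T \<subseteq> Collect algebraic \<and> inverse (of_nat q :: complex) \<notin> T}"
  have "inverse (of_nat q :: complex) \<notin> \<int>"
  proof
    assume "inverse (of_nat q :: complex) \<in> \<int>"
    then obtain k where "inverse (of_nat q :: complex) = of_int k" by (rule Ints_cases)
    then have "(of_int (k * int q) :: complex) = of_int 1"
      using prime_gt_0_nat[OF assms] by (simp add: field_simps)
    then have "k * int q = 1" by (simp only: of_int_eq_iff)
    then have "int q dvd 1" by (metis dvd_triv_right)
    then show False using prime_gt_1_nat[OF assms] by simp
  qed
  moreover have "complex_subring \<int>" by unfold_locales auto
  ultimately have "\<int> \<in> \<A>" by (auto simp: \<A>_def elim!: Ints_cases)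
  then have "\<A> \<noteq> {}" by auto
  moreover have "\<Union>C \<in> \<A>" if C: "C \<noteq> {}" "subset.chain \<A> C" for C
  proof -
    have sub: "T \<in> \<A>" if "T \<in> C" for T using C that by (auto simp: subset.chain_def)
    have common: "\<exists>T\<in>C. x \<in> T \<and> y \<in> T" if "x \<in> \<Union>C" "y \<in> \<Union>C" for x y
      using C that unfolding subset.chain_def by blast
    have "complex_subring (\<Union>C)"
    proof
      obtain T where "T \<in> C" using C(1) by blast
      then show "1 \<in> \<Union>C" using sub complex_subring.one_mem unfolding \<A>_def by blast
      fix x y assume "x \<in> \<Union>C" "y \<in> \<Union>C"
      then obtain T where T: "T \<in> C" "x \<in> T" "y \<in> T" using common by blast
      then interpret complex_subring T using sub unfolding \<A>_def by blast
      show "x - y \<in> \<Union>C" "x * y \<in> \<Union>C" using T diff_mem mult_mem by blast+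
    qed
    then show ?thesis using sub unfolding \<A>_def by blast
  qed
  ultimately have "\<exists>M\<in>\<A>. \<forall>Y\<in>\<A>. M \<subseteq> Y \<longrightarrow> Y = M" by (rule subset_Zorn_nonempty)
  then obtain M where M: "M \<in> \<A>" "\<And>Y. Y \<in> \<A> \<Longrightarrow> M \<subseteq> Y \<Longrightarrow> Y = M" by blast
  then have "maximal_subring M q"
    using assms by (auto simp: maximal_subring_def maximal_subring_axioms_def \<A>_def)
  then show ?thesis by blast
qed

context maximal_subring
begin

abbreviation Q :: complex where "Q \<equiv> of_nat q"

lemma q_nz [simp]: "q \<noteq> 0"
  using prime_gt_0_nat[OF prime_q] by simp

lemma Q_nz [simp]: "Q \<noteq> 0"
  using prime_gt_0_nat[OF prime_q] by simp

lemma not_q_multiple: "x \<in> R \<Longrightarrow> 1 \<noteq> Q * x"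
  using R_q by (metis inverse_unique)

text \<open>If \<open>1 / q\<close> were in \<open>R[1 / u]\<close>, a power of \<open>u\<close> would be a multiple of \<open>q\<close> and \<open>\<equiv> 1\<close> modulo \<open>q\<close>.\<close>

lemma one_plus_unit:
  assumes t: "t \<in> R" shows "inverse (1 + Q * t) \<in> R"
proof -
  define u where "u = 1 + Q * t"
  have u: "u \<in> R" using t by (simp add: u_def)
  have unz: "u \<noteq> 0"
  proof
    assume "u = 0"
    then have "1 = Q * (- t)" by (simp add: u_def eq_neg_iff_add_eq_0)
    then show False using not_q_multiple[of "- t"] t by simp
  qed
  have u_power: "\<exists>s\<in>R. u ^ k = 1 + Q * s" for k
  proof (induction k)
    case (Suc k)
    then obtain s where s: "s \<in> R" "u ^ k = 1 + Q * s" by blast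
    have "u ^ Suc k = 1 + Q * (s + t + Q * s * t)" by (simp add: s(2)) (simp add: u_def algebra_simps)
    then show ?case using s t by (intro bexI[of _ "s + t + Q * s * t"]) auto
  qed (auto intro!: bexI[of _ 0])
  define T where "T = {r / u ^ k | r k. r \<in> R}"
  have T: "r / u ^ k \<in> T" if "r \<in> R" for r k using that unfolding T_def by blast
  have "T = R"
  proof (rule R_max)
    show "R \<subseteq> T" using T[of _ 0] by auto
    show "T \<subseteq> Collect algebraic"
    proof
      fix x assume "x \<in> T"
      then obtain r k where "r \<in> R" "x = r / u ^ k" unfolding T_def by blast
      then show "x \<in> Collect algebraic" using complex_subfield.divide_mem[OF complex_subfield_algebraic, of r "u ^ k"]
          R_alg[of r] R_alg[of "u ^ k"] u by simp
    qed
    show "complex_subring T"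
    proof
      show "1 \<in> T" using T[of 1 0] by simp
      fix x y assume "x \<in> T" "y \<in> T"
      then obtain r k s l where r: "r \<in> R" "x = r / u ^ k" and s: "s \<in> R" "y = s / u ^ l"
        unfolding T_def by blast
      have "x - y = (r * u ^ l - s * u ^ k) / u ^ (k + l)"
        using unz by (simp add: r s power_add field_simps)
      then show "x - y \<in> T" using T[of "r * u ^ l - s * u ^ k" "k + l"] r s u by simp
      have "x * y = (r * s) / u ^ (k + l)" by (simp add: r s power_add)
      then show "x * y \<in> T" using T[of "r * s" "k + l"] r(1) s(1) by simp
    qed
    show "inverse Q \<notin> T"
    proof
      assume "inverse Q \<in> T"
      then obtain r k where r: "r \<in> R" "inverse Q = r / u ^ k" unfolding T_def by blast
      obtain s where s: "s \<in> R" "u ^ k = 1 + Q * s" using u_power by blast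
      have "u ^ k = Q * r"
        using r(2) unz by (simp add: field_simps)
      then have "1 = Q * (r - s)"
        using s(2) by (simp add: algebra_simps)
      then show False using not_q_multiple[of "r - s"] r s by simp
    qed
  qed
  then show ?thesis using T[of 1 1] by (simp add: u_def inverse_eq_divide)
qed

text \<open>Adjoining an algebraic \<open>x\<close> outside \<open>R\<close> must produce
  \<open>1 / q\<close> by maximality; \<open>n\<close> bounds the degree of a polynomial expression
  for it.\<close>

definition rel_degree :: "complex \<Rightarrow> nat \<Rightarrow> bool" where
  "rel_degree x n \<longleftrightarrow> (\<exists>p. (\<forall>i. coeff p i \<in> R) \<and> degree p \<le> n \<and> 1 = Q * poly p x)"

lemma not_rel_degree_0: "\<not> rel_degree x 0"
proof
  assume "rel_degree x 0"
  then obtain p where p: "\<And>i. coeff p i \<in> R" "degree p = 0" "1 = Q * poly p x"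
    unfolding rel_degree_def by auto
  obtain a where "p = [:a:]" using p(2) by (rule degree_eq_zeroE)
  then show False using p(1)[of 0] p(3) not_q_multiple[of a] by simp
qed

text \<open>In the relation for \<open>inverse x\<close> the constant term can be moved to the left,
  where \<open>1 - q * coeff s 0\<close> is a unit. Dividing by it and multiplying by
  \<open>x ^ Suc n\<close> expresses this power by lower ones, which are substituted into the top
  term of \<open>p\<close>.\<close>

lemma rel_degree_reduce:
  assumes x: "x \<noteq> 0" and n: "rel_degree x (Suc n)" and m: "rel_degree (inverse x) m" "m \<le> Suc n"
  shows "rel_degree x n"
proof -
  obtain p where p: "\<And>i. coeff p i \<in> R" "degree p \<le> Suc n" "1 = Q * poly p x"
    using n unfolding rel_degree_def by auto
  obtain s where s: "\<And>i. coeff s i \<in> R" "degree s \<le> m" "1 = Q * poly s (inverse x)"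
    using m unfolding rel_degree_def by auto
  define u where "u = inverse (1 + Q * (- coeff s 0))"
  have u: "u \<in> R" unfolding u_def using s(1) by (intro one_plus_unit) simp
  have nz: "1 - Q * coeff s 0 \<noteq> 0" using not_q_multiple[OF s(1)[of 0]] by simp
  have poly_s: "poly s (inverse x) = (\<Sum>i\<le>Suc n. coeff s i * inverse x ^ i)"
    using s(2) m(2) by (intro poly_eq_sum_le) auto
  have "1 - Q * coeff s 0 = Q * (\<Sum>i=1..Suc n. coeff s i * inverse x ^ i)"
  proof -
    have "(\<Sum>i\<le>Suc n. coeff s i * inverse x ^ i) =
        coeff s 0 + (\<Sum>i=1..Suc n. coeff s i * inverse x ^ i)"
      by (simp only: atMost_atLeast0) (subst sum.atLeast_Suc_atMost, auto)
    then show ?thesis using s(3) unfolding poly_s by (simp add: algebra_simps)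
  qed
  then have "1 = Q * u * (\<Sum>i=1..Suc n. coeff s i * inverse x ^ i)"
    using nz by (simp add: u_def field_simps)
  then have "x ^ Suc n = x ^ Suc n * (Q * u * (\<Sum>i=1..Suc n. coeff s i * inverse x ^ i))"
    by (metis mult.right_neutral)
  also have "\<dots> = (\<Sum>i=1..Suc n. Q * u * coeff s i * x ^ (Suc n - i))"
    unfolding sum_distrib_left
  proof (rule sum.cong[OF refl])
    fix i assume "i \<in> {1..Suc n}"
    then have "x ^ Suc n = x ^ (Suc n - i) * x ^ i" by (simp flip: power_add)
    then show "x ^ Suc n * (Q * u * (coeff s i * inverse x ^ i)) = Q * u * coeff s i * x ^ (Suc n - i)"
      using x by (simp add: field_simps del: power_Suc)
  qed
  finally have xn: "x ^ Suc n = (\<Sum>i=1..Suc n. Q * u * coeff s i * x ^ (Suc n - i))" .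
  define a where "a = coeff p (Suc n)"
  define p' where "p' = (\<Sum>i\<le>n. monom (coeff p i) i) +
    (\<Sum>i=1..Suc n. monom (a * (Q * u * coeff s i)) (Suc n - i))"
  have "poly p x = (\<Sum>i\<le>Suc n. coeff p i * x ^ i)" using p(2) by (intro poly_eq_sum_le)
  also have "\<dots> = (\<Sum>i\<le>n. coeff p i * x ^ i) + a * x ^ Suc n" by (simp add: a_def)
  also have "\<dots> = poly p' x"
    unfolding xn p'_def by (simp add: poly_sum poly_monom sum_distrib_left mult.assoc del: sum.cl_ivl_Suc)
  finally have "1 = Q * poly p' x" using p(3) by simp
  moreover have "degree p' \<le> n"
    unfolding p'_def
    by (intro degree_add_le degree_sum_le) (auto intro: order.trans[OF degree_monom_le])
  moreover have "coeff p' i \<in> R" for i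
    unfolding p'_def coeff_add coeff_sum using p(1) s(1) u
    by (intro add_mem sum_mem) (auto simp: a_def)
  ultimately show ?thesis unfolding rel_degree_def by blast
qed

text \<open>Descent on \<open>n + m\<close>: the larger of the two degrees can always be lowered
  with the help of the other relation, but degree 0 is impossible.\<close>

lemma not_both_rel_degree:
  assumes "x \<noteq> 0"
  shows "\<not> (rel_degree x n \<and> rel_degree (inverse x) m)"
  using assms
proof (induction "n + m" arbitrary: n m x rule: less_induct)
  case less
  show ?case
  proof
    assume *: "rel_degree x n \<and> rel_degree (inverse x) m"
    then have "n \<noteq> 0" "m \<noteq> 0" using not_rel_degree_0 by metis+
    then obtain n' m' where nm: "n = Suc n'" "m = Suc m'" by (metis not0_implies_Suc)
    show False
    proof (cases "m \<le> n")
      case True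
      then have "rel_degree x n'" using rel_degree_reduce[of x n' m] * less.prems nm by simp
      then show False using less.hyps[of n' m x] * less.prems nm by simp
    next
      case False
      then have "rel_degree (inverse x) m'"
        using rel_degree_reduce[of "inverse x" m' n] * less.prems nm by simp
      then show False using less.hyps[of n m' x] * less.prems nm by simp
    qed
  qed
qed

text \<open>Without such a relation the ring generated by \<open>R\<close> and \<open>x\<close>
  would omit \<open>1 / q\<close>, so it would equal \<open>R\<close> by maximality and
  \<open>x\<close> would lie in \<open>R\<close>.\<close>

lemma rel_degree_exists:
  assumes x: "algebraic x" "x \<notin> R"
  shows "\<exists>n. rel_degree x n"
proof (rule ccontr)
  assume no: "\<nexists>n. rel_degree x n"
  define T where "T = {poly p x | p. \<forall>i. coeff p i \<in> R}"
  have T: "poly p x \<in> T" if "\<And>i. coeff p i \<in> R" for p using that unfolding T_def by blast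
  have "T = R"
  proof (rule R_max)
    show "R \<subseteq> T"
    proof
      fix r assume "r \<in> R"
      then show "r \<in> T" using T[of "[:r:]"] by (simp add: coeff_pCons split: nat.splits)
    qed
    show "T \<subseteq> Collect algebraic"
    proof
      fix y assume "y \<in> T"
      then obtain p where p: "y = poly p x" "\<And>i. coeff p i \<in> R" unfolding T_def by blast
      interpret A: complex_subfield "Collect algebraic" by (rule complex_subfield_algebraic)
      show "y \<in> Collect algebraic"
        unfolding p(1) poly_altdef using p(2) R_alg x by (intro A.sum_mem A.mult_mem A.power_mem) auto
    qed
    show "complex_subring T"
    proof
      show "1 \<in> T" using T[of 1] by (simp add: coeff_1)
      fix y z assume "y \<in> T" "z \<in> T"
      then obtain p p' where p: "y = poly p x" "\<And>i. coeff p i \<in> R" and p': "z = poly p' x" "\<And>i. coeff p' i \<in> R"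
        unfolding T_def by blast
      show "y - z \<in> T" using T[of "p - p'"] p p' by simp
      have "coeff (p * p') i \<in> R" for i using p p' by (auto simp: coeff_mult intro!: sum_mem)
      then show "y * z \<in> T" using T[of "p * p'"] p p' by simp
    qed
    show "inverse Q \<notin> T"
    proof
      assume "inverse Q \<in> T"
      then obtain p where p: "inverse Q = poly p x" "\<forall>i. coeff p i \<in> R" unfolding T_def by blast
      then have "1 = Q * poly p x" by (metis Q_nz right_inverse)
      then show False using no p unfolding rel_degree_def by blast
    qed
  qed
  moreover have "coeff (monom 1 1) i \<in> R" for i by (simp add: coeff_monom)
  ultimately show False using T[of "monom 1 1"] x by (simp add: poly_monom)
qed

lemma valuation_ring:
  assumes "algebraic x" "x \<notin> R" shows "inverse x \<in> R"
proof (rule ccontr)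
  assume "inverse x \<notin> R"
  moreover have "algebraic (inverse x)" using assms(1) by (rule algebraic_inverse)
  moreover have "x \<noteq> 0" using assms by auto
  ultimately show False using rel_degree_exists assms not_both_rel_degree by metis
qed

section \<open>Units of the valuation ring\<close>

definition unit_rel :: "complex \<Rightarrow> bool" where
  "unit_rel x \<longleftrightarrow> x \<noteq> 0 \<and> x \<in> R \<and> inverse x \<in> R"

lemma unit_rel_mult [simp]: "unit_rel x \<Longrightarrow> unit_rel y \<Longrightarrow> unit_rel (x * y)"
  by (simp add: unit_rel_def)

lemma unit_rel_inverse [simp]: "unit_rel x \<Longrightarrow> unit_rel (inverse x)"
  by (simp add: unit_rel_def)

lemma unit_rel_power [simp]: "unit_rel x \<Longrightarrow> unit_rel (x ^ k)"
  by (simp add: unit_rel_def flip: power_inverse)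

text \<open>If \<open>x\<close> is outside \<open>R\<close>, then \<open>inverse x\<close> is in
  \<open>R\<close>, and \<open>x = x ^ k * inverse x ^ (k - 1)\<close> gives a
  contradiction.\<close>

lemma R_power_mem_imp:
  assumes "algebraic x" "x ^ k \<in> R" "k > 0" shows "x \<in> R"
proof (rule ccontr)
  assume x: "x \<notin> R"
  then have "inverse x \<in> R" using valuation_ring assms by blast
  moreover have "x \<noteq> 0" using x zero_mem by metis
  then have "x = x ^ k * inverse x ^ (k - 1)"
    using assms(3) by (cases k) (auto simp: power_inverse)
  ultimately show False using x assms by (metis mult_mem power_mem)
qed

text \<open>Distinct powers of \<open>q\<close> differ by non-units, which will make the exponent in
  \<open>ext_abs\<close> unique. Otherwise a positive power of \<open>1 / q\<close> would lie in
  \<open>R\<close>, and with it \<open>1 / q\<close>.\<close>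

lemma Q_power_int_unit: "unit_rel (Q powi e) \<Longrightarrow> e = 0"
proof (rule ccontr)
  have *: False if "unit_rel (Q ^ k)" "k > 0" for k
  proof -
    have "inverse (Q ^ k) \<in> R" using that unfolding unit_rel_def by simp
    then have "inverse Q ^ k \<in> R" by (simp add: power_inverse)
    moreover have "algebraic (inverse Q)" by (intro algebraic_inverse) simp
    ultimately have "inverse Q \<in> R" using R_power_mem_imp that by blast
    then show False using R_q by simp
  qed
  assume u: "unit_rel (Q powi e)" and "e \<noteq> 0"
  then consider "e > 0" | "e < 0" by linarith
  then show False
  proof cases
    case 1
    then show False using *[of "nat e"] u by (simp add: power_int_def)
  next
    case 2
    then have "unit_rel (inverse (Q powi e))" using u by simp
    then have "unit_rel (Q ^ nat (- e))" using 2 by (simp add: power_int_def power_inverse)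
    then show False using *[of "nat (- e)"] 2 by simp
  qed
qed

text \<open>Bezout's identity writes a multiple of \<open>s\<close> as \<open>1 - b * q\<close>,
  which is invertible by \<open>one_plus_unit\<close>.\<close>

lemma coprime_unit:
  assumes "coprime s (int q)" shows "unit_rel (of_int s)"
proof -
  obtain a b where ab: "a * s + b * int q = 1" using bezout_int[of s "int q"] assms by auto
  then have "of_int (a * s + b * int q) = (1 :: complex)" by (simp only: of_int_1)
  then have eq: "of_int a * of_int s = 1 + Q * of_int (- b)"
    by (simp add: algebra_simps eq_diff_eq)
  have snz: "s \<noteq> 0" using assms prime_gt_1_nat[OF prime_q] by auto
  have nz: "1 + Q * of_int (- b) \<noteq> 0" using not_q_multiple[of "of_int b"] by simp
  have "inverse (1 + Q * of_int (- b)) \<in> R" by (rule one_plus_unit) simp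
  then have "of_int a * inverse (1 + Q * of_int (- b)) \<in> R" by simp
  also have "of_int a * inverse (1 + Q * of_int (- b)) = inverse (of_int s)"
    using nz snz unfolding eq[symmetric] by simp
  finally show ?thesis using snz by (simp add: unit_rel_def)
qed

lemma int_unit_part:
  assumes "k \<noteq> 0" shows "unit_rel (of_int k * Q powi (- int (multiplicity (int q) k)))"
proof -
  have "int q \<noteq> 0" "\<not> is_unit (int q)" using prime_gt_1_nat[OF prime_q] by auto
  then obtain s where s: "k = int q ^ multiplicity (int q) k * s" "\<not> int q dvd s"
    using multiplicity_decompose'[of k "int q"] assms by auto
  then have "coprime s (int q)"
    using prime_imp_coprime_int[of "int q" s] prime_q by (simp add: coprime_commute)
  then have u: "unit_rel (of_int s)" by (rule coprime_unit)
  have "(of_int k :: complex) = Q ^ multiplicity (int q) k * of_int s"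
    by (subst s(1)) simp
  then have "of_int k * Q powi (- int (multiplicity (int q) k)) = of_int s"
    by (simp add: power_int_minus)
  then show ?thesis using u by simp
qed

text \<open>The exponent is the one in \<open>padic_abs\<close>; this is why \<open>ext_abs\<close>
  restricts to the \<open>q\<close>-adic absolute value.\<close>

lemma rat_unit_part:
  assumes "z \<noteq> 0"
  shows "unit_rel (of_rat z * Q powi (int (multiplicity (int q) (snd (quotient_of z))) -
           int (multiplicity (int q) (fst (quotient_of z)))))"
proof -
  obtain a b where ab: "quotient_of z = (a, b)" by (cases "quotient_of z")
  have b: "b > 0" using quotient_of_denom_pos[OF ab] .
  have z: "z = of_int a / of_int b" using quotient_of_div[OF ab] .
  then have a: "a \<noteq> 0" using assms by auto
  have "of_rat z = (of_int a / of_int b :: complex)" by (simp add: z of_rat_divide)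
  then have "of_rat z * Q powi (int (multiplicity (int q) b) - int (multiplicity (int q) a)) =
      (of_int a * Q powi (- int (multiplicity (int q) a))) *
      inverse (of_int b * Q powi (- int (multiplicity (int q) b)))"
    by (simp add: power_int_diff power_int_minus field_simps)
  also have "unit_rel \<dots>" using a b by (intro unit_rel_mult unit_rel_inverse int_unit_part) auto
  finally show ?thesis using ab by simp
qed

text \<open>A valuation ring is local. Of two nonzero elements one divides the other, say
  \<open>y / x \<in> R\<close>; if \<open>x + y\<close> were a unit, then
  \<open>inverse x = inverse (x + y) * (1 + y / x)\<close> would lie in \<open>R\<close>, making
  \<open>x\<close> a unit.\<close>

lemma sum_nonunits:
  assumes "\<And>i. i \<in> I \<Longrightarrow> f i \<in> R \<and> \<not> unit_rel (f i)"
  shows "sum f I \<in> R \<and> \<not> unit_rel (sum f I)"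
proof -
  have add: "x + y \<in> R \<and> \<not> unit_rel (x + y)"
    if xy: "x \<in> R" "\<not> unit_rel x" "y \<in> R" "\<not> unit_rel y" for x y
  proof (cases "x = 0 \<or> y = 0")
    case False
    have *: "\<not> unit_rel (x + y)"
      if "x \<in> R" "\<not> unit_rel x" "x \<noteq> 0" "y / x \<in> R" for x y
    proof
      assume "unit_rel (x + y)"
      then have "inverse (x + y) * (1 + y / x) \<in> R" "x + y \<noteq> 0"
        using that by (auto simp: unit_rel_def)
      moreover from this have "inverse (x + y) * (1 + y / x) = inverse x"
        using that by (simp add: field_simps)
      ultimately show False using that by (auto simp: unit_rel_def)
    qed
    have "algebraic (y / x)"
      using complex_subfield.divide_mem[OF complex_subfield_algebraic, of y x] R_alg xy by simp
    then have "y / x \<in> R \<or> inverse (y / x) \<in> R" using valuation_ring by blast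
    then have "y / x \<in> R \<or> x / y \<in> R" by (simp add: inverse_eq_divide)
    then show ?thesis using *[of x y] *[of y x] xy False by (auto simp: add.commute)
  qed (use xy in auto)
  show ?thesis using assms
  proof (induction I rule: infinite_finite_induct)
    case (insert i I)
    then show ?case using add[of "f i" "sum f I"] by simp
  qed (auto simp: unit_rel_def)
qed

text \<open>Two terms of a polynomial relation for \<open>x\<close> have the same valuation.\<close>

lemma power_unit_exists:
  assumes x: "algebraic x" "x \<noteq> 0"
  shows "\<exists>k m. k > 0 \<and> unit_rel (x ^ k * Q powi m)"
proof -
  interpret A: complex_subfield "Collect algebraic" by (rule complex_subfield_algebraic)
  obtain p where p: "\<And>i. coeff p i \<in> \<rat>" "p \<noteq> 0" "poly p x = 0"
    using x(1) unfolding algebraic_altdef by blast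
  define I where "I = {i. coeff p i \<noteq> 0}"
  define t where "t i = coeff p i * x ^ i" for i
  have "I \<subseteq> {..degree p}" by (auto simp: I_def le_degree)
  then have fin: "finite I" by (rule finite_subset) simp
  have t_alg: "algebraic (t i)" for i
    using A.mult_mem[of "coeff p i" "x ^ i"] A.power_mem[of x i] A.Rats_mem[OF p(1)] x(1)
    by (simp add: t_def)
  have t_nz: "t i \<noteq> 0" if "i \<in> I" for i using that x by (simp add: t_def I_def)
  have sum0: "(\<Sum>i\<in>I. t i) = 0"
  proof -
    have "(\<Sum>i\<in>I. t i) = (\<Sum>i\<le>degree p. t i)"
      using \<open>I \<subseteq> {..degree p}\<close> by (intro sum.mono_neutral_left) (auto simp: I_def t_def)
    then show ?thesis using p(3) by (simp add: poly_altdef t_def)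
  qed
  have "I \<noteq> {}" using p(2) by (auto simp: I_def poly_eq_iff)
  \<comment> \<open>Divisibility in a valuation ring is total, so some term divides all others; it
    is a term of largest value.\<close>
  have max: "\<exists>i\<in>J. \<forall>j\<in>J. t j / t i \<in> R" if "finite J" "J \<noteq> {}" "J \<subseteq> I" for J
    using that
  proof (induction J rule: finite_ne_induct)
    case (singleton i)
    then show ?case using t_nz by simp
  next
    case (insert i J)
    then obtain k where k: "k \<in> J" "\<And>j. j \<in> J \<Longrightarrow> t j / t k \<in> R" by blast
    have nz: "t i \<noteq> 0" "t k \<noteq> 0" using t_nz insert.prems k by auto
    have "algebraic (t i / t k)" using A.divide_mem[of "t i" "t k"] t_alg by simp
    then consider "t i / t k \<in> R" | "t k / t i \<in> R"
      using valuation_ring[of "t i / t k"] by (auto simp: inverse_eq_divide)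
    then show ?case
    proof cases
      case 1
      then show ?thesis using k by (intro bexI[of _ k]) auto
    next
      case 2
      have "t j / t i \<in> R" if "j \<in> J" for j
      proof -
        have "t j / t i = (t j / t k) * (t k / t i)" using nz by simp
        then show ?thesis using k(2)[OF that] 2 by (metis mult_mem)
      qed
      then show ?thesis using nz by (intro bexI[of _ i]) auto
    qed
  qed
  obtain i where i: "i \<in> I" "\<And>j. j \<in> I \<Longrightarrow> t j / t i \<in> R"
    using max[OF fin \<open>I \<noteq> {}\<close>] by auto
  \<comment> \<open>If all other quotients were non-units, their sum would be a non-unit as well,
    but it equals -1.\<close>
  have "\<exists>j\<in>I - {i}. unit_rel (t j / t i)"
  proof (rule ccontr)
    assume "\<not> ?thesis"
    then have "(\<Sum>j\<in>I - {i}. t j / t i) \<in> R \<and> \<not> unit_rel (\<Sum>j\<in>I - {i}. t j / t i)"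
      using i by (intro sum_nonunits) auto
    moreover have "(\<Sum>j\<in>I - {i}. t j / t i) = - 1"
    proof -
      have "0 = t i + (\<Sum>j\<in>I - {i}. t j)" using sum0 fin i by (simp add: sum.remove)
      then have "(\<Sum>j\<in>I - {i}. t j) = - t i" by (simp add: eq_neg_iff_add_eq_0 add.commute)
      then show ?thesis using t_nz[OF i(1)] by (simp flip: sum_divide_distrib)
    qed
    ultimately show False by (simp add: unit_rel_def)
  qed
  then obtain j where j: "j \<in> I" "j \<noteq> i" "unit_rel (t j / t i)" by auto
  obtain a b where ab: "coeff p i = of_rat a" "coeff p j = of_rat b"
    using p(1) by (metis Rats_cases)
  define m where "m z = int (multiplicity (int q) (snd (quotient_of z))) -
           int (multiplicity (int q) (fst (quotient_of z)))" for z
  have u: "unit_rel (of_rat a * Q powi m a)" "unit_rel (of_rat b * Q powi m b)"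
    unfolding m_def using i j ab by (auto intro!: rat_unit_part simp: I_def)
  \<comment> \<open>The quotient of the two terms is a unit, and so is each coefficient after
    scaling by its power of \<open>q\<close>. What remains of the quotient is a positive power of
    \<open>x\<close> times a power of \<open>q\<close>.\<close>
  have *: "\<exists>k m. k > 0 \<and> unit_rel (x ^ k * Q powi m)"
    if "unit_rel (of_rat a * x ^ i / (of_rat b * x ^ j))" "i > j"
      "unit_rel (of_rat a * Q powi m a)" "unit_rel (of_rat b * Q powi m b)" "a \<noteq> 0" "b \<noteq> 0" for a b i j
  proof (intro exI conjI)
    have "unit_rel ((of_rat a * x ^ i / (of_rat b * x ^ j)) * (of_rat b * Q powi m b) *
        inverse (of_rat a * Q powi m a))"
      by (rule unit_rel_mult[OF unit_rel_mult[OF that(1,4)] unit_rel_inverse[OF that(3)]])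
    also have "x ^ i = x ^ (i - j) * x ^ j" using that by (simp flip: power_add)
    then have "(of_rat a * x ^ i / (of_rat b * x ^ j)) * (of_rat b * Q powi m b) *
        inverse (of_rat a * Q powi m a) = x ^ (i - j) * Q powi (m b - m a)"
      using that x by (simp add: power_int_diff divide_simps)
    finally show "unit_rel (x ^ (i - j) * Q powi (m b - m a))" .
    show "i - j > 0" using that by simp
  qed
  have nz: "a \<noteq> 0" "b \<noteq> 0" using i j ab by (auto simp: I_def)
  show ?thesis
  proof (cases "i > j")
    case True
    have "unit_rel (inverse (t j / t i))" using j by (intro unit_rel_inverse)
    then show ?thesis using *[of a i b j] True u nz ab by (simp add: t_def)
  next
    case False
    then show ?thesis using *[of b j a i] j u nz ab by (simp add: t_def)
  qed
qed

section \<open>The absolute value attached to the valuation ring\<close>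

text \<open>If \<open>x\<^sup>k q\<^sup>m\<close> is a unit, then \<open>\<bar>x\<bar>\<^sup>k = \<bar>q\<bar>\<^sup>-\<^sup>m = q\<^sup>m\<close>.\<close>

definition ext_abs :: "complex \<Rightarrow> real" where
  "ext_abs x = (if x = 0 then 0 else
     (THE r. \<exists>k m. k > 0 \<and> unit_rel (x ^ k * Q powi m) \<and> r = real q powr (of_int m / real k)))"

lemma ext_abs_0 [simp]: "ext_abs 0 = 0"
  by (simp add: ext_abs_def)

lemma monomial_power: "(x ^ k * Q powi m) ^ l = x ^ (k * l) * Q powi (m * int l)"
  by (simp only: power_mult_distrib power_mult power_int_mult power_int_of_nat)

text \<open>The value does not depend on the exponents: raising two such units to crosswise powers
  makes \<open>x\<close> cancel in their quotient, which is then a power of \<open>q\<close> and a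
  unit, so its exponent is 0.\<close>

lemma ext_abs_eq:
  assumes x: "x \<noteq> 0" and k: "k > 0" "unit_rel (x ^ k * Q powi m)"
  shows "ext_abs x = real q powr (of_int m / real k)"
proof -
  have uniq: "r = real q powr (of_int m / real k)"
    if "k' > 0" "unit_rel (x ^ k' * Q powi m')" "r = real q powr (of_int m' / real k')" for r k' m'
  proof -
    have "unit_rel ((x ^ k * Q powi m) ^ k' * inverse ((x ^ k' * Q powi m') ^ k))"
      by (rule unit_rel_mult[OF unit_rel_power[OF k(2)] unit_rel_inverse[OF unit_rel_power[OF that(2)]]])
    also have "(x ^ k * Q powi m) ^ k' * inverse ((x ^ k' * Q powi m') ^ k) =
        Q powi (m * int k' - m' * int k)"
      unfolding monomial_power using x by (simp add: power_int_diff divide_inverse mult.commute[of k k'])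
    finally have "m * int k' - m' * int k = 0" by (rule Q_power_int_unit)
    then have "m * int k' = m' * int k" by simp
    then have "of_int m * real k' = of_int m' * real k"
      by (metis of_int_mult of_int_of_nat_eq)
    then have "of_int m / real k = of_int m' / real k'" using k(1) that(1) by (simp add: field_simps)
    then show ?thesis using that(3) by simp
  qed
  have "(THE r. \<exists>k m. k > 0 \<and> unit_rel (x ^ k * Q powi m) \<and> r = real q powr (of_int m / real k)) =
      real q powr (of_int m / real k)"
    using k uniq by (intro the_equality) metis+
  then show ?thesis unfolding ext_abs_def using x by simp
qed

lemma ext_abs_obtain:
  assumes "algebraic x" "x \<noteq> 0"
  obtains k m where "k > 0" "unit_rel (x ^ k * Q powi m)" "ext_abs x = real q powr (of_int m / real k)"
  using power_unit_exists[OF assms] ext_abs_eq[OF assms(2)] by blast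

lemma q_gt_1: "real q > 1"
  using prime_gt_1_nat[OF prime_q] by simp

lemma ext_abs_mult:
  assumes "algebraic x" "algebraic y"
  shows "ext_abs (x * y) = ext_abs x * ext_abs y"
proof (cases "x = 0 \<or> y = 0")
  case False
  obtain k m where k: "k > 0" "unit_rel (x ^ k * Q powi m)" "ext_abs x = real q powr (of_int m / real k)"
    using ext_abs_obtain assms False by metis
  obtain l s where l: "l > 0" "unit_rel (y ^ l * Q powi s)" "ext_abs y = real q powr (of_int s / real l)"
    using ext_abs_obtain assms False by metis
  have "unit_rel ((x ^ k * Q powi m) ^ l * (y ^ l * Q powi s) ^ k)"
    by (rule unit_rel_mult[OF unit_rel_power[OF k(2)] unit_rel_power[OF l(2)]])
  also have "(x ^ k * Q powi m) ^ l * (y ^ l * Q powi s) ^ k =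
      (x * y) ^ (k * l) * Q powi (m * int l + s * int k)"
    unfolding monomial_power by (simp add: power_int_add power_mult_distrib mult.commute[of l k])
  finally have u: "unit_rel ((x * y) ^ (k * l) * Q powi (m * int l + s * int k))" .
  have "x * y \<noteq> 0" "k * l > 0" using k(1) l(1) False by simp_all
  then have "ext_abs (x * y) = real q powr (of_int (m * int l + s * int k) / real (k * l))"
    by (rule ext_abs_eq[OF _ _ u])
  also have "of_int (m * int l + s * int k) / real (k * l) = of_int m / real k + of_int s / real l"
    using k(1) l(1) add_frac_eq[of "real k" "real l" "of_int m" "of_int s"] by simp
  finally show ?thesis using k(3) l(3) by (simp add: powr_add)
qed (auto simp: ext_abs_def)

text \<open>Since \<open>x ^ k\<close> is a unit times \<open>Q powi (- m)\<close>, it lies in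
  \<open>R\<close> for \<open>m \<le> 0\<close>, whereas for \<open>m > 0\<close> it would bring a
  power of \<open>1 / q\<close> into \<open>R\<close>. Passing between \<open>x\<close> and
  \<open>x ^ k\<close> is \<open>R_power_mem_imp\<close>.\<close>

lemma ext_abs_le_1_iff:
  assumes "algebraic x" shows "ext_abs x \<le> 1 \<longleftrightarrow> x \<in> R"
proof (cases "x = 0")
  case False
  obtain k m where k: "k > 0" "unit_rel (x ^ k * Q powi m)" "ext_abs x = real q powr (of_int m / real k)"
    using ext_abs_obtain assms False by metis
  have "ext_abs x \<le> 1 \<longleftrightarrow> of_int m / real k \<le> 0"
    using k(3) q_gt_1 powr_le_cancel_iff[of "real q" "of_int m / real k" 0] by simp
  also have "\<dots> \<longleftrightarrow> m \<le> 0" using k(1) by (simp add: divide_le_0_iff)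
  also have "\<dots> \<longleftrightarrow> x \<in> R"
  proof
    assume "m \<le> 0"
    have "x ^ k = (x ^ k * Q powi m) * Q ^ nat (- m)"
      using \<open>m \<le> 0\<close> by (simp add: power_int_def power_inverse)
    also have "\<dots> \<in> R"
    proof (rule mult_mem)
      show "x ^ k * Q powi m \<in> R" using k(2) unfolding unit_rel_def by blast
    qed simp
    finally show "x \<in> R" using R_power_mem_imp assms k(1) by blast
  next
    assume x: "x \<in> R"
    show "m \<le> 0"
    proof (rule ccontr)
      assume "\<not> m \<le> 0"
      then have "nat m > 0" "Q powi m = Q ^ nat m" by (auto simp: power_int_def)
      have "inverse (x ^ k * Q powi m) * x ^ k \<in> R" using k(2) x by (simp add: unit_rel_def)
      also have "inverse (x ^ k * Q powi m) * x ^ k = inverse Q ^ nat m"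
        using False \<open>Q powi m = Q ^ nat m\<close> by (simp add: power_inverse)
      finally have "inverse Q \<in> R"
        using \<open>nat m > 0\<close> by (intro R_power_mem_imp[of "inverse Q" "nat m"] algebraic_inverse) auto
      then show False using R_q by simp
    qed
  qed
  finally show ?thesis .
qed (auto simp: ext_abs_def)

lemma ext_abs_pos: "algebraic x \<Longrightarrow> x \<noteq> 0 \<Longrightarrow> ext_abs x > 0"
  using ext_abs_obtain[of x] q_gt_1 by (metis powr_gt_zero less_numeral_extra(3) not_one_less_zero)

lemma ext_abs_nonneg: "algebraic x \<Longrightarrow> ext_abs x \<ge> 0"
  using ext_abs_pos[of x] by (cases "x = 0") (auto simp: ext_abs_def)

text \<open>After division by the larger element \<open>y\<close>, the claim becomes that
  \<open>1 + x / y\<close> lies in the unit ball, and the unit ball is the ring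
  \<open>R\<close>.\<close>

lemma ext_abs_ultrametric:
  assumes xy: "algebraic x" "algebraic y"
  shows "ext_abs (x + y) \<le> max (ext_abs x) (ext_abs y)"
proof -
  interpret A: complex_subfield "Collect algebraic" by (rule complex_subfield_algebraic)
  have *: "ext_abs (x + y) \<le> ext_abs y" if "algebraic x" "algebraic y" "ext_abs x \<le> ext_abs y" for x y
  proof (cases "y = 0")
    case True
    then have "x = 0" using that ext_abs_pos[of x] ext_abs_0 by force
    then show ?thesis using True by simp
  next
    case False
    have alg: "algebraic (x / y)" "algebraic (1 + x / y)"
      using A.divide_mem[of x y] A.add_mem[of 1 "x / y"] that by auto
    have "ext_abs (x / y) = ext_abs x / ext_abs y"
      using ext_abs_mult[OF alg(1) that(2)] False ext_abs_pos[OF that(2) False] by simp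
    then have "ext_abs (x / y) \<le> 1"
      using that(3) ext_abs_pos[OF that(2) False] by simp
    then have "1 + x / y \<in> R" using ext_abs_le_1_iff[OF alg(1)] by simp
    then have le: "ext_abs (1 + x / y) \<le> 1" using ext_abs_le_1_iff[OF alg(2)] by simp
    have "ext_abs (x + y) = ext_abs ((1 + x / y) * y)" using False by (simp add: field_simps)
    also have "\<dots> = ext_abs (1 + x / y) * ext_abs y" by (rule ext_abs_mult) (use alg that in auto)
    also have "\<dots> \<le> 1 * ext_abs y" using le ext_abs_nonneg[OF that(2)] by (rule mult_right_mono)
    finally show ?thesis by simp
  qed
  show ?thesis using *[of x y] *[of y x] xy by (cases "ext_abs x \<le> ext_abs y") (auto simp: add.commute)
qed

lemma ext_abs_abs_val_field: "abs_val_field (Collect algebraic) ext_abs"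
proof (intro abs_val_field.intro complex_subfield_algebraic abs_val_field_axioms.intro)
  show "absolute_value_on (Collect algebraic) ext_abs"
    unfolding absolute_value_on_def
  proof (intro conjI ballI)
    fix x y :: complex assume xy: "x \<in> Collect algebraic" "y \<in> Collect algebraic"
    show "ext_abs x \<ge> 0" using ext_abs_nonneg xy by simp
    show "ext_abs x = 0 \<longleftrightarrow> x = 0" using ext_abs_pos[of x] xy by (auto simp: ext_abs_def)
    show "ext_abs (x * y) = ext_abs x * ext_abs y" using ext_abs_mult xy by simp
    show "ext_abs (x + y) \<le> ext_abs x + ext_abs y"
      using ext_abs_ultrametric[of x y] ext_abs_nonneg[of x] ext_abs_nonneg[of y] xy by simp
  qed
qed

lemma ext_abs_rat: "ext_abs (of_rat z) = padic_abs q z"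
proof (cases "z = 0")
  case False
  define m where "m = int (multiplicity (int q) (snd (quotient_of z))) -
           int (multiplicity (int q) (fst (quotient_of z)))"
  have "unit_rel (of_rat z ^ 1 * Q powi m)" using rat_unit_part[OF False] by (simp add: m_def)
  then have "ext_abs (of_rat z) = real q powr (of_int m / real 1)"
    using False by (intro ext_abs_eq) auto
  also have "\<dots> = real q powi m" using q_gt_1 by (simp add: powr_real_of_int')
  finally show ?thesis using False by (simp add: padic_abs_def m_def)
qed (simp add: ext_abs_def padic_abs_def)

end

lemma exists_padic_extension:
  assumes "Factorial_Ring.prime q"
  obtains u where "abs_val_field (Collect algebraic) u" "\<And>z. u (of_rat z) = padic_abs q z"
proof -
  obtain R where "maximal_subring R q" using exists_maximal_subring[OF assms] by blast
  then interpret maximal_subring R q .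
  show ?thesis
    using that[of ext_abs] ext_abs_abs_val_field ext_abs_rat by blast
qed

section \<open>Minimal polynomials and conjugates\<close>

text \<open>The polynomials stay over the rationals, so that minimality, divisibility and
  \<open>gcd\<close> refer to rational coefficients; only the values are complex.\<close>

definition ev :: "rat poly \<Rightarrow> complex \<Rightarrow> complex" where
  "ev g x = poly (map_poly of_rat g) x"

lemma coeff_of_rat_poly: "coeff (map_poly of_rat g :: complex poly) i = of_rat (coeff g i)"
  by (simp add: coeff_map_poly)

lemma ev_0 [simp]: "ev 0 x = 0"
  by (simp add: ev_def)

lemma ev_pCons [simp]: "ev (pCons c g) x = of_rat c + x * ev g x"
  by (simp add: ev_def map_poly_pCons)

lemma ev_1 [simp]: "ev 1 x = 1"
  by (simp add: ev_def)

lemma ev_monom [simp]: "ev (monom c k) x = of_rat c * x ^ k"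
  by (simp add: ev_def map_poly_monom poly_monom)

lemma ev_add [simp]: "ev (g + h) x = ev g x + ev h x"
proof -
  have "map_poly of_rat (g + h) = (map_poly of_rat g + map_poly of_rat h :: complex poly)"
    by (rule poly_eqI) (simp add: coeff_of_rat_poly of_rat_add)
  then show ?thesis by (simp add: ev_def)
qed

lemma ev_smult [simp]: "ev (smult c g) x = of_rat c * ev g x"
proof -
  have "map_poly of_rat (smult c g) = (smult (of_rat c) (map_poly of_rat g) :: complex poly)"
    by (rule poly_eqI) (simp add: coeff_of_rat_poly of_rat_mult)
  then show ?thesis by (simp add: ev_def)
qed

lemma ev_uminus [simp]: "ev (- g) x = - ev g x"
  using ev_smult[of "-1" g x] by (simp add: of_rat_minus)

lemma ev_diff [simp]: "ev (g - h) x = ev g x - ev h x"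
  using ev_add[of g "- h" x] by simp

lemma ev_mult [simp]: "ev (g * h) x = ev g x * ev h x"
  by (induction g) (simp_all add: algebra_simps)

lemma ev_sum: "ev (sum g I) x = (\<Sum>i\<in>I. ev (g i) x)"
  by (induction I rule: infinite_finite_induct) auto

lemma ev_eq_sum: "degree g < n \<Longrightarrow> ev g x = (\<Sum>i<n. of_rat (coeff g i) * x ^ i)"
proof -
  assume "degree g < n"
  then obtain m where m: "n = Suc m" "degree g \<le> m" by (cases n) auto
  then have "degree (map_poly of_rat g :: complex poly) \<le> m"
    by (subst degree_map_poly) simp_all
  then have "ev g x = (\<Sum>i\<le>m. of_rat (coeff g i) * x ^ i)"
    unfolding ev_def by (simp add: poly_eq_sum_le coeff_of_rat_poly)
  then show ?thesis by (simp add: m lessThan_Suc_atMost)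
qed

lemma ev_altdef: "ev g x = (\<Sum>i\<le>degree g. of_rat (coeff g i) * x ^ i)"
  using ev_eq_sum[of g "Suc (degree g)"] by (simp only: lessThan_Suc_atMost lessI)

lemma ev_degree_0: "degree g = 0 \<Longrightarrow> g \<noteq> 0 \<Longrightarrow> ev g x \<noteq> 0"
  by (metis degree_eq_zeroE ev_0 ev_pCons mult_zero_right add_0_right of_rat_eq_0_iff pCons_0_0)

lemma algebraic_ev_root:
  assumes "g \<noteq> 0" "ev g x = 0" shows "algebraic x"
proof (rule algebraicI')
  show "coeff (map_poly of_rat g :: complex poly) i \<in> \<rat>" for i by (simp add: coeff_of_rat_poly)
  show "map_poly of_rat g \<noteq> (0 :: complex poly)" using assms(1) by (simp add: map_poly_eq_0_iff)
  show "poly (map_poly of_rat g) x = 0" using assms(2) by (simp add: ev_def)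
qed

text \<open>The scaling of \<open>f\<close> is left open: the coefficients that matter later are
  those of a primitive integral multiple.\<close>

locale minimal_poly =
  fixes a :: complex and f :: "rat poly"
  assumes f_nz: "f \<noteq> 0" and f_root: "ev f a = 0"
    and f_min: "g \<noteq> 0 \<Longrightarrow> ev g a = 0 \<Longrightarrow> degree f \<le> degree g"

lemma minimal_poly_exists:
  assumes "algebraic a" obtains f where "minimal_poly a f"
proof -
  obtain p where p: "\<And>i. coeff p i \<in> \<rat>" "p \<noteq> 0" "poly p a = 0"
    using assms unfolding algebraic_altdef by blast
  have "\<forall>i. \<exists>q. coeff p i = of_rat q" using p(1) by (metis Rats_cases)
  then obtain r where r: "\<And>i. coeff p i = of_rat (r i)" by metis
  define g where "g = (\<Sum>i\<le>degree p. monom (r i) i)"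
  have "ev g a = 0"
    using p(3) by (simp add: g_def ev_sum poly_altdef r)
  moreover have "coeff g (degree p) = r (degree p)" by (simp add: g_def coeff_sum)
  then have "g \<noteq> 0" using p(2) r[of "degree p"] by force
  ultimately have ex: "\<exists>g. g \<noteq> 0 \<and> ev g a = 0" by blast
  define f where "f = arg_min degree (\<lambda>g. g \<noteq> 0 \<and> ev g a = 0)"
  obtain g0 where "g0 \<noteq> 0 \<and> ev g0 a = 0" using ex by blast
  then have 1: "f \<noteq> 0 \<and> ev f a = 0" unfolding f_def by (rule arg_min_natI)
  have 2: "degree f \<le> degree g" if "g \<noteq> 0 \<and> ev g a = 0" for g
    unfolding f_def using that by (rule arg_min_nat_le)
  have "minimal_poly a f" by unfold_locales (use 1 2 in simp_all)
  then show ?thesis by (rule that)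
qed

context minimal_poly
begin

abbreviation n :: nat where "n \<equiv> degree f"

abbreviation K :: "complex set" where "K \<equiv> Q_adjoin a"

lemma n_pos: "n > 0"
  using ev_degree_0 f_nz f_root by blast

lemma algebraic_a: "algebraic a"
  using algebraic_ev_root f_nz f_root by blast

lemma dvd_iff: "f dvd g \<longleftrightarrow> ev g a = 0"
proof
  assume "ev g a = 0"
  have "g mod f = g - f * (g div f)" by (simp add: minus_mult_div_eq_mod)
  then have "ev (g mod f) a = 0" using \<open>ev g a = 0\<close> f_root by simp
  moreover have "g mod f = 0 \<or> degree (g mod f) < n" using f_nz by (rule degree_mod_less)
  ultimately have "g mod f = 0" using f_min by (metis not_le)
  then show "f dvd g" by (simp add: mod_eq_0_iff_dvd)
qed (auto simp: f_root)

text \<open>This is irreducibility: one of the factors vanishes at \<open>a\<close>, so by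
  minimality it already has the full degree.\<close>

lemma coprime_or_dvd:
  assumes "f = g * h" shows "degree g = 0 \<or> degree h = 0"
proof -
  have nz: "g \<noteq> 0" "h \<noteq> 0" using assms f_nz by auto
  have "ev g a = 0 \<or> ev h a = 0" using f_root assms by simp
  then have "n \<le> degree g \<or> n \<le> degree h" using f_min nz by blast
  moreover have "n = degree g + degree h" using assms nz by (simp add: degree_mult_eq)
  ultimately show ?thesis by linarith
qed

text \<open>The minimal polynomial of \<open>b\<close> divides the irreducible \<open>f\<close> and
  is not constant, so it has the degree of \<open>f\<close>. Facts about \<open>a\<close> thereby
  transfer to all its conjugates.\<close>

lemma root_minimal_poly:
  assumes b: "ev f b = 0" shows "minimal_poly b f"
proof
  fix g assume g: "g \<noteq> 0" "ev g b = 0"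
  have "algebraic b" using algebraic_ev_root[OF f_nz b] .
  then obtain h where "minimal_poly b h" by (rule minimal_poly_exists)
  then interpret h: minimal_poly b h .
  obtain k where k: "f = h * k" using h.dvd_iff b by (auto elim: dvdE)
  have "degree k = 0" using coprime_or_dvd[OF k] h.n_pos by simp
  then have "n = degree h" using k f_nz by (auto simp: degree_mult_eq)
  then show "n \<le> degree g" using h.f_min g by simp
qed (use f_nz b in auto)

text \<open>The derivative is nonzero in characteristic 0 and has smaller degree, so it cannot
  vanish at \<open>b\<close>, for which \<open>f\<close> is minimal too.\<close>

lemma pderiv_root_neq_0:
  assumes "ev f b = 0" shows "ev (pderiv f) b \<noteq> 0"
proof
  assume "ev (pderiv f) b = 0"
  moreover have "pderiv f \<noteq> 0" using n_pos by (simp add: pderiv_eq_0_iff)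
  ultimately have "n \<le> degree (pderiv f)"
    using minimal_poly.f_min[OF root_minimal_poly[OF assms]] by blast
  then show False using n_pos by (simp add: degree_pderiv)
qed

abbreviation fC :: "complex poly" where "fC \<equiv> map_poly of_rat f"

lemma degree_fC: "degree fC = n"
  by (rule degree_map_poly) simp

lemma lead_coeff_fC: "lead_coeff fC = of_rat (lead_coeff f)"
  by (simp add: degree_fC coeff_of_rat_poly)

lemma fC_nz: "fC \<noteq> 0"
  using f_nz by (simp add: map_poly_eq_0_iff)

definition roots :: "complex set" where "roots = {b. ev f b = 0}"

lemma finite_roots: "finite roots"
  using poly_roots_finite[OF fC_nz] by (simp add: roots_def ev_def)

text \<open>A product over the set \<open>roots\<close> counts every root once, which is right
  because the roots are simple.\<close>

lemma fC_split: "fC = smult (lead_coeff fC) (\<Prod>b\<in>roots. [:- b, 1:])"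
proof -
  have "pderiv fC = map_poly of_rat (pderiv f)"
    by (rule poly_eqI) (simp add: coeff_pderiv coeff_of_rat_poly of_rat_mult of_rat_add)
  then have "rsquarefree fC"
    using pderiv_root_neq_0 by (auto simp: rsquarefree_roots ev_def)
  then show ?thesis
    using complex_poly_decompose_rsquarefree[of fC] by (simp add: roots_def ev_def)
qed

text \<open>The polynomial \<open>d = gcd f g\<close> does not vanish at \<open>a\<close>, so its
  cofactor in \<open>f\<close> does and has full degree. Hence \<open>d\<close> is constant, and
  Bezout's identity yields the inverse.\<close>

lemma inverse_ev:
  assumes "ev g a \<noteq> 0" obtains h where "inverse (ev g a) = ev h a"
proof -
  define d where "d = gcd f g"
  obtain k where k: "f = d * k" unfolding d_def by (metis dvdE gcd_dvd1)
  obtain l where l: "g = d * l" unfolding d_def by (metis dvdE gcd_dvd2)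
  have d: "ev d a \<noteq> 0" using assms l by auto
  have "ev k a = 0" using f_root k d by simp
  moreover have "k \<noteq> 0" using k f_nz by auto
  ultimately have "n \<le> degree k" by (rule f_min[rotated])
  moreover have "n = degree d + degree k" using k f_nz by (auto simp: degree_mult_eq)
  ultimately have "degree d = 0" by simp
  then obtain c where c: "d = [:c:]" by (rule degree_eq_zeroE)
  obtain s t where st: "s * f + t * g = d"
    unfolding d_def by (metis bezout_coefficients_fst_snd)
  have "ev (s * f + t * g) a = of_rat c" unfolding st c by simp
  then have "ev t a * ev g a = of_rat c" by (simp add: f_root)
  moreover have "c \<noteq> 0" using d c by auto
  ultimately have "inverse (ev g a) = of_rat (inverse c) * ev t a"
    using assms by (simp add: field_simps of_rat_divide)
  then show ?thesis by (intro that[of "smult (inverse c) t"]) simp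
qed

end

section \<open>The field generated by an algebraic number\<close>

lemma complex_field_simps:
  "x \<otimes>\<^bsub>complex_field\<^esub> y = x * y" "x \<oplus>\<^bsub>complex_field\<^esub> y = x + y"
  "\<one>\<^bsub>complex_field\<^esub> = 1" "\<zero>\<^bsub>complex_field\<^esub> = 0" "carrier complex_field = UNIV"
  by (simp_all add: ring_of_type_algebra_def)

lemma complex_field_field: "field complex_field"
  by (rule field_from_type_algebra)

interpretation complex_field: cring complex_field
  by (rule cring_from_type_algebra)

lemma complex_field_a_inv: "\<ominus>\<^bsub>complex_field\<^esub> x = - x"
  by (rule complex_field.minus_equality) (simp_all add: complex_field_simps)

lemma complex_field_m_inv: "x \<noteq> 0 \<Longrightarrow> inv\<^bsub>complex_field\<^esub> x = inverse x"
  by (rule complex_field.comm_inv_char) (simp_all add: complex_field_simps)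

lemma complex_subfield_Q_adjoin: "complex_subfield (Q_adjoin a)"
proof
  fix x y assume xy: "x \<in> Q_adjoin a" "y \<in> Q_adjoin a"
  have "x \<oplus>\<^bsub>complex_field\<^esub> (\<ominus>\<^bsub>complex_field\<^esub> y) \<in> Q_adjoin a"
    using xy unfolding Q_adjoin_def by (intro generate_field.eng_add generate_field.a_inv)
  then show "x - y \<in> Q_adjoin a" by (simp add: complex_field_simps complex_field_a_inv)
  show "x * y \<in> Q_adjoin a"
    using xy generate_field.eng_mult[of x complex_field "{a}" y] by (simp add: Q_adjoin_def complex_field_simps)
next
  show one: "1 \<in> Q_adjoin a"
    using generate_field.one[of complex_field "{a}"] by (simp add: Q_adjoin_def complex_field_simps)
  fix x assume x: "x \<in> Q_adjoin a"
  show "inverse x \<in> Q_adjoin a"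
  proof (cases "x = 0")
    case False
    then show ?thesis
      using x generate_field.m_inv[of x complex_field "{a}"]
      by (simp add: Q_adjoin_def complex_field_simps complex_field_m_inv)
  next
    case True
    then show ?thesis using x by simp
  qed
qed

lemma mem_Q_adjoin: "a \<in> Q_adjoin a"
  using generate_field.incl[of a "{a}"] by (simp add: Q_adjoin_def)

lemma subfield_Rats: "subfield \<rat> complex_field"
proof (rule field.subfieldI'[OF complex_field_field])
  show "subring \<rat> complex_field"
    by (rule complex_field.subringI) (auto simp: complex_field_simps complex_field_a_inv)
  show "inv\<^bsub>complex_field\<^esub> k \<in> \<rat>" if "k \<in> \<rat> - {\<zero>\<^bsub>complex_field\<^esub>}" for k
    using that by (simp add: complex_field_simps complex_field_m_inv)
qed

lemma combine_complex_field:
  "complex_field.combine (map f xs) (map g xs) = (\<Sum>x\<leftarrow>xs. f x * g x)"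
  by (induction xs) (simp_all add: complex_field_simps)

lemma field_degree_eq:
  assumes K: "K = rat_span {..<m} w"
    and indep: "\<And>c. (\<And>i. c i \<in> \<rat>) \<Longrightarrow> (\<Sum>i<m. c i * w i) = 0 \<Longrightarrow> \<forall>i<m. c i = 0"
  shows "field_degree K = m"
  unfolding field_degree_def
proof (rule complex_field.dim_eqI[OF subfield_Rats])
  have combine: "complex_field.combine (map c [0..<m]) (map w [0..<m]) = (\<Sum>i<m. c i * w i)" for c
    by (simp add: combine_complex_field sum_list_distinct_conv_sum_set atLeast0LessThan)
  \<comment> \<open>\<open>rat_span\<close> and \<open>indep\<close> speak of rational coefficients
    at all indices, while \<open>c\<close> is controlled only below \<open>m\<close>.\<close>
  have trunc: "(\<Sum>i<m. c i * w i) = (\<Sum>i<m. (if i < m then c i else 0) * w i)" for c by simp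
  show "w i \<in> carrier complex_field" for i by (simp add: complex_field_simps)
  show "\<forall>i<m. c i = \<zero>\<^bsub>complex_field\<^esub>"
    if c: "\<And>i. i < m \<Longrightarrow> c i \<in> \<rat>"
      "complex_field.combine (map c [0..<m]) (map w [0..<m]) = \<zero>\<^bsub>complex_field\<^esub>" for c
  proof -
    have "\<forall>i<m. (if i < m then c i else 0) = 0"
    proof (rule indep)
      show "(if i < m then c i else 0) \<in> \<rat>" for i using c(1)[of i] by simp
      show "(\<Sum>i<m. (if i < m then c i else 0) * w i) = 0"
        using c(2) unfolding combine trunc[of c] complex_field_simps .
    qed
    then show ?thesis by (simp add: complex_field_simps)
  qed
  show "x \<in> K \<longleftrightarrow> (\<exists>c. (\<forall>i<m. c i \<in> \<rat>) \<and>
      x = complex_field.combine (map c [0..<m]) (map w [0..<m]))" for x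
  proof
    assume "x \<in> K"
    then obtain c where c: "\<forall>i. c i \<in> \<rat>" "x = (\<Sum>i<m. c i * w i)" unfolding K by (rule rat_spanE)
    show "\<exists>c. (\<forall>i<m. c i \<in> \<rat>) \<and> x = complex_field.combine (map c [0..<m]) (map w [0..<m])"
      unfolding combine by (rule exI[of _ c]) (simp add: c)
  next
    assume "\<exists>c. (\<forall>i<m. c i \<in> \<rat>) \<and> x = complex_field.combine (map c [0..<m]) (map w [0..<m])"
    then obtain c where c: "\<forall>i<m. c i \<in> \<rat>" "x = (\<Sum>i<m. c i * w i)" unfolding combine by blast
    show "x \<in> K"
      unfolding K c(2) trunc[of c] by (rule rat_spanI) (use c(1) in simp)
  qed
qed

context minimal_poly
begin

lemma Q_adjoin_ev: "K = {ev g a | g. True}"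
proof (intro equalityI subsetI)
  fix x assume "x \<in> {ev g a | g. True}"
  then obtain g where "x = ev g a" by blast
  interpret complex_subfield K by (rule complex_subfield_Q_adjoin)
  show "x \<in> K" unfolding \<open>x = ev g a\<close> ev_altdef by (simp add: mem_Q_adjoin)
next
  fix x assume "x \<in> K"
  then show "x \<in> {ev g a | g. True}"
    unfolding Q_adjoin_def
  proof (induction rule: generate_field.induct)
    case one
    then show ?case using ev_1[of a] by (metis (mono_tags, lifting) complex_field_simps(3) mem_Collect_eq)
  next
    case (incl h)
    have "h = ev [:0, 1:] a" using incl by simp
    then show ?case by blast
  next
    case (a_inv h)
    then obtain g where "h = ev g a" by blast
    then have "\<ominus>\<^bsub>complex_field\<^esub> h = ev (- g) a" by (simp add: complex_field_a_inv)
    then show ?case by blast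
  next
    case (m_inv h)
    then obtain g where g: "h = ev g a" by blast
    moreover have "h \<noteq> 0" using m_inv by (simp add: complex_field_simps)
    ultimately obtain k where "inverse h = ev k a" using inverse_ev by metis
    then have "inv\<^bsub>complex_field\<^esub> h = ev k a" using \<open>h \<noteq> 0\<close> by (simp add: complex_field_m_inv)
    then show ?case by blast
  next
    case (eng_add h1 h2)
    then obtain g1 g2 where "h1 = ev g1 a" "h2 = ev g2 a" by blast
    then have "h1 \<oplus>\<^bsub>complex_field\<^esub> h2 = ev (g1 + g2) a" by (simp add: complex_field_simps)
    then show ?case by blast
  next
    case (eng_mult h1 h2)
    then obtain g1 g2 where "h1 = ev g1 a" "h2 = ev g2 a" by blast
    then have "h1 \<otimes>\<^bsub>complex_field\<^esub> h2 = ev (g1 * g2) a" by (simp add: complex_field_simps)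
    then show ?case by blast
  qed
qed

lemma Q_adjoin_span: "K = rat_span {..<n} (\<lambda>i. a ^ i)"
proof (intro equalityI subsetI)
  fix x assume "x \<in> K"
  then obtain g where g: "x = ev g a" unfolding Q_adjoin_ev by blast
  have "ev g a = ev (g mod f) a"
  proof -
    have "ev g a = ev (g div f) a * ev f a + ev (g mod f) a"
      by (metis ev_add ev_mult div_mult_mod_eq)
    then show ?thesis by (simp add: f_root)
  qed
  also have "\<dots> = (\<Sum>i<n. of_rat (coeff (g mod f) i) * a ^ i)"
    using degree_mod_less[OF f_nz, of g] n_pos by (intro ev_eq_sum) auto
  also have "\<dots> \<in> rat_span {..<n} (\<lambda>i. a ^ i)" by (rule rat_spanI) simp
  finally show "x \<in> rat_span {..<n} (\<lambda>i. a ^ i)" unfolding g .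
next
  fix x assume "x \<in> rat_span {..<n} (\<lambda>i. a ^ i)"
  then obtain c where c: "\<forall>i. c i \<in> \<rat>" "x = (\<Sum>i<n. c i * a ^ i)" by (rule rat_spanE)
  interpret complex_subfield K by (rule complex_subfield_Q_adjoin)
  show "x \<in> K" unfolding c(2) using c(1) by (intro sum_mem mult_mem) (auto simp: mem_Q_adjoin)
qed

lemma power_basis_independent:
  assumes c: "\<And>i. c i \<in> \<rat>" "(\<Sum>i<n. c i * a ^ i) = 0"
  shows "\<forall>i<n. c i = 0"
proof -
  have "\<forall>i. \<exists>q. c i = of_rat q" using c(1) by (metis Rats_cases)
  then obtain r where r: "\<And>i. c i = of_rat (r i)" by metis
  define g where "g = (\<Sum>i<n. monom (r i) i)"
  have coeff: "coeff g i = (if i < n then r i else 0)" for i by (simp add: g_def coeff_sum)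
  have "ev g a = 0" using c(2) by (simp add: g_def ev_sum r)
  moreover have "degree g < n"
    using coeff n_pos by (intro degree_lessI) auto
  ultimately have "g = 0" using f_min[of g] by auto
  then show ?thesis using coeff r by (metis coeff_0 of_rat_0)
qed

lemma field_degree_Q_adjoin: "field_degree K = n"
  using Q_adjoin_span power_basis_independent by (intro field_degree_eq) blast+

lemma number_field_Q_adjoin: "number_field K n (\<lambda>i. a ^ i)"
proof -
  interpret complex_subfield K by (rule complex_subfield_Q_adjoin)
  show ?thesis
  proof
    show "a ^ i \<in> K" for i by (simp add: mem_Q_adjoin)
    show "\<exists>c. (\<forall>i. c i \<in> \<rat>) \<and> x = (\<Sum>i<n. c i * a ^ i)" if "x \<in> K" for x
      using that unfolding Q_adjoin_span by (auto elim: rat_spanE)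
  qed
qed

text \<open>For a root \<open>b\<close> of \<open>f\<close>, this is the embedding of
  \<open>K\<close> that sends \<open>a\<close> to \<open>b\<close>; independence of the chosen
  polynomial is \<open>conjugate_ev\<close>.\<close>

definition conjugate :: "complex \<Rightarrow> complex \<Rightarrow> complex" where
  "conjugate b x = ev (SOME g. x = ev g a) b"

text \<open>Two polynomials with the same value at \<open>a\<close> differ by a multiple of
  \<open>f\<close>, which vanishes at \<open>b\<close> as well.\<close>

lemma conjugate_ev: "b \<in> roots \<Longrightarrow> conjugate b (ev g a) = ev g b"
proof -
  assume b: "b \<in> roots"
  define h where "h = (SOME h. ev g a = ev h a)"
  have "ev g a = ev h a" unfolding h_def by (rule someI[of _ g]) simp
  then have "f dvd (g - h)" by (simp add: dvd_iff)
  then obtain k where "g - h = f * k" by (rule dvdE)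
  then have "ev (g - h) b = ev (f * k) b" by (rule arg_cong)
  then have "ev g b = ev h b" using b by (simp add: roots_def)
  then show ?thesis by (simp add: conjugate_def h_def)
qed

lemma conjugate_hom:
  assumes b: "b \<in> roots" and x: "x \<in> K" and y: "y \<in> K"
  shows "conjugate b (x + y) = conjugate b x + conjugate b y" "conjugate b (x * y) = conjugate b x * conjugate b y"
    "conjugate b (x - y) = conjugate b x - conjugate b y"
proof -
  obtain g h where "x = ev g a" "y = ev h a" using x y unfolding Q_adjoin_ev by blast
  then show "conjugate b (x + y) = conjugate b x + conjugate b y" "conjugate b (x * y) = conjugate b x * conjugate b y"
    "conjugate b (x - y) = conjugate b x - conjugate b y"
    using conjugate_ev[OF b, of "g + h"] conjugate_ev[OF b, of "g * h"] conjugate_ev[OF b, of "g - h"] conjugate_ev[OF b]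
    by simp_all
qed

lemma conjugate_rat: "b \<in> roots \<Longrightarrow> conjugate b (of_rat q) = of_rat q"
  using conjugate_ev[of b "[:q:]"] by simp

lemma conjugate_gen: "b \<in> roots \<Longrightarrow> conjugate b a = b"
  using conjugate_ev[of b "[:0, 1:]"] by simp

lemma conjugate_eq_0_iff:
  assumes "b \<in> roots" "x \<in> K" shows "conjugate b x = 0 \<longleftrightarrow> x = 0"
proof -
  interpret b: minimal_poly b f using assms by (intro root_minimal_poly) (simp add: roots_def)
  obtain g where g: "x = ev g a" using assms unfolding Q_adjoin_ev by blast
  show ?thesis unfolding g conjugate_ev[OF assms(1)] using b.dvd_iff dvd_iff by metis
qed

lemma algebraic_conjugate:
  assumes "b \<in> roots" "x \<in> K" shows "algebraic (conjugate b x)"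
proof -
  interpret b: minimal_poly b f using assms by (intro root_minimal_poly) (simp add: roots_def)
  interpret A: complex_subfield "Collect algebraic" by (rule complex_subfield_algebraic)
  obtain g where g: "x = ev g a" using assms unfolding Q_adjoin_ev by blast
  have "ev g b \<in> Collect algebraic"
    unfolding ev_altdef using b.algebraic_a by (intro A.sum_mem A.mult_mem A.power_mem A.of_rat_mem) simp
  then show ?thesis unfolding g conjugate_ev[OF assms(1)] by simp
qed

end

section \<open>Places over a place of the rationals\<close>

lemma absolute_value_on_restrict:
  assumes "\<And>x y. x \<in> K \<Longrightarrow> y \<in> K \<Longrightarrow> x + y \<in> K \<and> x * y \<in> K"
  shows "absolute_value_on K (restrict v K) \<longleftrightarrow> absolute_value_on K v"
  using assms unfolding absolute_value_on_def by auto

text \<open>The index \<open>0\<close> stands for the archimedean place of \<open>\<rat>\<close>.\<close>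

definition base_abs :: "nat \<Rightarrow> rat \<Rightarrow> real" where
  "base_abs p q = (if p = 0 then \<bar>of_rat q\<bar> else padic_abs p q)"

definition places_over :: "complex set \<Rightarrow> nat \<Rightarrow> (complex \<Rightarrow> real) set" where
  "places_over K p = {v \<in> extensional K. absolute_value_on K v \<and> (\<forall>q. v (of_rat q) = base_abs p q)}"

lemma places_eq: "places K = (\<Union>p\<in>insert 0 {p. Factorial_Ring.prime p}. places_over K p)"
  unfolding places_def places_over_def base_abs_def by auto

lemma padic_abs_of_int:
  "k \<noteq> 0 \<Longrightarrow> padic_abs p (of_int k) = real p powi (- int (multiplicity (int p) k))"
  by (simp add: padic_abs_def)

lemma padic_abs_of_int_le:
  assumes "Factorial_Ring.prime p" shows "padic_abs p (of_int k) \<le> 1"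
proof (cases "k = 0")
  case False
  have "1 \<le> real p ^ multiplicity (int p) k"
    using prime_gt_0_nat[OF assms] by (intro one_le_power) simp
  then show ?thesis using False by (simp add: padic_abs_of_int power_int_minus inverse_le_1_iff)
qed (simp add: padic_abs_def)

lemma padic_abs_of_int_eq_1:
  assumes "\<not> int p dvd k" shows "padic_abs p (of_int k) = 1"
proof -
  have "k \<noteq> 0" using assms by auto
  then show ?thesis using assms by (simp add: padic_abs_of_int not_dvd_imp_multiplicity_0)
qed

lemma padic_abs_self:
  assumes "Factorial_Ring.prime p" shows "padic_abs p (of_nat p) = 1 / real p"
proof -
  have "padic_abs p (of_int (int p)) = real p powi (- int (multiplicity (int p) (int p)))"
    using prime_gt_0_nat[OF assms] by (intro padic_abs_of_int) simp
  also have "multiplicity (int p) (int p) = 1"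
    using prime_gt_1_nat[OF assms] by (intro multiplicity_self) auto
  finally show ?thesis by (simp add: power_int_minus divide_inverse)
qed

text \<open>Inherited from the multiplicativity of an extension to the algebraic numbers, which
  avoids comparing fractions in lowest terms.\<close>

lemma padic_abs_inverse:
  assumes p: "Factorial_Ring.prime p" shows "padic_abs p (inverse r) = inverse (padic_abs p r)"
proof -
  obtain u where u: "abs_val_field (Collect algebraic) u" "\<And>z. u (of_rat z) = padic_abs p z"
    using exists_padic_extension[OF p] by metis
  interpret u: abs_val_field "Collect algebraic" u by (rule u(1))
  show ?thesis
    unfolding u(2)[symmetric] of_rat_inverse by (rule u.v_inverse, rule u.of_rat_mem)
qed

lemma base_abs_large:
  assumes "p = 0 \<or> Factorial_Ring.prime p" shows "\<exists>r. base_abs p r > 1"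
proof (cases "p = 0")
  case True
  then show ?thesis by (intro exI[of _ 2]) (simp add: base_abs_def)
next
  case False
  then have p: "Factorial_Ring.prime p" using assms by simp
  have "padic_abs p (inverse (of_nat p)) > 1"
    using prime_gt_1_nat[OF p] by (simp add: padic_abs_inverse[OF p] padic_abs_self[OF p])
  then show ?thesis using False by (auto simp: base_abs_def)
qed

text \<open>The prime \<open>p\<close> is small at its own place only. This tells the places of the
  rationals apart and locates where \<open>1 / p\<close> is large.\<close>

lemma base_abs_prime:
  assumes p: "Factorial_Ring.prime p" and q: "q = 0 \<or> Factorial_Ring.prime q"
  shows "base_abs q (of_nat p) < 1 \<longleftrightarrow> q = p"
proof -
  have "base_abs q (of_nat p) = 1" if "q \<noteq> 0" "q \<noteq> p"
  proof -
    have "\<not> int q dvd int p" using that p q primes_dvd_imp_eq by auto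
    then show ?thesis using that padic_abs_of_int_eq_1[of q "int p"] by (simp add: base_abs_def)
  qed
  then show ?thesis
    using prime_gt_1_nat[OF p] padic_abs_self[OF p]
    by (cases "q = 0"; cases "q = p") (auto simp: base_abs_def)
qed

lemma places_over_disjoint:
  assumes "p = 0 \<or> Factorial_Ring.prime p" "q = 0 \<or> Factorial_Ring.prime q" "p \<noteq> q"
  shows "places_over K p \<inter> places_over K q = {}"
proof -
  have "\<exists>r. base_abs p r \<noteq> base_abs q r"
    using assms base_abs_prime[of p p] base_abs_prime[of p q] base_abs_prime[of q p] base_abs_prime[of q q]
    by metis
  then show ?thesis unfolding places_over_def by auto
qed

context number_field
begin

text \<open>Places are extensional on \<open>K\<close>, so different ones already differ at a point
  of \<open>K\<close>; on the rationals they agree by definition.\<close>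

lemma places_over_separated:
  assumes p: "p = 0 \<or> Factorial_Ring.prime p"
  obtains r where "r \<in> \<rat>" "\<And>S. S \<subseteq> places_over K p \<Longrightarrow> separated_abs_vals K S r"
proof -
  obtain r where r: "base_abs p r > 1" using base_abs_large[OF p] by blast
  show ?thesis
  proof (rule that)
    show "of_rat r \<in> (\<rat> :: complex set)" by simp
    fix S assume S: "S \<subseteq> places_over K p"
    have "v x = v' x" if vv: "v \<in> S" "v' \<in> S" "x \<in> \<rat>" for v v' x
    proof -
      obtain q where "x = of_rat q" using vv(3) by (rule Rats_cases)
      moreover have "v (of_rat q) = base_abs p q" "v' (of_rat q) = base_abs p q"
        using vv S unfolding places_over_def by blast+
      ultimately show ?thesis by simp
    qed
    moreover have "\<exists>x\<in>K. v x \<noteq> v' x" if "v \<in> S" "v' \<in> S" "v \<noteq> v'" for v v'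
      using that S extensionalityI[of v K v'] unfolding places_over_def by blast
    moreover have "abs_val_field K v \<and> v (of_rat r) > 1" if "v \<in> S" for v
      using that S r by (auto simp: places_over_def intro: abs_val_fieldI)
    ultimately show "separated_abs_vals K S (of_rat r)"
      unfolding separated_abs_vals_def by simp
  qed
qed

lemma places_over_nfa: "v \<in> places_over K p \<Longrightarrow> number_field_abs K n w v"
  using number_field_axioms
  by (auto simp: places_over_def intro!: number_field_abs.intro abs_val_fieldI)

lemma places_nfa: "v \<in> places K \<Longrightarrow> number_field_abs K n w v"
  unfolding places_eq using places_over_nfa by auto

lemma sum_local_degree_places_over:
  assumes p: "p = 0 \<or> Factorial_Ring.prime p" and S: "finite S" "S \<subseteq> places_over K p"
  shows "(\<Sum>v\<in>S. local_degree K v) \<le> n"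
proof -
  obtain r where r: "r \<in> \<rat>" "\<And>S. S \<subseteq> places_over K p \<Longrightarrow> separated_abs_vals K S r"
    using places_over_separated[OF p] by blast
  show ?thesis using S r by (intro sum_local_degree_le) auto
qed

text \<open>Every local degree is at least 1, so \<open>n + 1\<close> places would violate the bound
  \<open>n\<close> on the sum of their local degrees.\<close>

lemma finite_places_over:
  assumes p: "p = 0 \<or> Factorial_Ring.prime p" shows "finite (places_over K p)"
proof (rule ccontr)
  assume "infinite (places_over K p)"
  then obtain S where S: "finite S" "card S = Suc n" "S \<subseteq> places_over K p"
    using infinite_arbitrarily_large by blast
  have "card S = (\<Sum>v\<in>S. 1)" by simp
  also have "\<dots> \<le> (\<Sum>v\<in>S. local_degree K v)"
    using S places_over_nfa number_field_abs.local_degree_pos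
    by (intro sum_mono) (metis Suc_leI One_nat_def subsetD)
  also have "\<dots> \<le> n" using S p by (intro sum_local_degree_places_over) auto
  finally show False using S by simp
qed

end

text \<open>A combination that annihilates all powers annihilates all polynomials. The test
  polynomial vanishes on \<open>F\<close> except at \<open>b0\<close>.\<close>

lemma homogeneous_vandermonde:
  fixes c :: "complex \<Rightarrow> complex"
  assumes F: "finite F" and z: "\<And>j. (\<Sum>b\<in>F. c b * b ^ j) = 0" and b0: "b0 \<in> F"
  shows "c b0 = 0"
proof -
  have poly: "(\<Sum>b\<in>F. c b * poly P b) = 0" for P
  proof -
    have "(\<Sum>b\<in>F. c b * poly P b) = (\<Sum>i\<le>degree P. coeff P i * (\<Sum>b\<in>F. c b * b ^ i))"
      unfolding poly_altdef sum_distrib_left by (subst sum.swap) (simp add: mult_ac)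
    then show ?thesis using z by simp
  qed
  define P where "P = (\<Prod>b\<in>F - {b0}. [:- b, 1:])"
  have "poly P b = 0" if "b \<in> F - {b0}" for b
    using that F by (auto simp: P_def poly_prod)
  then have "(\<Sum>b\<in>F. c b * poly P b) = c b0 * poly P b0"
    using F b0 by (simp add: sum.remove)
  moreover have "poly P b0 \<noteq> 0" using F by (auto simp: P_def poly_prod)
  ultimately show ?thesis using poly[of P] by simp
qed

section \<open>Places induced by the conjugates\<close>

locale minimal_poly_ext = minimal_poly a f + u: abs_val_field "Collect algebraic" u for a f u
begin

text \<open>The pullback of \<open>u\<close> along the embedding that sends \<open>a\<close> to
  \<open>b\<close>. It is made extensional so that equality of functions is equality of
  places.\<close>

definition conj_place :: "complex \<Rightarrow> complex \<Rightarrow> real" where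
  "conj_place b = restrict (\<lambda>x. u (conjugate b x)) K"

sublocale number_field K n "\<lambda>i. a ^ i"
  by (rule number_field_Q_adjoin)

lemma conj_place_eq [simp]: "x \<in> K \<Longrightarrow> conj_place b x = u (conjugate b x)"
  by (simp add: conj_place_def)

lemma conj_place_abs:
  assumes b: "b \<in> roots" shows "absolute_value_on K (conj_place b)"
  unfolding conj_place_def
proof (subst absolute_value_on_restrict)
  show "absolute_value_on K (\<lambda>x. u (conjugate b x))"
    unfolding absolute_value_on_def
    using algebraic_conjugate[OF b] conjugate_eq_0_iff[OF b] conjugate_hom[OF b] u.v_triangle by simp
qed simp

lemma conj_place_over:
  assumes "b \<in> roots" "\<And>q. u (of_rat q) = base_abs p q"
  shows "conj_place b \<in> places_over K p"
proof -
  have "conj_place b (of_rat q) = base_abs p q" for q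
    using assms by (simp add: conjugate_rat)
  moreover have "conj_place b \<in> extensional K" by (simp add: conj_place_def)
  ultimately show ?thesis using conj_place_abs[OF assms(1)] by (simp add: places_over_def)
qed

lemma conjugate_sum:
  assumes b: "b \<in> roots" and f: "\<And>i. i \<in> I \<Longrightarrow> g i \<in> K"
  shows "conjugate b (sum g I) = (\<Sum>i\<in>I. conjugate b (g i))"
  using f
proof (induction I rule: infinite_finite_induct)
  case (insert i I)
  then show ?case using conjugate_hom(1)[OF b, of "g i" "sum g I"] by simp
qed (use conjugate_rat[OF b, of 0] in simp_all)

lemma conjugate_Rats: "b \<in> roots \<Longrightarrow> x \<in> \<rat> \<Longrightarrow> conjugate b x = x"
  using conjugate_rat by (auto elim!: Rats_cases)

lemma conjugate_power: "b \<in> roots \<Longrightarrow> conjugate b (a ^ i) = b ^ i"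
  using conjugate_ev[of b "monom 1 i"] by simp

text \<open>
  Otherwise there would be a linear relation between the conjugations inducing \<open>v\<close> that holds on a
  local basis at \<open>v\<close>, hence by density on \<open>K\<close>, contradicting Dedekind's independence of characters.
\<close>

lemma card_fiber_le:
  assumes v: "v \<in> conj_place ` roots"
  shows "card {b \<in> roots. conj_place b = v} \<le> local_degree K v"
proof (rule ccontr)
  assume contra: "\<not> ?thesis"
  define F where "F = {b \<in> roots. conj_place b = v}"
  define m where "m = local_degree K v"
  have F: "finite F" "\<And>b. b \<in> F \<Longrightarrow> b \<in> roots" using finite_roots by (auto simp: F_def)
  have uv: "u (conjugate b x) = v x" if "b \<in> F" "x \<in> K" for b x
    using that by (auto simp: F_def)
  have "absolute_value_on K v" using v conj_place_abs by auto
  then interpret v: number_field_abs K n "\<lambda>i. a ^ i" v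
    by (intro number_field_abs.intro number_field_axioms abs_val_fieldI)
  obtain us where us: "\<And>i. us i \<in> K" "\<And>x. x \<in> K \<Longrightarrow> v.approximable m us x"
  proof (rule v.local_basis)
    fix us C
    assume "\<And>i. us i \<in> K" "\<And>x. x \<in> K \<Longrightarrow> v.approximable (local_degree K v) us x"
    then show thesis by (intro that[of us]) (simp_all add: m_def)
  qed
  \<comment> \<open>One unknown for each conjugation inducing \<open>v\<close>, one equation for
    each of the fewer members of the local basis. The coefficients may be irrational, so the system
    is solved over the algebraic numbers, where \<open>u\<close> measures them.\<close>
  have "\<exists>c. (\<forall>b. c b \<in> Collect algebraic) \<and> (\<exists>b\<in>F. c b \<noteq> 0) \<and>
      (\<forall>i\<in>{..<m}. (\<Sum>b\<in>F. c b * conjugate b (us i)) = 0)"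
  proof (rule u.homogeneous_system)
    show "card {..<m} < card F" using contra by (simp add: m_def F_def)
    show "conjugate b (us i) \<in> Collect algebraic" if "b \<in> F" for i b
      using algebraic_conjugate[OF F(2)[OF that] us(1)] by simp
  qed (simp_all add: F)
  then obtain c where c: "\<And>b. algebraic (c b)" "\<exists>b\<in>F. c b \<noteq> 0"
    "\<And>i. i < m \<Longrightarrow> (\<Sum>b\<in>F. c b * conjugate b (us i)) = 0" by auto
  define L where "L = 1 + (\<Sum>b\<in>F. u (c b))"
  have L: "L > 0" unfolding L_def using c(1) by (intro add_pos_nonneg sum_nonneg) auto
  have zero: "(\<Sum>b\<in>F. c b * conjugate b x) = 0" if x: "x \<in> K" for x
  proof (rule ccontr)
    define s where "s = (\<Sum>b\<in>F. c b * conjugate b x)"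
    assume "(\<Sum>b\<in>F. c b * conjugate b x) \<noteq> 0"
    then have "s \<noteq> 0" by (simp add: s_def)
    have s_alg: "s \<in> Collect algebraic"
      unfolding s_def using c(1) F(2) algebraic_conjugate x by (intro u.sum_mem u.mult_mem) auto
    then have "u s / L > 0" using \<open>s \<noteq> 0\<close> L by simp
    then have "\<exists>d. (\<forall>i. d i \<in> \<rat>) \<and> v (x - (\<Sum>i<m. d i * us i)) < u s / L"
      using us(2)[OF x] unfolding v.approximable_def by blast
    then obtain d where d: "\<And>i. d i \<in> \<rat>" "v (x - (\<Sum>i<m. d i * us i)) < u s / L" by blast
    \<comment> \<open>The relation kills rational combinations of the local basis, so it takes the
      value \<open>s\<close> at the remainder \<open>y\<close> too. All conjugates in
      \<open>F\<close> have \<open>u\<close>-size \<open>v y\<close>, which is too small for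
      that.\<close>
    define y where "y = x - (\<Sum>i<m. d i * us i)"
    have comb: "(\<Sum>i<m. d i * us i) \<in> K" by (rule v.rat_combination_mem) (use d us in auto)
    then have y: "y \<in> K" using x by (simp add: y_def)
    have conj_y: "conjugate b y = conjugate b x - (\<Sum>i<m. d i * conjugate b (us i))" if "b \<in> F" for b
    proof -
      have b: "b \<in> roots" using F that by auto
      have "conjugate b y = conjugate b x - conjugate b (\<Sum>i<m. d i * us i)"
        unfolding y_def by (rule conjugate_hom(3)[OF b x comb])
      also have "conjugate b (\<Sum>i<m. d i * us i) = (\<Sum>i<m. conjugate b (d i * us i))"
        using d us by (intro conjugate_sum[OF b] mult_mem) simp_all
      also have "\<dots> = (\<Sum>i<m. d i * conjugate b (us i))"
      proof (rule sum.cong[OF refl])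
        fix i
        have "conjugate b (d i * us i) = conjugate b (d i) * conjugate b (us i)"
          by (rule conjugate_hom(2)[OF b]) (use d us in simp_all)
        then show "conjugate b (d i * us i) = d i * conjugate b (us i)" using conjugate_Rats[OF b d(1)] by simp
      qed
      finally show ?thesis .
    qed
    have "(\<Sum>b\<in>F. c b * conjugate b y) = s - (\<Sum>b\<in>F. c b * (\<Sum>i<m. d i * conjugate b (us i)))"
      unfolding s_def sum_subtractf[symmetric]
      by (rule sum.cong) (auto simp: conj_y right_diff_distrib)
    also have "(\<Sum>b\<in>F. c b * (\<Sum>i<m. d i * conjugate b (us i))) =
        (\<Sum>i<m. d i * (\<Sum>b\<in>F. c b * conjugate b (us i)))"
      unfolding sum_distrib_left by (subst sum.swap) (simp add: mult_ac)
    also have "\<dots> = 0" using c(3) by simp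
    finally have "s = (\<Sum>b\<in>F. c b * conjugate b y)" by simp
    then have "u s \<le> (\<Sum>b\<in>F. u (c b * conjugate b y))"
    proof (simp only:, intro u.v_sum u.mult_mem)
      show "c b \<in> Collect algebraic" for b using c(1) by simp
      show "conjugate b y \<in> Collect algebraic" if "b \<in> F" for b
        using algebraic_conjugate[OF F(2)[OF that] y] by simp
    qed
    also have "\<dots> = (\<Sum>b\<in>F. u (c b) * v y)"
      using c(1) F(2) algebraic_conjugate y uv by (intro sum.cong) auto
    also have "\<dots> = (\<Sum>b\<in>F. u (c b)) * v y" by (simp add: sum_distrib_right)
    also have "\<dots> \<le> L * v y" using y by (intro mult_right_mono) (auto simp: L_def)
    also have "\<dots> < L * (u s / L)" using d(2) L by (intro mult_strict_left_mono) (auto simp: y_def)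
    finally show False using L by simp
  qed
  have "(\<Sum>b\<in>F. c b * b ^ j) = 0" for j
  proof -
    have "(\<Sum>b\<in>F. c b * conjugate b (a ^ j)) = (\<Sum>b\<in>F. c b * b ^ j)"
      using F(2) by (intro sum.cong) (auto simp: conjugate_power)
    then show ?thesis using zero[OF basis_mem] by simp
  qed
  then have "\<forall>b\<in>F. c b = 0" using homogeneous_vandermonde[OF F(1)] by blast
  then show False using c(2) by blast
qed

text \<open>The roots are grouped by the place \<open>v\<close> that they induce; every
  \<open>b\<close> in such a group satisfies \<open>u b = v a\<close>.\<close>

lemma prod_roots_le:
  "(\<Prod>b\<in>roots. max 1 (u b)) \<le> (\<Prod>v\<in>conj_place ` roots. max 1 (v a) ^ local_degree K v)"
proof -
  have "(\<Prod>b\<in>roots. max 1 (u b)) =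
      (\<Prod>v\<in>conj_place ` roots. \<Prod>b\<in>{b \<in> roots. conj_place b = v}. max 1 (u b))"
    by (rule prod.image_gen[OF finite_roots])
  also have "\<dots> = (\<Prod>v\<in>conj_place ` roots. max 1 (v a) ^ card {b \<in> roots. conj_place b = v})"
  proof (rule prod.cong[OF refl])
    fix v assume "v \<in> conj_place ` roots"
    have "(\<Prod>b\<in>{b \<in> roots. conj_place b = v}. max 1 (u b)) =
        (\<Prod>b\<in>{b \<in> roots. conj_place b = v}. max 1 (v a))"
      by (rule prod.cong) (auto simp: mem_Q_adjoin conjugate_gen)
    then show "(\<Prod>b\<in>{b \<in> roots. conj_place b = v}. max 1 (u b)) =
        max 1 (v a) ^ card {b \<in> roots. conj_place b = v}" by simp
  qed
  also have "\<dots> \<le> (\<Prod>v\<in>conj_place ` roots. max 1 (v a) ^ local_degree K v)"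
    by (intro prod_mono conjI power_increasing card_fiber_le) auto
  finally show ?thesis .
qed

end

section \<open>Bounds for the Mahler measure\<close>

context abs_val_field
begin

text \<open>Places are only required to satisfy the triangle inequality. As binomial coefficients
  have absolute value at most 1, the expansion of \<open>(x + y) ^ k\<close> gives
  \<open>v (x + y) ^ k \<le> (k + 1) * M ^ k\<close>; if \<open>v (x + y) > M\<close>, exponential
  growth contradicts the linear factor.\<close>

lemma ultrametric:
  assumes nat: "\<And>k. v (of_nat k) \<le> 1" and x: "x \<in> K" and y: "y \<in> K"
  shows "v (x + y) \<le> max (v x) (v y)"
proof (rule ccontr)
  assume contra: "\<not> ?thesis"
  define M where "M = max (v x) (v y)"
  have "M \<noteq> 0"
  proof
    assume "M = 0"
    then have "v x = 0" "v y = 0" using v_nonneg[OF x] v_nonneg[OF y] by (auto simp: M_def max_def split: if_splits)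
    then show False using x y contra by simp
  qed
  moreover have "M \<ge> 0" using x by (simp add: M_def le_max_iff_disj)
  ultimately have M: "M > 0" by simp
  define s where "s = M / v (x + y)"
  have s: "0 < s" "s < 1" using contra M by (auto simp: s_def M_def divide_less_eq)
  have "v (x + y) > 0" using contra M by (simp add: M_def)
  have bound: "1 \<le> real (Suc k) * s ^ k" for k
  proof -
    have "v (x + y) ^ k = v ((x + y) ^ k)" using x y by simp
    also have "(x + y) ^ k = (\<Sum>i\<le>k. of_nat (k choose i) * x ^ i * y ^ (k - i))" by (rule binomial_ring)
    also have "v \<dots> \<le> (\<Sum>i\<le>k. v (of_nat (k choose i) * x ^ i * y ^ (k - i)))"
      using x y by (intro v_sum) simp
    also have "\<dots> \<le> (\<Sum>i\<le>k. M ^ k)"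
    proof (rule sum_mono)
      fix i assume "i \<in> {..k}"
      have "v (of_nat (k choose i) * x ^ i * y ^ (k - i)) = v (of_nat (k choose i)) * (v x ^ i * v y ^ (k - i))"
        using x y by (simp add: mult.assoc)
      also have "\<dots> \<le> 1 * (M ^ i * M ^ (k - i))"
        using x y nat M by (intro mult_mono power_mono) (auto simp: M_def)
      also have "\<dots> = M ^ k" using \<open>i \<in> {..k}\<close> by (simp flip: power_add)
      finally show "v (of_nat (k choose i) * x ^ i * y ^ (k - i)) \<le> M ^ k" .
    qed
    also have "\<dots> = real (Suc k) * M ^ k" by simp
    finally show ?thesis using \<open>v (x + y) > 0\<close> by (simp add: s_def power_divide field_simps)
  qed
  have "(\<lambda>k. of_nat k * s ^ k + s ^ k) \<longlonglongrightarrow> 0 + 0"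
    using s by (intro tendsto_add powser_times_n_limit_0 LIMSEQ_realpow_zero) auto
  then have "(\<lambda>k. real (Suc k) * s ^ k) \<longlonglongrightarrow> 0" by (simp add: algebra_simps)
  then have "\<forall>\<^sub>F k in sequentially. real (Suc k) * s ^ k < 1" by (intro order_tendstoD(2)) auto
  then obtain k where "real (Suc k) * s ^ k < 1" using eventually_happens'[OF sequentially_bot] by blast
  then show False using bound[of k] by simp
qed

lemma ultrametric_sum:
  assumes nat: "\<And>k. v (of_nat k) \<le> 1" and B: "B \<ge> 0" and f: "\<And>i. i \<in> I \<Longrightarrow> f i \<in> K \<and> v (f i) \<le> B"
  shows "v (sum f I) \<le> B"
  using f
proof (induction I rule: infinite_finite_induct)
  case (insert i I)
  then have "v (f i + sum f I) \<le> max (v (f i)) (v (sum f I))" by (intro ultrametric nat sum_mem) auto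
  then show ?case using insert by force
qed (use B in simp_all)

text \<open>If \<open>v x > 1\<close>, the leading term has value \<open>v x ^ n\<close>, because
  its coefficient has absolute value 1, while all other terms are bounded by
  \<open>v x ^ (n - 1)\<close>.\<close>

lemma integral_le_1:
  assumes int: "\<And>k. v (of_int k) \<le> 1" and x: "x \<in> K"
    and c: "(\<Sum>i\<le>n. of_int (c i) * x ^ i) = 0" "v (of_int (c n)) = 1"
  shows "v x \<le> 1"
proof (rule ccontr)
  assume "\<not> v x \<le> 1"
  then have gt: "v x > 1" by simp
  have nat: "v (of_nat k) \<le> 1" for k using int[of "int k"] by simp
  have "n \<noteq> 0"
  proof
    assume "n = 0"
    then have "of_int (c n) = (0 :: complex)" using c(1) by simp
    then show False using c(2) by simp
  qed
  have eq: "of_int (c n) * x ^ n = - (\<Sum>i<n. of_int (c i) * x ^ i)"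
    using c(1) by (simp add: eq_neg_iff_add_eq_0 add.commute flip: lessThan_Suc_atMost)
  have "v x ^ n = v (of_int (c n) * x ^ n)" using c(2) x by simp
  also have "\<dots> = v (\<Sum>i<n. of_int (c i) * x ^ i)"
    unfolding eq using x by (intro v_minus sum_mem mult_mem) simp_all
  also have "\<dots> \<le> v x ^ (n - 1)"
  proof (rule ultrametric_sum[OF nat])
    fix i assume i: "i \<in> {..<n}"
    have "v (of_int (c i) * x ^ i) = v (of_int (c i)) * v x ^ i" using x by simp
    also have "\<dots> \<le> 1 * v x ^ (n - 1)"
      using i gt int by (intro mult_mono power_increasing) auto
    finally show "of_int (c i) * x ^ i \<in> K \<and> v (of_int (c i) * x ^ i) \<le> v x ^ (n - 1)"
      using x by simp
  qed (use gt in simp)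
  finally have "v x ^ n \<le> v x ^ (n - 1)" .
  moreover have "v x ^ (n - 1) < v x ^ n" using gt \<open>n \<noteq> 0\<close> by (intro power_strict_increasing) auto
  ultimately show False by simp
qed

text \<open>The reversed coefficients give a relation for \<open>inverse x\<close>, whose leading
  coefficient is \<open>c 0\<close>.\<close>

lemma integral_ge_1:
  assumes int: "\<And>k. v (of_int k) \<le> 1" and x: "x \<in> K" "x \<noteq> 0"
    and c: "(\<Sum>i\<le>n. of_int (c i) * x ^ i) = 0" "v (of_int (c 0)) = 1"
  shows "v x \<ge> 1"
proof -
  have "(\<Sum>i\<le>n. of_int (c (n - i)) * inverse x ^ i) = (\<Sum>i\<le>n. of_int (c i) * inverse x ^ (n - i))"
    by (rule sum.reindex_bij_witness[of _ "\<lambda>i. n - i" "\<lambda>i. n - i"]) auto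
  also have "\<dots> = (\<Sum>i\<le>n. inverse x ^ n * (of_int (c i) * x ^ i))"
  proof (rule sum.cong[OF refl])
    fix i assume "i \<in> {..n}"
    then have "inverse x ^ n = inverse x ^ (n - i) * inverse x ^ i" by (simp flip: power_add)
    then show "of_int (c i) * inverse x ^ (n - i) = inverse x ^ n * (of_int (c i) * x ^ i)"
      using x(2) by (simp add: power_inverse)
  qed
  also have "\<dots> = 0" unfolding sum_distrib_left[symmetric] c(1) by simp
  finally have "v (inverse x) \<le> 1"
    using x c(2) int by (intro integral_le_1[of "inverse x" "\<lambda>i. c (n - i)" n]) auto
  then show ?thesis using x by (simp add: inverse_le_1_iff) (metis not_le v_pos)
qed

text \<open>The required inequality of Gauss's lemma: multiplication by \<open>X - b\<close>
  enlarges the maximal absolute value of the coefficients at most by the factor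
  \<open>max 1 (v b)\<close>.\<close>

lemma coeff_prod_linear_le:
  assumes nat: "\<And>k. v (of_nat k) \<le> 1" and S: "S \<subseteq> K"
  shows "coeff (\<Prod>b\<in>S. [:- b, 1:]) j \<in> K \<and> v (coeff (\<Prod>b\<in>S. [:- b, 1:]) j) \<le> (\<Prod>b\<in>S. max 1 (v b))"
  using S
proof (induction S arbitrary: j rule: infinite_finite_induct)
  case (insert b S)
  define p where "p = (\<Prod>b\<in>S. [:- b, 1:])"
  define B where "B = (\<Prod>b\<in>S. max 1 (v b))"
  have B: "B \<ge> 1" unfolding B_def by (intro prod_ge_1) simp
  have IH: "coeff p i \<in> K" "v (coeff p i) \<le> B" for i
    using insert unfolding p_def B_def by auto
  have b: "b \<in> K" using insert by simp
  define s where "s = (case j of 0 \<Rightarrow> 0 | Suc i \<Rightarrow> coeff p i)"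
  have s: "s \<in> K" "v s \<le> B" using IH B by (auto simp: s_def split: nat.split)
  have eq: "coeff ([:- b, 1:] * p) j = - b * coeff p j + s"
    by (simp add: s_def coeff_pCons split: nat.split)
  have "v (- b * coeff p j + s) \<le> max (v (- b * coeff p j)) (v s)"
    using b IH s by (intro ultrametric nat) auto
  also have "\<dots> \<le> max 1 (v b) * B"
  proof (rule max.boundedI)
    show "v (- b * coeff p j) \<le> max 1 (v b) * B"
      using b IH by (simp del: mult_minus_left) (intro mult_mono, auto)
    have "v s \<le> 1 * B" using s by simp
    also have "\<dots> \<le> max 1 (v b) * B" using B by (intro mult_right_mono) auto
    finally show "v s \<le> max 1 (v b) * B" .
  qed
  finally show ?case
    using insert.hyps b IH s eq by (simp add: p_def B_def del: mult_pCons_left)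
qed (auto simp: coeff_1)

end

section \<open>The product formula and primitive integral polynomials\<close>

lemma multiplicity_int_nat_abs: "multiplicity (int q) c = multiplicity q (nat \<bar>c\<bar>)"
  by (simp add: multiplicity_def dvd_nat_abs_iff)

text \<open>The product formula for a nonzero integer, restricted to the finitely many primes that
  contribute: each factor is the full power of \<open>q\<close> in \<open>c\<close>.\<close>

lemma padic_abs_prod:
  assumes "c \<noteq> 0"
  shows "(\<Prod>q\<in>{q. Factorial_Ring.prime q \<and> int q dvd c}. 1 / padic_abs q (of_int c)) = \<bar>of_int c\<bar>"
    and "finite {q. Factorial_Ring.prime q \<and> int q dvd c}"
proof -
  define N where "N = nat \<bar>c\<bar>"
  have N: "N \<noteq> 0" using assms by (simp add: N_def)
  have set: "{q. Factorial_Ring.prime q \<and> int q dvd c} = prime_factors N"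
    using N by (auto simp: N_def dvd_nat_abs_iff in_prime_factors_iff)
  then show "finite {q. Factorial_Ring.prime q \<and> int q dvd c}" by simp
  have "(\<Prod>q\<in>prime_factors N. 1 / padic_abs q (of_int c)) = (\<Prod>q\<in>prime_factors N. real (q ^ multiplicity q N))"
  proof (rule prod.cong[OF refl])
    fix q assume "q \<in> prime_factors N"
    then have "q > 0" using prime_gt_0_nat by blast
    then show "1 / padic_abs q (of_int c) = real (q ^ multiplicity q N)"
      using assms by (simp add: padic_abs_of_int multiplicity_int_nat_abs N_def power_int_minus divide_inverse)
  qed
  also have "\<dots> = real (\<Prod>q\<in>prime_factors N. q ^ multiplicity q N)" by simp
  also have "(\<Prod>q\<in>prime_factors N. q ^ multiplicity q N) = N"
    using prod_prime_factors[OF N] by simp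
  also have "real N = \<bar>of_int c\<bar>" by (simp add: N_def)
  finally show "(\<Prod>q\<in>{q. Factorial_Ring.prime q \<and> int q dvd c}. 1 / padic_abs q (of_int c)) = \<bar>of_int c\<bar>"
    unfolding set .
qed

lemma primitive_int_poly:
  assumes "f \<noteq> (0 :: rat poly)"
  obtains F :: "int poly" and d :: rat
  where "d \<noteq> 0" "\<And>i. of_int (coeff F i) = d * coeff f i" "content F = 1"
proof -
  define D where "D = (\<Prod>i\<le>degree f. snd (quotient_of (coeff f i)))"
  have D: "D \<noteq> 0"
    unfolding D_def using quotient_of_denom_pos' by (subst prod_zero_iff) (auto simp: less_le)
  have "\<exists>k. of_int D * coeff f i = of_int k" if "i \<le> degree f" for i
  proof -
    obtain a b where ab: "quotient_of (coeff f i) = (a, b)" by (cases "quotient_of (coeff f i)")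
    have "b dvd D" unfolding D_def using that ab by (metis dvd_prodI atMost_iff finite_atMost snd_conv)
    then obtain e where e: "D = b * e" by (rule dvdE)
    have "b > 0" using quotient_of_denom_pos[OF ab] .
    then have "of_int D * coeff f i = of_int (e * a)"
      unfolding quotient_of_div[OF ab] e by simp
    then show ?thesis by blast
  qed
  then obtain k where k: "\<And>i. i \<le> degree f \<Longrightarrow> of_int D * coeff f i = of_int (k i)" by metis
  define G where "G = (\<Sum>i\<le>degree f. monom (k i) i)"
  have G: "of_int (coeff G i) = of_int D * coeff f i" for i
    using k[of i] by (auto simp: G_def coeff_sum coeff_eq_0)
  have "coeff G (degree f) \<noteq> 0" using G[of "degree f"] D assms by auto
  then have "G \<noteq> 0" by auto
  define c where "c = content G"
  have c: "c \<noteq> 0" using \<open>G \<noteq> 0\<close> by (simp add: c_def)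
  define F where "F = primitive_part G"
  have "G = smult c F" by (simp add: c_def F_def)
  then have cF: "of_int (coeff G i) = (of_int c * of_int (coeff F i) :: rat)" for i by simp
  show ?thesis
  proof (rule that)
    show "of_int D / of_int c \<noteq> (0 :: rat)" using c D by simp
    show "of_int (coeff F i) = of_int D / of_int c * coeff f i" for i
      using cF[of i] G[of i] c by (simp add: field_simps)
    show "content F = 1" using \<open>G \<noteq> 0\<close> by (simp add: F_def)
  qed
qed

lemma primitive_coeff:
  assumes "content F = (1 :: int)" "Factorial_Ring.prime q"
  obtains j where "\<not> int q dvd coeff F j"
proof -
  have "\<not> int q dvd content F" using assms prime_gt_1_nat[of q] by simp
  then have "\<not> [:int q:] dvd F" by (simp add: const_poly_dvd_iff_dvd_content)
  then show ?thesis using that by (auto simp: const_poly_dvd_iff)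
qed

section \<open>The Mahler measure as a product over places\<close>

context minimal_poly
begin

sublocale nf: number_field K n "\<lambda>i. a ^ i"
  by (rule number_field_Q_adjoin)

definition expanding_places :: "nat \<Rightarrow> (complex \<Rightarrow> real) set" where
  "expanding_places p = {v \<in> places_over K p. v a > 1}"

text \<open>The exponent \<open>deg a\<close> cancels the denominator in
  \<open>normalized_abs\<close>. As local degrees are positive, a normalized value exceeds 1 exactly
  when \<open>v a\<close> does.\<close>

lemma mahler_measure_eq:
  "mahler_measure a = (\<Prod>v\<in>{v \<in> places K. v a > 1}. v a ^ local_degree K v)"
proof -
  define W where "W = {v \<in> places K. v a > 1}"
  let ?d = "local_degree K"
  have iff: "max 1 (normalized_abs K v a) \<noteq> 1 \<longleftrightarrow> v a > 1"
    and val: "v a > 1 \<Longrightarrow> max 1 (normalized_abs K v a) = v a powr (?d v / n)"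
    if "v \<in> places K" for v
  proof -
    interpret v: number_field_abs K n "\<lambda>i. a ^ i" v by (rule nf.places_nfa[OF that])
    have e: "real (?d v) / real n > 0" using v.local_degree_pos n_pos by simp
    have nn: "v a \<ge> 0" by (simp add: mem_Q_adjoin)
    have norm: "normalized_abs K v a = v a powr (?d v / n)"
      by (simp add: normalized_abs_def field_degree_Q_adjoin)
    have gt: "v a powr (?d v / n) > 1" if "v a > 1" using gr_one_powr[OF that e] .
    have le: "v a powr (?d v / n) \<le> 1" if "\<not> v a > 1"
      using that e nn by (intro powr_le1) auto
    show "max 1 (normalized_abs K v a) \<noteq> 1 \<longleftrightarrow> v a > 1"
    proof (cases "v a > 1")
      case True
      show ?thesis unfolding norm max_absorb2[OF less_imp_le[OF gt[OF True]]] using gt[OF True] True by force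
    next
      case False
      show ?thesis unfolding norm max_absorb1[OF le[OF False]] using False by simp
    qed
    show "max 1 (normalized_abs K v a) = v a powr (?d v / n)" if "v a > 1"
      unfolding norm by (rule max_absorb2[OF less_imp_le[OF gt[OF that]]])
  qed
  have set: "{v \<in> places K. max 1 (normalized_abs K v a) \<noteq> 1} = W"
    using iff by (auto simp: W_def)
  have "weil_height a = (\<Prod>v\<in>W. v a powr (?d v / n))"
    unfolding weil_height_def weil_height_in_def set by (rule prod.cong) (auto simp: W_def val)
  then have "mahler_measure a = (\<Prod>v\<in>W. (v a powr (?d v / n)) ^ n)"
    by (simp add: mahler_measure_def alg_degree_def field_degree_Q_adjoin prod_power_distrib)
  also have "\<dots> = (\<Prod>v\<in>W. v a ^ ?d v)"
  proof (rule prod.cong[OF refl])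
    fix v assume "v \<in> W"
    then have "v a > 1" by (simp add: W_def)
    then show "(v a powr (?d v / n)) ^ n = v a ^ ?d v"
      using n_pos by (simp add: powr_power powr_realpow)
  qed
  finally show ?thesis by (simp add: W_def)
qed

lemma mahler_measure_ge_1: "mahler_measure a \<ge> 1"
  unfolding mahler_measure_eq by (intro prod_ge_1) (auto intro: one_le_power)

text \<open>When all places with \<open>v a > 1\<close> lie over one place of the rationals and
  share the value \<open>c\<close>, the exponents add up to at most \<open>n\<close>. Taking
  \<open>max 1 c\<close> keeps powers monotone in the exponent; for \<open>c \<le> 1\<close> there
  is no such place.\<close>

lemma mahler_measure_upper:
  assumes p: "p = 0 \<or> Factorial_Ring.prime p" and c: "c \<ge> 0"
    and W: "\<And>v. v \<in> places K \<Longrightarrow> v a > 1 \<Longrightarrow> v \<in> places_over K p \<and> v a = c"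
  shows "mahler_measure a \<le> max 1 c ^ n"
proof -
  define W where "W = {v \<in> places K. v a > 1}"
  let ?d = "local_degree K"
  have sub: "W \<subseteq> places_over K p" using W by (auto simp: W_def)
  have fin: "finite W" using finite_subset[OF sub nf.finite_places_over[OF p]] .
  have "mahler_measure a = (\<Prod>v\<in>W. v a ^ ?d v)" by (simp add: mahler_measure_eq W_def)
  also have "\<dots> \<le> (\<Prod>v\<in>W. max 1 c ^ ?d v)"
    using W c by (intro prod_mono) (auto simp: W_def intro!: power_mono)
  also have "\<dots> = max 1 c ^ (\<Sum>v\<in>W. ?d v)" by (simp add: power_sum)
  also have "\<dots> \<le> max 1 c ^ n"
    by (intro power_increasing nf.sum_local_degree_places_over[OF p fin sub]) auto
  finally show ?thesis .
qed

end

text \<open>At each place with \<open>v x > 1\<close> the value is the \<open>d\<close>-th root of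
  \<open>c\<close>. Since \<open>x\<close> has degree \<open>n \<le> d\<close>, the bound
  \<open>root d c ^ n\<close> is at most \<open>c\<close>.\<close>

lemma mahler_measure_radical_le:
  assumes x: "x ^ d = of_rat r" "d > 0" and p: "p = 0 \<or> Factorial_Ring.prime p" and c: "c \<ge> 1"
    and base: "\<And>q. q = 0 \<or> Factorial_Ring.prime q \<Longrightarrow> base_abs q r > 1 \<Longrightarrow> q = p \<and> base_abs q r = c"
  shows "algebraic x" "mahler_measure x \<le> c"
proof -
  define g where "g = monom 1 d - [:r:]"
  have ev: "ev g x = 0" using x by (simp add: g_def)
  have "coeff g d = 1" using x(2) by (simp add: g_def coeff_pCons split: nat.split)
  then have g: "g \<noteq> 0" by auto
  show alg: "algebraic x" using algebraic_ev_root[OF g ev] .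
  obtain f where "minimal_poly x f" using minimal_poly_exists[OF alg] .
  then interpret minimal_poly x f .
  have "degree f \<le> degree g" using f_min g ev by blast
  also have "degree g \<le> d"
    unfolding g_def by (intro degree_diff_le degree_monom_le) simp
  finally have nd: "n \<le> d" .
  have root: "root d c \<ge> 1" using c x(2) by simp
  have "mahler_measure x \<le> max 1 (root d c) ^ n"
  proof (rule mahler_measure_upper[OF p])
    show "0 \<le> root d c" using root by simp
    fix v assume v: "v \<in> places (Q_adjoin x)" "v x > 1"
    then obtain q where q: "q = 0 \<or> Factorial_Ring.prime q" "v \<in> places_over (Q_adjoin x) q"
      unfolding places_eq by auto
    interpret v: number_field_abs "Q_adjoin x" n "\<lambda>i. x ^ i" v by (rule nf.places_nfa[OF v(1)])
    have vd: "v x ^ d = base_abs q r"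
      using q(2) x(1) v.v_power[OF mem_Q_adjoin, of d] by (simp add: places_over_def)
    then have "base_abs q r > 1" using v(2) x(2) by (metis one_less_power)
    then have "q = p" "base_abs q r = c" using base q(1) by blast+
    moreover from this have "v x = root d c"
      using vd v(2) x(2) by (metis real_root_power_cancel less_imp_le less_trans zero_less_one)
    ultimately show "v \<in> places_over (Q_adjoin x) p \<and> v x = root d c" using q by simp
  qed
  also have "max 1 (root d c) ^ n = root d c ^ n" using root by simp
  also have "\<dots> \<le> root d c ^ d" using nd root by (rule power_increasing)
  also have "\<dots> = c" using x(2) c by simp
  finally show "mahler_measure x \<le> c" .
qed

section \<open>The lower bound by the first and last coefficients\<close>

context minimal_poly
begin

definition place_factor :: "nat \<Rightarrow> real" where
  "place_factor p = (\<Prod>v\<in>expanding_places p. v a ^ local_degree K v)"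

text \<open>The places induced by the roots are among those over \<open>p\<close>; enlarging the
  product only adds factors that are at least 1.\<close>

lemma place_factor_ge:
  assumes p: "p = 0 \<or> Factorial_Ring.prime p"
    and u: "abs_val_field (Collect algebraic) u" "\<And>q. u (of_rat q) = base_abs p q"
  shows "(\<Prod>b\<in>roots. max 1 (u b)) \<le> place_factor p"
proof -
  interpret u: abs_val_field "Collect algebraic" u by (rule u(1))
  interpret minimal_poly_ext a f u ..
  have "(\<Prod>b\<in>roots. max 1 (u b)) \<le> (\<Prod>v\<in>conj_place ` roots. max 1 (v a) ^ local_degree K v)"
    by (rule prod_roots_le)
  also have "\<dots> \<le> (\<Prod>v\<in>places_over K p. max 1 (v a) ^ local_degree K v)"
  proof (rule prod_mono2[OF nf.finite_places_over[OF p]])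
    show "conj_place ` roots \<subseteq> places_over K p" using conj_place_over u(2) by auto
  qed (auto intro: one_le_power)
  also have "\<dots> = place_factor p"
    unfolding place_factor_def
    by (rule prod.mono_neutral_cong_right[OF nf.finite_places_over[OF p]])
      (auto simp: expanding_places_def max_def less_le)
  finally show ?thesis .
qed

lemma int_poly_relation:
  assumes "\<And>i. of_int (coeff F i) = e * coeff f i"
  shows "(\<Sum>i\<le>n. of_int (coeff F i) * a ^ i) = 0"
proof -
  have "of_int (coeff F i) = (of_rat (e * coeff f i) :: complex)" for i
    using assms[of i] by (metis of_rat_of_int_eq)
  then have "(\<Sum>i\<le>n. of_int (coeff F i) * a ^ i) = of_rat e * ev f a"
    by (simp add: ev_altdef of_rat_mult sum_distrib_left mult.assoc)
  then show ?thesis by (simp add: f_root)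
qed

text \<open>By the product formula the leading coefficient \<open>c\<close> is the product of the
  \<open>1 / padic_abs q c\<close>, each of which is at most the factor of \<open>q\<close> in the
  Mahler measure. The archimedean factor is at least the product of the
  \<open>max 1 (cmod b)\<close>, which serves both for \<open>c\<close> and for the constant
  coefficient.\<close>

lemma mahler_measure_lower:
  assumes F: "\<And>i. of_int (coeff F i) = e * coeff f i" "e \<noteq> 0" "content F = 1"
  shows "\<bar>of_int (coeff F n)\<bar> \<le> mahler_measure a" "\<bar>of_int (coeff F 0)\<bar> \<le> mahler_measure a"
proof -
  define c where "c = coeff F n"
  have c: "c \<noteq> 0" using F(1)[of n] F(2) f_nz by (auto simp: c_def)
  have FC: "of_int (coeff F j) = (of_rat (e * coeff f j) :: complex)" for j
    using F(1)[of j] by (metis of_rat_of_int_eq)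
  have coeffs: "of_int (coeff F j) = of_int c * coeff (\<Prod>b\<in>roots. [:- b, 1:]) j" for j
  proof -
    have "of_int (coeff F j) = of_rat e * coeff fC j" by (simp add: FC of_rat_mult coeff_of_rat_poly)
    also have "coeff fC j = lead_coeff fC * coeff (\<Prod>b\<in>roots. [:- b, 1:]) j"
      by (subst fC_split) simp
    also have "of_rat e * (lead_coeff fC * coeff (\<Prod>b\<in>roots. [:- b, 1:]) j) =
        of_int c * coeff (\<Prod>b\<in>roots. [:- b, 1:]) j"
      unfolding c_def FC lead_coeff_fC by (simp add: of_rat_mult)
    finally show ?thesis .
  qed
  define B where "B = {q. Factorial_Ring.prime q \<and> int q dvd c}"
  have B: "finite B" "(\<Prod>q\<in>B. 1 / padic_abs q (of_int c)) = \<bar>of_int c\<bar>" "0 \<notin> B"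
    using padic_abs_prod[OF c] by (auto simp: B_def)
  have B_prime: "q = 0 \<or> Factorial_Ring.prime q" if "q \<in> insert 0 B" for q
    using that by (auto simp: B_def)
  \<comment> \<open>At a prime not dividing \<open>c\<close> the number \<open>a\<close> is integral
    by \<open>integral_le_1\<close>, so no place over it has \<open>v a > 1\<close>.\<close>
  have W: "{v \<in> places K. v a > 1} = (\<Union>q\<in>insert 0 B. expanding_places q)"
  proof (intro equalityI subsetI)
    fix v assume v: "v \<in> {v \<in> places K. v a > 1}"
    then obtain q where q: "q = 0 \<or> Factorial_Ring.prime q" "v \<in> places_over K q"
      unfolding places_eq by auto
    interpret v: number_field_abs K n "\<lambda>i. a ^ i" v by (rule nf.places_over_nfa[OF q(2)])
    have "q \<in> insert 0 B"
    proof (rule ccontr)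
      assume notB: "q \<notin> insert 0 B"
      then have qp: "Factorial_Ring.prime q" "\<not> int q dvd c" using q by (auto simp: B_def)
      have vi: "v (of_int k) = padic_abs q (of_int k)" for k
      proof -
        have "v (of_rat (of_int k)) = base_abs q (of_int k)" using q(2) unfolding places_over_def by blast
        then show ?thesis using notB by (simp add: base_abs_def)
      qed
      have "v a \<le> 1"
      proof (rule v.integral_le_1)
        show "v (of_int k) \<le> 1" for k unfolding vi by (rule padic_abs_of_int_le[OF qp(1)])
        show "v (of_int (coeff F n)) = 1"
          unfolding vi by (rule padic_abs_of_int_eq_1) (use qp in \<open>simp add: c_def\<close>)
        show "(\<Sum>i\<le>n. of_int (coeff F i) * a ^ i) = 0" by (rule int_poly_relation[OF F(1)])
      qed (rule mem_Q_adjoin)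
      then show False using v by simp
    qed
    then show "v \<in> (\<Union>q\<in>insert 0 B. expanding_places q)" using q v by (auto simp: expanding_places_def)
  next
    fix v assume "v \<in> (\<Union>q\<in>insert 0 B. expanding_places q)"
    then obtain q where "q \<in> insert 0 B" "v \<in> expanding_places q" by blast
    then show "v \<in> {v \<in> places K. v a > 1}"
      using B_prime unfolding expanding_places_def places_eq by blast
  qed
  have "mahler_measure a = (\<Prod>q\<in>insert 0 B. place_factor q)"
    unfolding mahler_measure_eq W place_factor_def
  proof (rule prod.UNION_disjoint)
    show "\<forall>q\<in>insert 0 B. finite (expanding_places q)"
      using nf.finite_places_over[OF B_prime] by (auto simp: expanding_places_def)
    show "\<forall>p\<in>insert 0 B. \<forall>q\<in>insert 0 B. p \<noteq> q \<longrightarrow> expanding_places p \<inter> expanding_places q = {}"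
      using places_over_disjoint[OF B_prime B_prime] unfolding expanding_places_def by blast
  qed (use B in simp)
  then have M: "mahler_measure a = place_factor 0 * (\<Prod>q\<in>B. place_factor q)"
    using B by simp
  have "(\<Prod>q\<in>B. 1 / padic_abs q (of_int c)) \<le> (\<Prod>q\<in>B. place_factor q)"
  proof (rule prod_mono, intro conjI)
    fix q assume "q \<in> B"
    then have q: "Factorial_Ring.prime q" by (simp add: B_def)
    show "0 \<le> 1 / padic_abs q (of_int c)" using c by (simp add: padic_abs_of_int)
    obtain u where u: "abs_val_field (Collect algebraic) u" "\<And>z. u (of_rat z) = padic_abs q z"
      using exists_padic_extension[OF q] by metis
    interpret u: abs_val_field "Collect algebraic" u by (rule u(1))
    have ui: "u (of_int k) = padic_abs q (of_int k)" for k using u(2)[of "of_int k"] by simp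
    have un: "u (of_nat k) \<le> 1" for k
      using ui[of "int k"] padic_abs_of_int_le[OF q, of "int k"] by simp
    have "q \<noteq> 0" using prime_gt_0_nat[OF q] by simp
    \<comment> \<open>Coefficient \<open>j\<close> of \<open>F\<close> has \<open>q\<close>-adic
      absolute value 1 and equals \<open>c\<close> times the corresponding coefficient
      \<open>s\<close> of the product of the \<open>X - b\<close>. So \<open>u s\<close> is
      \<open>1 / padic_abs q c\<close>, to which Gauss's bound applies.\<close>
    obtain j where j: "\<not> int q dvd coeff F j" using primitive_coeff[OF F(3) q] .
    define s where "s = coeff (\<Prod>b\<in>roots. [:- b, 1:]) j"
    have "roots \<subseteq> Collect algebraic"
      using root_minimal_poly minimal_poly.algebraic_a by (auto simp: roots_def)
    then have s: "s \<in> Collect algebraic" "u s \<le> (\<Prod>b\<in>roots. max 1 (u b))"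
      using u.coeff_prod_linear_le[OF un, of roots j] by (auto simp: s_def)
    have "1 = u (of_int (coeff F j))" using padic_abs_of_int_eq_1[OF j] by (simp add: ui)
    also have "\<dots> = padic_abs q (of_int c) * u s"
      unfolding coeffs[of j] ui[symmetric] s_def[symmetric] by (rule u.v_mult) (use s in simp_all)
    finally have "1 / padic_abs q (of_int c) = u s"
      by (metis mult_zero_left nonzero_mult_div_cancel_left zero_neq_one)
    also have "\<dots> \<le> (\<Prod>b\<in>roots. max 1 (u b))" by (rule s)
    also have "\<dots> \<le> place_factor q"
      by (rule place_factor_ge) (use q u \<open>q \<noteq> 0\<close> in \<open>auto simp: base_abs_def\<close>)
    finally show "1 / padic_abs q (of_int c) \<le> place_factor q" .
  qed
  then have fin: "\<bar>of_int c\<bar> \<le> (\<Prod>q\<in>B. place_factor q)" using B by simp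
  have "abs_val_field (Collect algebraic) cmod"
    by (intro complex_subfield.abs_val_fieldI complex_subfield_algebraic)
      (simp add: absolute_value_on_def norm_mult norm_triangle_ineq)
  then have inf: "(\<Prod>b\<in>roots. max 1 (cmod b)) \<le> place_factor 0"
  proof (rule place_factor_ge[rotated])
    show "cmod (of_rat q) = base_abs 0 q" for q
    proof -
      obtain k b where "quotient_of q = (k, b)" by (cases "quotient_of q")
      then have "q = of_int k / of_int b" by (rule quotient_of_div)
      then show ?thesis by (simp only: base_abs_def of_rat_divide of_rat_of_int_eq norm_divide norm_of_int abs_divide if_True simp_thms)
    qed
  qed simp
  have "(\<Prod>b\<in>roots. max 1 (cmod b)) \<ge> 1" by (intro prod_ge_1) simp
  then have "1 * \<bar>of_int c\<bar> \<le> place_factor 0 * (\<Prod>q\<in>B. place_factor q)"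
    using inf fin by (intro mult_mono) auto
  then show "\<bar>of_int (coeff F n)\<bar> \<le> mahler_measure a" by (simp add: M c_def)
  \<comment> \<open>The constant coefficient is, up to sign, \<open>c\<close> times the product of
    the roots: the finite factors account for \<open>c\<close>, the archimedean factor for the
    roots.\<close>
  have "\<bar>of_int (coeff F 0)\<bar> = cmod (of_int (coeff F 0))" by simp
  also have "\<dots> = \<bar>of_int c\<bar> * (\<Prod>b\<in>roots. cmod b)"
    unfolding coeffs[of 0] norm_mult by (simp add: poly_prod flip: prod_norm poly_0_coeff_0)
  also have "\<dots> \<le> (\<Prod>q\<in>B. place_factor q) * place_factor 0"
  proof (rule mult_mono[OF fin])
    have "(\<Prod>b\<in>roots. cmod b) \<le> (\<Prod>b\<in>roots. max 1 (cmod b))" by (intro prod_mono) auto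
    then show "(\<Prod>b\<in>roots. cmod b) \<le> place_factor 0" using inf by linarith
    show "0 \<le> (\<Prod>q\<in>B. place_factor q)" using fin by (rule order.trans[rotated]) simp
  qed (auto intro: prod_nonneg)
  finally show "\<bar>of_int (coeff F 0)\<bar> \<le> mahler_measure a" by (simp add: M mult.commute)
qed

lemma mahler_measure_ge_prime:
  assumes p: "Factorial_Ring.prime p"
    and u: "abs_val_field (Collect algebraic) u" "\<And>z. u (of_rat z) = padic_abs p z"
    and a: "a \<noteq> 0" "u a \<noteq> 1"
  shows "mahler_measure a \<ge> real p"
proof -
  interpret u: abs_val_field "Collect algebraic" u by (rule u(1))
  obtain F e where F: "e \<noteq> 0" "\<And>i. of_int (coeff F i) = e * coeff f i" "content F = 1"
    using primitive_int_poly[OF f_nz] by metis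
  have ui: "u (of_int k) = padic_abs p (of_int k)" for k using u(2)[of "of_int k"] by simp
  have le: "u (of_int k) \<le> 1" for k unfolding ui by (rule padic_abs_of_int_le[OF p])
  note sum = int_poly_relation[OF F(2)]
  have alg: "a \<in> Collect algebraic" using algebraic_a by simp
  have "int p dvd coeff F n \<or> int p dvd coeff F 0"
  proof (rule ccontr)
    assume *: "\<not> ?thesis"
    then have "u (of_int (coeff F n)) = 1" "u (of_int (coeff F 0)) = 1"
      unfolding ui by (auto intro: padic_abs_of_int_eq_1)
    then have "u a \<le> 1" "u a \<ge> 1"
      using u.integral_le_1[OF le alg sum] u.integral_ge_1[OF le alg a(1) sum] by auto
    then show False using a by simp
  qed
  moreover have "coeff F n \<noteq> 0" using F(2)[of n] F(1) f_nz by auto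
  moreover have "coeff F 0 \<noteq> 0"
  proof
    assume "coeff F 0 = 0"
    then have "coeff f 0 = 0" using F(1) F(2)[of 0] by simp
    then have "ev f 0 = 0" by (cases f) simp
    \<comment> \<open>If 0 is a root, then \<open>f\<close> is minimal for 0 as well and divides
      \<open>X\<close>, which forces \<open>a = 0\<close>. Nonzero coefficients are required because
      divisibility by \<open>p\<close> bounds only nonzero integers from below.\<close>
    then interpret zero: minimal_poly 0 f by (rule root_minimal_poly)
    have "f dvd [:0, 1:]" using zero.dvd_iff by simp
    then have "ev [:0, 1:] a = 0" using dvd_iff by blast
    then show False using a by simp
  qed
  ultimately obtain k where k: "k \<noteq> 0" "int p dvd k" "\<bar>of_int k\<bar> \<le> mahler_measure a"
    using mahler_measure_lower[OF F(2,1,3)] by auto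
  have "int p \<le> \<bar>k\<bar>" using k by (intro zdvd_imp_le) auto
  then have "real p \<le> \<bar>of_int k\<bar>" by linarith
  then show ?thesis using k(3) by simp
qed

end

text \<open>Among the places of the rationals, \<open>q\<close> is large only at the archimedean
  one, with index 0, and \<open>1 / q\<close> only at \<open>q\<close>. In both cases the value is
  \<open>q\<close>.\<close>

lemma mahler_measure_prime_radical:
  assumes x: "x ^ d = of_nat q" and d: "d > 0" and q: "Factorial_Ring.prime q"
  shows "algebraic x" "mahler_measure x \<le> real q"
    "algebraic (inverse x)" "mahler_measure (inverse x) \<le> real q"
proof -
  have q1: "q > 1" using prime_gt_1_nat[OF q] .
  have padic_le: "padic_abs r (of_nat q) \<le> 1" if "Factorial_Ring.prime r" for r
    using padic_abs_of_int_le[OF that, of "int q"] by simp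
  have *: "r = 0 \<and> base_abs r (of_nat q) = real q"
    if "r = 0 \<or> Factorial_Ring.prime r" "base_abs r (of_nat q) > 1" for r
    using that padic_le[of r] by (cases "r = 0") (auto simp: base_abs_def)
  show "algebraic x" "mahler_measure x \<le> real q"
    using mahler_measure_radical_le[of x d "of_nat q" 0 "real q"] x d q1 * by auto
  have **: "r = q \<and> base_abs r (inverse (of_nat q)) = real q"
    if r: "r = 0 \<or> Factorial_Ring.prime r" and gt: "base_abs r (inverse (of_nat q)) > 1" for r
  proof -
    have eq: "base_abs r (inverse (of_nat q)) = inverse (base_abs r (of_nat q))"
      using r by (auto simp: base_abs_def padic_abs_inverse of_rat_inverse)
    then have "base_abs r (of_nat q) < 1" using gt by (simp add: one_less_inverse_iff)
    then have "r = q" using base_abs_prime[OF q r] by simp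
    then show ?thesis using eq padic_abs_self[OF q] q1 by (simp add: base_abs_def)
  qed
  show "algebraic (inverse x)" "mahler_measure (inverse x) \<le> real q"
    using mahler_measure_radical_le[of "inverse x" d "inverse (of_nat q)" q "real q"] x d q q1 **
    by (auto simp: power_inverse of_rat_inverse)
qed

text \<open>The number 1 has absolute value 1 at every place of the rationals, so the radical bound
  applies with \<open>c = 1\<close>, and the choice of the place 0 is arbitrary.\<close>

lemma mahler_measure_root_of_unity:
  assumes "x ^ d = 1" "d > 0"
  shows "algebraic x" "mahler_measure x \<le> 1"
proof -
  have "base_abs r 1 = 1" if "r = 0 \<or> Factorial_Ring.prime r" for r
    using that padic_abs_of_int_eq_1[of r 1] prime_gt_1_nat[of r] by (auto simp: base_abs_def)
  then show "algebraic x" "mahler_measure x \<le> 1"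
    using mahler_measure_radical_le[of x d 1 0 1] assms by auto
qed

lemma mahler_measure_ge_1: "algebraic x \<Longrightarrow> mahler_measure x \<ge> 1"
  using minimal_poly_exists minimal_poly.mahler_measure_ge_1 by metis

section \<open>The strong metric Mahler measure\<close>

text \<open>Lists make products easy, by concatenation, and may repeat a factor;
  \<open>mahler_factorable_imp_seq\<close> returns to the sequences of the definition.\<close>

definition mahler_factorable :: "real \<Rightarrow> complex \<Rightarrow> bool" where
  "mahler_factorable B x \<longleftrightarrow>
     (\<exists>xs. prod_list xs = x \<and> (\<forall>y\<in>set xs. algebraic y \<and> y \<noteq> 0 \<and> mahler_measure y \<le> B))"

lemma mahler_factorable_single:
  "algebraic x \<Longrightarrow> x \<noteq> 0 \<Longrightarrow> mahler_measure x \<le> B \<Longrightarrow> mahler_factorable B x"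
  unfolding mahler_factorable_def by (intro exI[of _ "[x]"]) simp

lemma mahler_factorable_1: "mahler_factorable B 1"
  unfolding mahler_factorable_def by (intro exI[of _ "[]"]) simp

lemma mahler_factorable_mult:
  "mahler_factorable B x \<Longrightarrow> mahler_factorable B y \<Longrightarrow> mahler_factorable B (x * y)"
  unfolding mahler_factorable_def
proof (elim exE conjE)
  fix xs ys
  assume "prod_list xs = x" "prod_list ys = y"
    "\<forall>y\<in>set xs. algebraic y \<and> y \<noteq> 0 \<and> mahler_measure y \<le> B"
    "\<forall>y\<in>set ys. algebraic y \<and> y \<noteq> 0 \<and> mahler_measure y \<le> B"
  then show "\<exists>xs. prod_list xs = x * y \<and> (\<forall>y\<in>set xs. algebraic y \<and> y \<noteq> 0 \<and> mahler_measure y \<le> B)"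
    by (intro exI[of _ "xs @ ys"]) auto
qed

lemma mahler_factorable_power: "mahler_factorable B x \<Longrightarrow> mahler_factorable B (x ^ k)"
  by (induction k) (auto intro: mahler_factorable_1 mahler_factorable_mult)

lemma mahler_factorable_prod:
  "(\<And>i. i \<in> I \<Longrightarrow> mahler_factorable B (g i)) \<Longrightarrow> mahler_factorable B (prod g I)"
  by (induction I rule: infinite_finite_induct)
    (auto intro: mahler_factorable_1 mahler_factorable_mult)

lemma mahler_factorable_imp_seq:
  assumes "mahler_factorable B x" "B \<ge> 1"
  obtains s where "s \<in> alg_seqs" "seq_prod s = x" "\<And>n. mahler_measure (s n) \<le> B"
proof -
  obtain xs where xs: "prod_list xs = x"
    "\<And>y. y \<in> set xs \<Longrightarrow> algebraic y \<and> y \<noteq> 0 \<and> mahler_measure y \<le> B"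
    using assms(1) unfolding mahler_factorable_def by blast
  define s where "s i = (if i < length xs then xs ! i else 1)" for i
  have sub: "{i. s i \<noteq> 1} \<subseteq> {..<length xs}" by (auto simp: s_def)
  show ?thesis
  proof (rule that)
    show "s \<in> alg_seqs"
      using finite_subset[OF sub] xs(2) by (auto simp: alg_seqs_def s_def)
    have "seq_prod s = (\<Prod>i<length xs. s i)"
      unfolding seq_prod_def using sub by (intro prod.mono_neutral_left) auto
    also have "\<dots> = (\<Prod>i<length xs. xs ! i)" by (simp add: s_def)
    also have "\<dots> = x" using xs(1) by (simp add: prod.list_conv_set_nth atLeast0LessThan)
    finally show "seq_prod s = x" .
    \<comment> \<open>The list is padded by infinitely many ones, whose Mahler measure has to be
      covered by \<open>B\<close> too.\<close>
    have "mahler_measure 1 \<le> B" using mahler_measure_root_of_unity(2)[of 1 1] assms(2) by simp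
    then show "mahler_measure (s i) \<le> B" for i using xs(2) by (auto simp: s_def)
  qed
qed

text \<open>A \<open>d\<close>-th root of \<open>N\<close> is a product of \<open>d\<close>-th roots
  of its primes, each repeated according to its multiplicity; repetition does not change the bound
  \<open>B\<close>.\<close>

lemma prime_power_radical:
  assumes d: "d > 0" and N: "N > 0" and B: "\<And>q. q \<in> prime_factors N \<Longrightarrow> real q \<le> B"
  obtains x where "x ^ d = of_nat N" "mahler_factorable B x" "mahler_factorable B (inverse x)"
proof -
  define \<rho> where "\<rho> q = (of_real (root d (real q)) :: complex)" for q
  have \<rho>: "\<rho> q ^ d = of_nat q" for q
    using d by (simp add: \<rho>_def flip: of_real_power)
  have fact: "mahler_factorable B (\<rho> q)" "mahler_factorable B (inverse (\<rho> q))"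
    if "q \<in> prime_factors N" for q
  proof -
    have q: "Factorial_Ring.prime q" using that by auto
    have "\<rho> q \<noteq> 0" using \<rho>[of q] prime_gt_0_nat[OF q] d by (auto simp: power_0_left)
    then show "mahler_factorable B (\<rho> q)" "mahler_factorable B (inverse (\<rho> q))"
      using mahler_measure_prime_radical[OF \<rho> d q] B[OF that]
      by (auto intro!: mahler_factorable_single)
  qed
  define x where "x = (\<Prod>q\<in>prime_factors N. \<rho> q ^ multiplicity q N)"
  have "x ^ d = (\<Prod>q\<in>prime_factors N. (\<rho> q ^ d) ^ multiplicity q N)"
    by (simp add: x_def prod_power_distrib mult.commute flip: power_mult)
  also have "\<dots> = of_nat (\<Prod>q\<in>prime_factors N. q ^ multiplicity q N)" by (simp add: \<rho>)
  also have "(\<Prod>q\<in>prime_factors N. q ^ multiplicity q N) = N"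
    using prod_prime_factors[of N] N by simp
  finally have 1: "x ^ d = of_nat N" .
  have 2: "mahler_factorable B x"
    unfolding x_def by (intro mahler_factorable_prod mahler_factorable_power fact)
  have "inverse x = (\<Prod>q\<in>prime_factors N. inverse (\<rho> q) ^ multiplicity q N)"
    by (simp add: x_def power_inverse flip: prod_inversef)
  then have 3: "mahler_factorable B (inverse x)"
    by (simp only:) (intro mahler_factorable_prod mahler_factorable_power fact)
  show ?thesis by (rule that[OF 1 2 3])
qed

lemma finite_rat_primes:
  assumes "\<alpha> \<noteq> 0" shows "finite (rat_primes \<alpha>)"
proof -
  obtain a b where ab: "quotient_of \<alpha> = (a, b)" by (cases "quotient_of \<alpha>")
  have "b \<noteq> 0" "a \<noteq> 0" using quotient_of_denom_pos[OF ab] quotient_of_div[OF ab] assms by auto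
  then have "finite {q. Factorial_Ring.prime q \<and> int q dvd a}" "finite {q. Factorial_Ring.prime q \<and> int q dvd b}"
    using padic_abs_prod(2) by blast+
  moreover have "rat_primes \<alpha> = {q. Factorial_Ring.prime q \<and> int q dvd a} \<union> {q. Factorial_Ring.prime q \<and> int q dvd b}"
    by (auto simp: rat_primes_def ab)
  ultimately show ?thesis by simp
qed

text \<open>In lowest terms \<open>p\<close> divides exactly one of numerator and denominator, so
  the two multiplicities cannot cancel.\<close>

lemma padic_abs_rat_primes:
  assumes "\<alpha> \<noteq> 0" "p \<in> rat_primes \<alpha>" shows "padic_abs p \<alpha> \<noteq> 1"
proof -
  obtain a b where ab: "quotient_of \<alpha> = (a, b)" by (cases "quotient_of \<alpha>")
  have p: "Factorial_Ring.prime p" "int p dvd a \<or> int p dvd b" using assms(2) ab by (auto simp: rat_primes_def)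
  have p1: "real p > 1" using prime_gt_1_nat[OF p(1)] by simp
  have nz: "b \<noteq> 0" "a \<noteq> 0" using quotient_of_denom_pos[OF ab] quotient_of_div[OF ab] assms by auto
  have np: "\<not> is_unit (int p)" using prime_gt_1_nat[OF p(1)] by simp
  have "\<not> (int p dvd a \<and> int p dvd b)"
    using quotient_of_coprime[OF ab] np coprime_common_divisor by blast
  then have "multiplicity (int p) b \<noteq> multiplicity (int p) a"
    using p(2) nz np multiplicity_gt_zero_iff[of _ "int p"] not_dvd_imp_multiplicity_0
    by (metis less_irrefl)
  then have "real p powr of_int (int (multiplicity (int p) b) - int (multiplicity (int p) a)) \<noteq> 1"
    using p1 by (simp add: powr_eq_one_iff)
  also have "real p powr of_int (int (multiplicity (int p) b) - int (multiplicity (int p) a)) = padic_abs p \<alpha>"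
    using assms(1) ab p1 by (subst powr_real_of_int') (simp_all add: padic_abs_def)
  finally show ?thesis .
qed

theorem corollary1p4:
  fixes \<alpha> :: rat and d :: nat and \<beta> :: complex
  assumes "\<alpha> \<noteq> 0" and "d > 0"
    and "\<beta> ^ d = of_rat \<alpha>"
  shows "strong_metric_mahler \<beta> = real (largest_prime \<alpha>)"
proof -
  define P where "P = real (largest_prime \<alpha>)"
  define S where "S = {Max (range (\<lambda>n. mahler_measure (a n))) | a. a \<in> alg_seqs \<and> seq_prod a = \<beta>}"
  have fin: "finite (range (\<lambda>n. mahler_measure (a n)))" if "a \<in> alg_seqs" for a
  proof (rule finite_subset)
    show "range (\<lambda>n. mahler_measure (a n)) \<subseteq>
        insert (mahler_measure 1) ((\<lambda>n. mahler_measure (a n)) ` {n. a n \<noteq> 1})"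
      by auto
    show "finite (insert (mahler_measure 1) ((\<lambda>n. mahler_measure (a n)) ` {n. a n \<noteq> 1}))"
      using that by (simp add: alg_seqs_def)
  qed
  have prime_le: "real q \<le> P" if "q \<in> rat_primes \<alpha>" for q
    using that finite_rat_primes[OF assms(1)] by (auto simp: P_def largest_prime_def intro: Max_ge)
  have P1: "P \<ge> 1"
  proof (cases "rat_primes \<alpha> = {}")
    case False
    then obtain q where q: "q \<in> rat_primes \<alpha>" by blast
    then have "Factorial_Ring.prime q" by (simp add: rat_primes_def)
    then have "real q \<ge> 1" using prime_ge_1_nat by simp
    then show ?thesis using prime_le[OF q] by simp
  qed (simp add: P_def largest_prime_def)
  have lower: "P \<le> s" if s: "s \<in> S" for s
  proof -
    obtain a where a: "a \<in> alg_seqs" "seq_prod a = \<beta>" "s = Max (range (\<lambda>n. mahler_measure (a n)))"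
      using s unfolding S_def by blast
    have alg: "algebraic (a n)" "a n \<noteq> 0" for n using a(1) by (auto simp: alg_seqs_def)
    have le: "mahler_measure (a n) \<le> s" for n unfolding a(3) using fin[OF a(1)] by (intro Max_ge) auto
    show ?thesis
    proof (cases "rat_primes \<alpha> = {}")
      \<comment> \<open>The conventional value 1 for \<alpha> = 1 and \<alpha> = -1 is the trivial
        lower bound of the Mahler measure.\<close>
      case True
      then have "P = 1" by (simp add: P_def largest_prime_def)
      then show ?thesis using mahler_measure_ge_1[OF alg(1)[of 0]] le[of 0] by linarith
    next
      case False
      define p where "p = Max (rat_primes \<alpha>)"
      have P: "P = real p" using False by (simp add: P_def p_def largest_prime_def)
      have p: "p \<in> rat_primes \<alpha>" unfolding p_def using finite_rat_primes[OF assms(1)] False by (rule Max_in)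
      then have prime: "Factorial_Ring.prime p" by (simp add: rat_primes_def)
      obtain u where u: "abs_val_field (Collect algebraic) u" "\<And>z. u (of_rat z) = padic_abs p z"
        using exists_padic_extension[OF prime] by metis
      interpret u: abs_val_field "Collect algebraic" u by (rule u(1))
      have prod: "u \<beta> = (\<Prod>n\<in>{n. a n \<noteq> 1}. u (a n))"
        unfolding a(2)[symmetric] seq_prod_def using alg by (intro u.v_prod) simp
      have "\<beta> \<in> Collect algebraic"
        unfolding a(2)[symmetric] seq_prod_def using alg by (intro u.prod_mem) simp
      then have "u \<beta> ^ d = padic_abs p \<alpha>" using assms(3) u(2)[of \<alpha>] u.v_power[of \<beta> d] by simp
      then have "u \<beta> \<noteq> 1" using padic_abs_rat_primes[OF assms(1) p] by auto
      \<comment> \<open>A product with \<open>u\<close>-value different from 1 has a factor with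
        \<open>u\<close>-value different from 1.\<close>
      then obtain n where n: "u (a n) \<noteq> 1" unfolding prod by (metis prod.neutral)
      obtain f where "minimal_poly (a n) f" using minimal_poly_exists[OF alg(1)] .
      then have "mahler_measure (a n) \<ge> real p"
        using minimal_poly.mahler_measure_ge_prime[OF _ prime u alg(2) n] by blast
      then show ?thesis using le[of n] P by linarith
    qed
  qed
  have "mahler_factorable P \<beta>"
  proof -
    obtain k b where kb: "quotient_of \<alpha> = (k, b)" by (cases "quotient_of \<alpha>")
    have b: "b > 0" using quotient_of_denom_pos[OF kb] .
    have \<alpha>: "\<alpha> = of_int k / of_int b" using quotient_of_div[OF kb] .
    have k: "k \<noteq> 0" using \<alpha> assms(1) by auto
    have "real q \<le> P" if "q \<in> prime_factors (nat \<bar>k\<bar>)" for q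
      using that kb by (intro prime_le) (auto simp: rat_primes_def dvd_nat_abs_iff in_prime_factors_iff)
    then obtain x where x: "x ^ d = of_nat (nat \<bar>k\<bar>)" "mahler_factorable P x"
      using prime_power_radical[OF assms(2), of "nat \<bar>k\<bar>" P] k by auto
    have "real q \<le> P" if "q \<in> prime_factors (nat \<bar>b\<bar>)" for q
      using that kb by (intro prime_le) (auto simp: rat_primes_def dvd_nat_abs_iff in_prime_factors_iff simp del: abs_of_pos)
    then obtain y where y: "y ^ d = of_nat (nat \<bar>b\<bar>)" "mahler_factorable P (inverse y)"
      using prime_power_radical[OF assms(2), of "nat \<bar>b\<bar>" P] b by auto
    have nz: "x \<noteq> 0" "y \<noteq> 0" using x(1) y(1) k b assms(2) by (auto simp: power_0_left)
    \<comment> \<open>The root \<beta> may differ from the constructed \<open>x / y\<close> by a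
      root of unity. As \<open>x\<close> and \<open>y\<close> only see the absolute values of
      numerator and denominator, \<open>z ^ d\<close> is the sign of \<alpha>, and
      \<open>2 * d\<close> is an exponent that kills \<open>z\<close>.\<close>
    define z where "z = \<beta> / (x * inverse y)"
    have "z ^ d = of_int (sgn k)"
    proof -
      have "z ^ d = of_rat \<alpha> * of_int b / of_int \<bar>k\<bar>"
        using x(1) y(1) b nz by (simp add: z_def power_divide power_mult_distrib power_inverse assms(3) field_simps)
      also have "\<dots> = of_int k / of_int \<bar>k\<bar>" using b by (simp add: \<alpha> of_rat_divide)
      also have "\<dots> = of_int (sgn k)" using k by (cases "k > 0") (auto simp: sgn_if)
      finally show ?thesis .
    qed
    then have "z ^ (d * 2) = 1" using k by (simp add: power_mult sgn_if)
    moreover have "z \<noteq> 0"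
    proof
      assume "z = 0"
      then show False using \<open>z ^ d = of_int (sgn k)\<close> k assms(2) by (simp add: sgn_if power_0_left split: if_splits)
    qed
    ultimately have "mahler_factorable P z"
      using mahler_measure_root_of_unity[of z "d * 2"] assms(2) P1 by (intro mahler_factorable_single) auto
    then have "mahler_factorable P (z * (x * inverse y))"
      using x y by (intro mahler_factorable_mult)
    then show ?thesis using nz by (simp add: z_def)
  qed
  then obtain a where a: "a \<in> alg_seqs" "seq_prod a = \<beta>" "\<And>n. mahler_measure (a n) \<le> P"
    using mahler_factorable_imp_seq P1 by metis
  define s where "s = Max (range (\<lambda>n. mahler_measure (a n)))"
  have s: "s \<in> S" "s \<le> P" using a fin[OF a(1)] by (auto simp: S_def s_def)
  have "P \<in> S" using s lower[OF s(1)] by simp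
  then have "Inf S = P" using lower by (rule cInf_eq_minimum)
  then show ?thesis by (simp add: strong_metric_mahler_def S_def P_def)
qed

end
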